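(* Let $A$ be a regular weak multiplier Hopf algebra and let $H$ be the space of left cointegrals in $A$. Define a right action of $A_s$ on $A'$ by $\omega\leftharpoonup y=\omega(\cdot\, S(y))$ and a left action of $A_s$ on $H$ by $y\rightharpoonup h=hS(y)$, for $y\in A_s$, $\omega\in A'$, $h\in H$. Then the map $\omega\otimes h\mapsto(\omega\otimes id)\Delta(h)$, with values in $M(A)$, is well-defined and injective on the balanced tensor product $A'\otimes_{A_s}H$.
   Context: All algebras are over $\mathbb{C}$, associative, possibly non-unital, with non-degenerate product. $A$ is idempotent if $A^2=A$; $M(A)$ is the multiplier algebra (identity $1$); $A'$ is the space of all linear functionals on $A$. A coproduct is a homomorphism $\Delta:A\to M(A\otimes A)$ with $\Delta(a)(1\otimes b),(a\otimes 1)\Delta(b)\in A\otimes A$, coassociative: $(a\otimes1\otimes1)(\Delta\otimes id)(\Delta(b)(1\otimes c))=(id\otimes\Delta)((a\otimes1)\Delta(b))(1\otimes1\otimes c)$. Put $T_1(a\otimes b)=\Delta(a)(1\otimes b)$, $T_2(a\otimes b)=(a\otimes1)\Delta(b)$. $\Delta$ is full if the smallest subspaces $V,W\subset A$ with $\Delta(A)(1\otimes A)\subset V\otimes A$ and $(A\otimes1)\Delta(A)\subset A\otimes W$ both equal $A$. A counit is a linear functional $\varepsilon$ with $(\varepsilon\otimes id)(\Delta(a)(1\otimes b))=ab$, $(id\otimes\varepsilon)((c\otimes1)\Delta(a))=ca$. A weak multiplier Hopf algebra is a non-degenerate idempotent algebra $A$ with a full coproduct $\Delta$ and a counit such that: (i)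 there is an idempotent $E\in M(A\otimes A)$ with $T_1(A\otimes A)=E(A\otimes A)$, $T_2(A\otimes A)=(A\otimes A)E$; (ii) $(id\otimes\Delta)E=(E\otimes1)(1\otimes E)=(1\otimes E)(E\otimes1)$; (iii) $\mathrm{Ker}(T_i)=(1-G_i)(A\otimes A)$, $i=1,2$, where $G_1,G_2$ are the linear maps on $A\otimes A$ given by $(G_1\otimes id)(\Delta_{13}(a)(1\otimes b\otimes c))=\Delta_{13}(a)(1\otimes E)(1\otimes b\otimes c)$ and $(id\otimes G_2)((a\otimes b\otimes1)\Delta_{13}(c))=(a\otimes b\otimes1)(E\otimes1)\Delta_{13}(c)$. Here $\Delta$ (and likewise $id\otimes\Delta$) is uniquely extended to multipliers, with $\Delta(1)=E$. With Sweedler notation $\Delta(a)=\sum a_{(1)}\otimes a_{(2)}$, the antipode $S$ is the non-degenerate anti-homomorphism $A\to M(A)$ with $E(a\otimes b)=\sum a_{(1)}\otimes a_{(2)}S(a_{(3)})b$, $(a\otimes b)E=\sum aS(b_{(1)})b_{(2)}\otimes b_{(3)}$, $G_1(a\otimes b)=\sum a_{(1)}\otimes S(a_{(2)})a_{(3)}b$, $G_2(a\otimes b)=\sum ab_{(1)}S(b_{(2)})\otimes b_{(3)}$, $\sum S(a_{(1)})a_{(2)}S(a_{(3)})=S(a)$; it extends to $M(A)$. $A$ is regular if $S$ is bijective from $A$ to $A$; then also $\Delta(a)(b\otimes1),(1\otimes a)\Delta(b)\in A\otimes A$. Put $\varepsilon_t(a)=\sum a_{(1)}S(a_{(2)})$,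 $A_s=\{y\in M(A):\Delta(y)=E(1\otimes y)\}$. For $\omega\in A'$, $(\omega\otimes id)\Delta(a)\in M(A)$ is the multiplier with $((\omega\otimes id)\Delta(a))b=(\omega\otimes id)(\Delta(a)(1\otimes b))$ and $b((\omega\otimes id)\Delta(a))=(\omega\otimes id)((1\otimes b)\Delta(a))$. A left cointegral is a non-zero $h\in M(A)$ with $ah=\varepsilon_t(a)h$ for all $a\in A$. $H$ is the space of left cointegrals lying in $A$ (together with $0$). For $y\in M(A)$, $\omega(\cdot\,y)$ denotes the functional $a\mapsto\omega(ay)$. *)

theory Defs
  imports Complex_Main "HOL-Library.Poly_Mapping" "HOL-Library.Function_Algebras"
begin

section \<open>Complex vector spaces and complex algebras\<close>

class complex_vector = ab_group_add +
  fixes scaleC :: "complex \<Rightarrow> 'a \<Rightarrow> 'a"  (infixr \<open>*\<^sub>C\<close> 75)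
  assumes scaleC_add_right: "c *\<^sub>C (x + y) = c *\<^sub>C x + c *\<^sub>C y"
    and scaleC_add_left: "(c + d) *\<^sub>C x = c *\<^sub>C x + d *\<^sub>C x"
    and scaleC_scaleC: "c *\<^sub>C d *\<^sub>C x = (c * d) *\<^sub>C x"
    and scaleC_one: "1 *\<^sub>C x = x"

text \<open>Associative, not necessarily unital.\<close>

class complex_algebra = complex_vector + ring +
  assumes mult_scaleC_left: "(c *\<^sub>C x) * y = c *\<^sub>C (x * y)"
    and mult_scaleC_right: "x * (c *\<^sub>C y) = c *\<^sub>C (x * y)"

global_interpretation cvec: vector_space "scaleC :: complex \<Rightarrow> 'a \<Rightarrow> 'a::complex_vector"
  by unfold_locales (simp_all add: scaleC_add_right scaleC_add_left scaleC_scaleC scaleC_one)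

abbreviation clinear :: "('a::complex_vector \<Rightarrow> 'b::complex_vector) \<Rightarrow> bool"
  where "clinear f \<equiv> Vector_Spaces.linear scaleC scaleC f"

definition cbilinear :: "('a::complex_vector \<Rightarrow> 'b::complex_vector \<Rightarrow> 'c::complex_vector) \<Rightarrow> bool"
  where "cbilinear f \<longleftrightarrow> (\<forall>b. clinear (\<lambda>a. f a b)) \<and> (\<forall>a. clinear (\<lambda>b. f a b))"

lemma clinear_iff:
  "clinear f \<longleftrightarrow> (\<forall>x y. f (x + y) = f x + f y) \<and> (\<forall>c x. f (c *\<^sub>C x) = c *\<^sub>C f x)"
  unfolding Vector_Spaces.linear_iff by (auto intro: cvec.vector_space_axioms)

lemma clinearI:
  assumes "\<And>x y. f (x + y) = f x + f y" "\<And>c x. f (c *\<^sub>C x) = c *\<^sub>C f x"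
  shows "clinear f"
  using assms by (simp add: clinear_iff)

lemma clinear_add: "clinear f \<Longrightarrow> f (x + y) = f x + f y"
  and clinear_scaleC: "clinear f \<Longrightarrow> f (c *\<^sub>C x) = c *\<^sub>C f x"
  by (simp_all add: clinear_iff)

lemma clinear_zero: "clinear f \<Longrightarrow> f 0 = 0"
  by (metis add_cancel_right_right clinear_add)

lemma clinear_diff: "clinear f \<Longrightarrow> f (x - y) = f x - f y"
  by (metis add_diff_cancel_right' clinear_add diff_add_cancel)

lemma clinear_compose: "clinear f \<Longrightarrow> clinear g \<Longrightarrow> clinear (\<lambda>x. f (g x))"
  by (simp add: clinear_iff)

lemma clinear_ident: "clinear (\<lambda>x. x)"
  by (simp add: clinear_iff)

lemma cbilinearI:
  assumes "\<And>x y b. f (x + y) b = f x b + f y b" "\<And>c x b. f (c *\<^sub>C x) b = c *\<^sub>C f x b"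
    and "\<And>a x y. f a (x + y) = f a x + f a y" "\<And>a c x. f a (c *\<^sub>C x) = c *\<^sub>C f a x"
  shows "cbilinear f"
  using assms by (simp add: cbilinear_def clinear_iff)

lemma cbilinear_compose:
  assumes "clinear f" "clinear g" "cbilinear h"
  shows "cbilinear (\<lambda>a b. h (f a) (g b))"
  using assms by (simp add: cbilinear_def clinear_iff)

instantiation complex :: complex_algebra
begin
definition scaleC_complex :: "complex \<Rightarrow> complex \<Rightarrow> complex"
  where "scaleC_complex c x = c * x"
instance
  by standard (simp_all add: scaleC_complex_def algebra_simps)
end

instantiation "fun" :: (type, complex_vector) complex_vector
begin
definition scaleC_fun :: "complex \<Rightarrow> ('a \<Rightarrow> 'b) \<Rightarrow> 'a \<Rightarrow> 'b"
  where "scaleC_fun c f = (\<lambda>x. c *\<^sub>C f x)"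
instance
  by standard
    (simp_all add: scaleC_fun_def fun_eq_iff scaleC_add_right scaleC_add_left scaleC_scaleC scaleC_one)
end

instantiation poly_mapping :: (type, complex_vector) complex_vector
begin
lift_definition scaleC_poly_mapping :: "complex \<Rightarrow> ('a \<Rightarrow>\<^sub>0 'b) \<Rightarrow> 'a \<Rightarrow>\<^sub>0 'b"
  is "\<lambda>c f x. c *\<^sub>C f x"
  by (rule finite_subset[rotated]) auto
instance
  by (standard; transfer)
    (simp_all add: fun_eq_iff scaleC_add_right scaleC_add_left scaleC_scaleC scaleC_one)
end


section \<open>Tensor products over the complex numbers\<close>

inductive_set tensor_relators :: "(('a::complex_vector \<times> 'b::complex_vector) \<Rightarrow>\<^sub>0 complex) set"
  where
    "Poly_Mapping.single (a + a', b) 1 - Poly_Mapping.single (a, b) 1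
       - Poly_Mapping.single (a', b) 1 \<in> tensor_relators"
  | "Poly_Mapping.single (a, b + b') 1 - Poly_Mapping.single (a, b) 1
       - Poly_Mapping.single (a, b') 1 \<in> tensor_relators"
  | "Poly_Mapping.single (c *\<^sub>C a, b) 1 - c *\<^sub>C Poly_Mapping.single (a, b) 1 \<in> tensor_relators"
  | "Poly_Mapping.single (a, c *\<^sub>C b) 1 - c *\<^sub>C Poly_Mapping.single (a, b) 1 \<in> tensor_relators"

definition tensor_rel ::
    "(('a::complex_vector \<times> 'b::complex_vector) \<Rightarrow>\<^sub>0 complex) \<Rightarrow> (('a \<times> 'b) \<Rightarrow>\<^sub>0 complex) \<Rightarrow> bool"
  where "tensor_rel p q \<longleftrightarrow> p - q \<in> cvec.span tensor_relators"

quotient_type (overloaded) ('a, 'b) tensor =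
    "('a::complex_vector \<times> 'b::complex_vector) \<Rightarrow>\<^sub>0 complex" / tensor_rel
proof (rule equivpI)
  show "reflp (tensor_rel :: ('a \<times> 'b \<Rightarrow>\<^sub>0 complex) \<Rightarrow> _)"
    by (rule reflpI) (simp add: tensor_rel_def cvec.span_zero)
  show "symp (tensor_rel :: ('a \<times> 'b \<Rightarrow>\<^sub>0 complex) \<Rightarrow> _)"
    by (rule sympI) (metis tensor_rel_def cvec.span_neg minus_diff_eq)
  show "transp (tensor_rel :: ('a \<times> 'b \<Rightarrow>\<^sub>0 complex) \<Rightarrow> _)"
  proof (rule transpI)
    fix p q r :: "'a \<times> 'b \<Rightarrow>\<^sub>0 complex"
    assume "tensor_rel p q" "tensor_rel q r"
    then have "(p - q) + (q - r) \<in> cvec.span tensor_relators"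
      unfolding tensor_rel_def by (rule cvec.span_add)
    then show "tensor_rel p r" by (simp add: tensor_rel_def)
  qed
qed

instantiation tensor :: (complex_vector, complex_vector) complex_vector
begin

lift_definition zero_tensor :: "('a, 'b) tensor" is 0 .

lift_definition plus_tensor :: "('a, 'b) tensor \<Rightarrow> ('a, 'b) tensor \<Rightarrow> ('a, 'b) tensor" is "(+)"
  unfolding tensor_rel_def by (metis add_diff_add cvec.span_add)

lift_definition uminus_tensor :: "('a, 'b) tensor \<Rightarrow> ('a, 'b) tensor" is uminus
  unfolding tensor_rel_def by (metis cvec.span_neg minus_diff_minus)

lift_definition minus_tensor :: "('a, 'b) tensor \<Rightarrow> ('a, 'b) tensor \<Rightarrow> ('a, 'b) tensor" is "(-)"
  unfolding tensor_rel_def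
  by (metis (no_types, lifting) cvec.span_diff add_diff_add diff_conv_add_uminus minus_diff_minus)

lift_definition scaleC_tensor :: "complex \<Rightarrow> ('a, 'b) tensor \<Rightarrow> ('a, 'b) tensor" is "(*\<^sub>C)"
  unfolding tensor_rel_def by (metis cvec.span_scale cvec.scale_right_diff_distrib)

instance
  by (standard; transfer; simp add: tensor_rel_def cvec.span_zero algebra_simps
        scaleC_add_right scaleC_add_left scaleC_scaleC scaleC_one)

end

lift_definition tensor_prod :: "'a::complex_vector \<Rightarrow> 'b::complex_vector \<Rightarrow> ('a, 'b) tensor"
    (infixr \<open>\<otimes>\<close> 70)
  is "\<lambda>a b. Poly_Mapping.single (a, b) 1" .

lemma cbilinear_tensor_prod: "cbilinear (\<otimes>)"
  by (rule cbilinearI; transfer)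
    (auto simp: tensor_rel_def diff_diff_eq[symmetric]
       intro: cvec.span_base tensor_relators.intros)

lemma tensor_induct [case_names prod add]:
  assumes "\<And>a b. P (a \<otimes> b)" and "\<And>s t. P s \<Longrightarrow> P t \<Longrightarrow> P (s + t)"
  shows "P t"
proof -
  have scale: "v *\<^sub>C (a \<otimes> b) = (v *\<^sub>C a) \<otimes> b" for v and a :: 'a and b :: 'b
    using cbilinear_tensor_prod[where ?'a = 'a and ?'b = 'b] by (simp add: cbilinear_def clinear_iff)
  have "P (abs_tensor p)" for p :: "'a \<times> 'b \<Rightarrow>\<^sub>0 complex"
  proof (induction p rule: update_induct)
    case const
    have "abs_tensor 0 = 0 *\<^sub>C (0 \<otimes> 0 :: ('a, 'b) tensor)"
      by (simp only: cvec.scale_zero_left zero_tensor.abs_eq)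
    then show ?case using assms(1)[of "0 *\<^sub>C 0" 0] by (simp only: scale)
  next
    case (update p k v)
    obtain a b where k: "k = (a, b)" by (cases k)
    have "Poly_Mapping.update k v p = p + v *\<^sub>C Poly_Mapping.single k (1::complex)"
      using update(1)
      by (intro poly_mapping_eqI)
        (auto simp: lookup_update lookup_add scaleC_poly_mapping.rep_eq scaleC_complex_def
          lookup_single when_def not_in_keys_iff_lookup_eq_zero)
    then have "abs_tensor (Poly_Mapping.update k v p) = abs_tensor p + v *\<^sub>C (a \<otimes> b)"
      by (simp add: k plus_tensor.abs_eq scaleC_tensor.abs_eq tensor_prod.abs_eq)
    then show ?case using assms update by (simp add: scale)
  qed
  then show ?thesis by (induction t rule: tensor.abs_induct)
qed

lemma clinear_tensor_eqI:
  assumes "clinear F" "clinear G" "\<And>a b. F (a \<otimes> b) = G (a \<otimes> b)"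
  shows "F = G"
proof
  fix t show "F t = G t"
    by (induction t rule: tensor_induct) (simp_all add: assms clinear_add[OF assms(1)] clinear_add[OF assms(2)])
qed

definition tensor_lift ::
    "('a::complex_vector \<Rightarrow> 'b::complex_vector \<Rightarrow> 'c::complex_vector) \<Rightarrow> ('a, 'b) tensor \<Rightarrow> 'c"
  where "tensor_lift f = (THE F. clinear F \<and> (\<forall>a b. F (a \<otimes> b) = f a b))"

lemma tensor_lift_exists:
  fixes f :: "'a::complex_vector \<Rightarrow> 'b::complex_vector \<Rightarrow> 'c::complex_vector"
  assumes f: "cbilinear f"
  shows "\<exists>F. clinear F \<and> (\<forall>a b. F (a \<otimes> b) = f a b)"
proof -
  define \<phi> where "\<phi> p = (\<Sum>x\<in>Poly_Mapping.keys p. Poly_Mapping.lookup p x *\<^sub>C f (fst x) (snd x))"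
    for p :: "'a \<times> 'b \<Rightarrow>\<^sub>0 complex"
  have \<phi>: "\<phi> p = (\<Sum>x\<in>X. Poly_Mapping.lookup p x *\<^sub>C f (fst x) (snd x))"
    if "finite X" "Poly_Mapping.keys p \<subseteq> X" for p X
  proof -
    have "Poly_Mapping.lookup p x = 0" if "x \<in> X - Poly_Mapping.keys p" for x
      using that by (metis DiffD2 not_in_keys_iff_lookup_eq_zero)
    then show ?thesis
      unfolding \<phi>_def using that by (intro sum.mono_neutral_left) auto
  qed
  have \<phi>_add: "\<phi> (p + q) = \<phi> p + \<phi> q" for p q
  proof -
    let ?X = "Poly_Mapping.keys p \<union> Poly_Mapping.keys q"
    have "\<phi> (p + q) = (\<Sum>x\<in>?X. Poly_Mapping.lookup (p + q) x *\<^sub>C f (fst x) (snd x))"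
      by (rule \<phi>) (auto simp: keys_add)
    also have "\<dots> = \<phi> p + \<phi> q"
      by (simp add: \<phi>[of ?X p] \<phi>[of ?X q] lookup_add scaleC_add_left sum.distrib)
    finally show ?thesis .
  qed
  have \<phi>_scale: "\<phi> (c *\<^sub>C p) = c *\<^sub>C \<phi> p" for c p
  proof -
    have l: "Poly_Mapping.lookup (c *\<^sub>C p) x = c * Poly_Mapping.lookup p x" for x
      by transfer (simp add: scaleC_complex_def)
    have "\<phi> (c *\<^sub>C p) =
        (\<Sum>x\<in>Poly_Mapping.keys p. Poly_Mapping.lookup (c *\<^sub>C p) x *\<^sub>C f (fst x) (snd x))"
      by (rule \<phi>) (auto simp: in_keys_iff l)
    also have "\<dots> = c *\<^sub>C \<phi> p"
      by (simp add: \<phi>_def l cvec.scale_sum_right scaleC_scaleC)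
    finally show ?thesis .
  qed
  have lin: "clinear \<phi>" by (rule clinearI[OF \<phi>_add \<phi>_scale])
  have single: "\<phi> (Poly_Mapping.single (a, b) 1) = f a b" for a b
    by (simp add: \<phi>_def scaleC_one)
  have relator: "\<phi> r = 0" if "r \<in> tensor_relators" for r
    using that f
    by cases (simp_all add: clinear_diff[OF lin] \<phi>_scale single cbilinear_def clinear_iff)
  have "\<phi> r = 0" if "r \<in> cvec.span tensor_relators" for r
    using that
    by (induction rule: cvec.span_induct_alt)
      (simp_all add: clinear_zero[OF lin] \<phi>_add \<phi>_scale relator)
  then have resp: "\<phi> p = \<phi> q" if "tensor_rel p q" for p q
    using that clinear_diff[OF lin, of p q] by (simp add: tensor_rel_def)
  define F where "F t = \<phi> (rep_tensor t)" for t
  have F: "F (abs_tensor p) = \<phi> p" for p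
    unfolding F_def using Quotient3_rep_abs[OF Quotient3_tensor] Quotient3_tensor
    by (metis Quotient3_rel_rep Quotient3_abs_rep Quotient3_def resp tensor.abs_eq_iff)
  have "F (s + t) = F s + F t" for s t
    by (induction s rule: tensor.abs_induct, induction t rule: tensor.abs_induct)
      (simp add: F plus_tensor.abs_eq \<phi>_add)
  moreover have "F (c *\<^sub>C t) = c *\<^sub>C F t" for c t
    by (induction t rule: tensor.abs_induct) (simp add: F scaleC_tensor.abs_eq \<phi>_scale)
  moreover have "F (a \<otimes> b) = f a b" for a b
    by (simp add: F tensor_prod.abs_eq single)
  ultimately show ?thesis by (intro exI[of _ F]) (simp add: clinear_iff)
qed

lemma tensor_lift:
  assumes "cbilinear f"
  shows clinear_tensor_lift: "clinear (tensor_lift f)"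
    and tensor_lift_prod: "tensor_lift f (a \<otimes> b) = f a b"
proof -
  have "\<exists>!F. clinear F \<and> (\<forall>a b. F (a \<otimes> b) = f a b)"
    using tensor_lift_exists[OF assms] clinear_tensor_eqI by (metis (no_types, lifting))
  from theI'[OF this, folded tensor_lift_def]
  show "clinear (tensor_lift f)" "tensor_lift f (a \<otimes> b) = f a b" by blast+
qed

definition tensor_map ::
    "('a::complex_vector \<Rightarrow> 'c::complex_vector) \<Rightarrow> ('b::complex_vector \<Rightarrow> 'd::complex_vector)
      \<Rightarrow> ('a, 'b) tensor \<Rightarrow> ('c, 'd) tensor"
  where "tensor_map f g = tensor_lift (\<lambda>a b. f a \<otimes> g b)"

lemma tensor_map:
  assumes "clinear f" "clinear g"
  shows clinear_tensor_map: "clinear (tensor_map f g)"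
    and tensor_map_prod: "tensor_map f g (a \<otimes> b) = f a \<otimes> g b"
  unfolding tensor_map_def
  using tensor_lift[OF cbilinear_compose[OF assms cbilinear_tensor_prod]] by auto

text \<open>For subspaces \<open>V\<close>, \<open>W\<close> the space \<open>V \<otimes> W\<close> is realised inside the tensor product of the
  ambient spaces, into which it embeds because the scalars form a field.\<close>

definition tensor_sub :: "'a::complex_vector set \<Rightarrow> 'b::complex_vector set \<Rightarrow> ('a, 'b) tensor set"
  where "tensor_sub V W = cvec.span {v \<otimes> w |v w. v \<in> V \<and> w \<in> W}"

definition tensor_mult ::
    "('a::complex_algebra, 'b::complex_algebra) tensor \<Rightarrow> ('a, 'b) tensor \<Rightarrow> ('a, 'b) tensor"
  where "tensor_mult s t = tensor_lift (\<lambda>a b. tensor_map ((*) a) ((*) b) t) s"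

lemma clinear_mult_left: "clinear ((*) (a::'a::complex_algebra))"
  and clinear_mult_right: "clinear (\<lambda>x. x * (a::'a::complex_algebra))"
  by (simp_all add: clinear_iff distrib_left distrib_right mult_scaleC_left mult_scaleC_right)

lemma cbilinear_tensor_mult_aux:
  fixes t :: "('a::complex_algebra, 'b::complex_algebra) tensor"
  shows "cbilinear (\<lambda>a b. tensor_map ((*) a) ((*) b) t)"
proof -
  define M where "M a b = tensor_map ((*) a) ((*) b)" for a :: 'a and b :: 'b
  have lin: "clinear (M a b)" and prod: "M a b (c \<otimes> d) = (a * c) \<otimes> (b * d)" for a b c d
    unfolding M_def using tensor_map[OF clinear_mult_left clinear_mult_left] by auto
  have bil: "(a + a') \<otimes> b = a \<otimes> b + a' \<otimes> b" "a \<otimes> (b + b') = a \<otimes> b + a \<otimes> b'"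
    "(c *\<^sub>C a) \<otimes> b = c *\<^sub>C (a \<otimes> b)" "a \<otimes> (c *\<^sub>C b) = c *\<^sub>C (a \<otimes> b)"
    for a a' :: 'a and b b' :: 'b and c
    using cbilinear_tensor_prod[where ?'a = 'a and ?'b = 'b]
    by (simp_all add: cbilinear_def clinear_iff)
  have "M (a + a') b t = M a b t + M a' b t" "M a (b + b') t = M a b t + M a b' t"
    "M (c *\<^sub>C a) b t = c *\<^sub>C M a b t" "M a (c *\<^sub>C b) t = c *\<^sub>C M a b t" for a a' b b' c
    by (induction t rule: tensor_induct; simp add: prod bil distrib_right mult_scaleC_left
          clinear_add[OF lin] scaleC_add_right)+
  then show ?thesis
    unfolding M_def by (intro cbilinearI)
qed

lemma tensor_mult_prod: "tensor_mult (a \<otimes> b) (c \<otimes> d) = (a * c) \<otimes> (b * d)"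
  unfolding tensor_mult_def tensor_lift_prod[OF cbilinear_tensor_mult_aux]
  by (rule tensor_map_prod[OF clinear_mult_left clinear_mult_left])

lemma clinear_tensor_mult_left: "clinear (\<lambda>s. tensor_mult s t)"
  unfolding tensor_mult_def by (rule clinear_tensor_lift[OF cbilinear_tensor_mult_aux])

lemma clinear_tensor_mult_right: "clinear (tensor_mult s)"
proof (induction s rule: tensor_induct)
  case (prod a b)
  show ?case
    unfolding tensor_mult_def
    by (simp add: tensor_lift_prod[OF cbilinear_tensor_mult_aux]
        clinear_tensor_map[OF clinear_mult_left clinear_mult_left])
next
  case (add s s')
  then show ?case
    by (simp add: clinear_iff clinear_add[OF clinear_tensor_mult_left] scaleC_add_right algebra_simps)
qed

instantiation tensor :: (complex_algebra, complex_algebra) complex_algebra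
begin

definition times_tensor :: "('a, 'b) tensor \<Rightarrow> ('a, 'b) tensor \<Rightarrow> ('a, 'b) tensor"
  where "times_tensor = tensor_mult"

instance
proof
  note left = clinear_tensor_mult_left and right = clinear_tensor_mult_right
  fix r s t :: "('a, 'b) tensor" and c :: complex
  show "(r + s) * t = r * t + s * t" "(c *\<^sub>C s) * t = c *\<^sub>C (s * t)"
    unfolding times_tensor_def by (rule clinear_add[OF left] clinear_scaleC[OF left])+
  show "r * (s + t) = r * s + r * t" "s * (c *\<^sub>C t) = c *\<^sub>C (s * t)"
    unfolding times_tensor_def by (rule clinear_add[OF right] clinear_scaleC[OF right])+
  show "r * s * t = r * (s * t)"
    unfolding times_tensor_def
  proof (induction r rule: tensor_induct)
    case (prod a b)
    show ?case
    proof (induction s rule: tensor_induct)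
      case (prod c d)
      show ?case
        by (induction t rule: tensor_induct)
          (simp_all add: tensor_mult_prod mult.assoc clinear_add[OF right])
    qed (simp_all add: clinear_add[OF left] clinear_add[OF right])
  qed (simp_all add: clinear_add[OF left])
qed

end

lemma tensor_times_prod: "(a \<otimes> b) * (c \<otimes> d) = (a * c) \<otimes> (b * d)"
  by (simp add: times_tensor_def tensor_mult_prod)

text \<open>Threefold tensor products are nested to the right.\<close>

definition tensor_assoc ::
    "(('a::complex_vector, 'b::complex_vector) tensor, 'c::complex_vector) tensor
      \<Rightarrow> ('a, ('b, 'c) tensor) tensor"
  where "tensor_assoc = tensor_lift (\<lambda>s c. tensor_lift (\<lambda>a b. a \<otimes> b \<otimes> c) s)"

text \<open>\<open>(p \<otimes> q) \<otimes> b \<mapsto> p \<otimes> b \<otimes> q\<close>, moving the legs of an element of \<open>A \<otimes> A\<close> to positions 1 and 3.\<close>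

definition tensor_legs13 ::
    "(('a::complex_vector, 'b::complex_vector) tensor, 'c::complex_vector) tensor
      \<Rightarrow> ('a, ('c, 'b) tensor) tensor"
  where "tensor_legs13 = tensor_lift (\<lambda>s b. tensor_lift (\<lambda>p q. p \<otimes> b \<otimes> q) s)"

definition slice_left :: "('a::complex_vector \<Rightarrow> complex) \<Rightarrow> ('a, 'b::complex_vector) tensor \<Rightarrow> 'b"
  where "slice_left \<omega> = tensor_lift (\<lambda>p q. \<omega> p *\<^sub>C q)"

definition slice_right :: "('b::complex_vector \<Rightarrow> complex) \<Rightarrow> ('a::complex_vector, 'b) tensor \<Rightarrow> 'a"
  where "slice_right \<omega> = tensor_lift (\<lambda>p q. \<omega> q *\<^sub>C p)"


section \<open>Multiplier algebras\<close>

text \<open>A multiplier \<open>m\<close> is given by a pair of maps \<open>b \<mapsto> m b\<close> and \<open>a \<mapsto> a m\<close> with \<open>(a m) b = a (m b)\<close>.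
  If the product of the algebra is non-degenerate, the other conditions below are automatic.\<close>

typedef (overloaded) ('a::complex_algebra) multiplier =
  "{(L :: 'a \<Rightarrow> 'a, R :: 'a \<Rightarrow> 'a). clinear L \<and> clinear R
      \<and> (\<forall>a b. L (a * b) = L a * b) \<and> (\<forall>a b. R (a * b) = a * R b) \<and> (\<forall>a b. R a * b = a * L b)}"
  by (rule exI[of _ "(\<lambda>x. x, \<lambda>x. x)"]) (simp add: clinear_ident)

setup_lifting type_definition_multiplier

lift_definition mult_left :: "'a::complex_algebra multiplier \<Rightarrow> 'a \<Rightarrow> 'a"  (infixr \<open>\<rhd>\<close> 75) is fst .

lift_definition mult_right :: "'a::complex_algebra \<Rightarrow> 'a multiplier \<Rightarrow> 'a"  (infixl \<open>\<lhd>\<close> 75)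
  is "\<lambda>a m. snd m a" .

lemma multiplier_eq_iff: "m = n \<longleftrightarrow> (\<forall>a. m \<rhd> a = n \<rhd> a) \<and> (\<forall>a. a \<lhd> m = a \<lhd> n)"
  by transfer (auto simp: fun_eq_iff)

lemma clinear_multL: "clinear ((\<rhd>) m)"
  and clinear_multR: "clinear (\<lambda>a. a \<lhd> m)"
  and multL_mult: "m \<rhd> (a * b) = (m \<rhd> a) * b"
  and multR_mult: "(a * b) \<lhd> m = a * (b \<lhd> m)"
  and mult_balanced: "(a \<lhd> m) * b = a * (m \<rhd> b)"
  by (transfer; auto)+

instantiation multiplier :: (complex_algebra) "{complex_algebra, monoid_mult}"
begin

lift_definition zero_multiplier :: "'a multiplier" is "(\<lambda>_. 0, \<lambda>_. 0)"
  by (simp add: clinear_iff)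

lift_definition one_multiplier :: "'a multiplier" is "(\<lambda>x. x, \<lambda>x. x)"
  by (simp add: clinear_iff)

lift_definition plus_multiplier :: "'a multiplier \<Rightarrow> 'a multiplier \<Rightarrow> 'a multiplier"
  is "\<lambda>(L, R) (L', R'). (\<lambda>x. L x + L' x, \<lambda>x. R x + R' x)"
  by (auto simp: clinear_iff algebra_simps scaleC_add_right)

lift_definition uminus_multiplier :: "'a multiplier \<Rightarrow> 'a multiplier"
  is "\<lambda>(L, R). (\<lambda>x. - L x, \<lambda>x. - R x)"
  by (auto simp: clinear_iff)

lift_definition minus_multiplier :: "'a multiplier \<Rightarrow> 'a multiplier \<Rightarrow> 'a multiplier"
  is "\<lambda>(L, R) (L', R'). (\<lambda>x. L x - L' x, \<lambda>x. R x - R' x)"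
  by (auto simp: clinear_iff algebra_simps cvec.scale_right_diff_distrib)

lift_definition scaleC_multiplier :: "complex \<Rightarrow> 'a multiplier \<Rightarrow> 'a multiplier"
  is "\<lambda>c (L, R). (\<lambda>x. c *\<^sub>C L x, \<lambda>x. c *\<^sub>C R x)"
  by (auto simp: clinear_iff scaleC_add_right scaleC_scaleC mult.commute
      mult_scaleC_left mult_scaleC_right)

lift_definition times_multiplier :: "'a multiplier \<Rightarrow> 'a multiplier \<Rightarrow> 'a multiplier"
  is "\<lambda>(L, R) (L', R'). (\<lambda>x. L (L' x), \<lambda>x. R' (R x))"
  by (auto simp: clinear_iff)

lemma one_multL: "1 \<rhd> a = a" and one_multR: "a \<lhd> 1 = a"
  and zero_multL: "0 \<rhd> a = 0" and zero_multR: "a \<lhd> 0 = 0"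
  and times_multL: "(m * n) \<rhd> a = m \<rhd> n \<rhd> a" and times_multR: "a \<lhd> (m * n) = a \<lhd> m \<lhd> n"
  and plus_multL: "(m + n) \<rhd> a = m \<rhd> a + n \<rhd> a" and plus_multR: "a \<lhd> (m + n) = a \<lhd> m + a \<lhd> n"
  and minus_multL: "(m - n) \<rhd> a = m \<rhd> a - n \<rhd> a" and minus_multR: "a \<lhd> (m - n) = a \<lhd> m - a \<lhd> n"
  and uminus_multL: "(- m) \<rhd> a = - (m \<rhd> a)" and uminus_multR: "a \<lhd> (- m) = - (a \<lhd> m)"
  and scaleC_multL: "(c *\<^sub>C m) \<rhd> a = c *\<^sub>C (m \<rhd> a)" and scaleC_multR: "a \<lhd> (c *\<^sub>C m) = c *\<^sub>C (a \<lhd> m)"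
  by (transfer; auto)+

lemmas multiplier_simps = one_multL one_multR zero_multL zero_multR times_multL times_multR
  plus_multL plus_multR minus_multL minus_multR uminus_multL uminus_multR scaleC_multL scaleC_multR
  clinear_add[OF clinear_multL] clinear_add[OF clinear_multR]
  clinear_scaleC[OF clinear_multL] clinear_scaleC[OF clinear_multR]

instance
  by standard
    (simp_all add: multiplier_eq_iff multiplier_simps add.assoc add.commute
       scaleC_add_right scaleC_add_left scaleC_scaleC scaleC_one)

end

lift_definition embed :: "'a::complex_algebra \<Rightarrow> 'a multiplier" is "\<lambda>a. ((*) a, \<lambda>x. x * a)"
  by (simp add: clinear_mult_left clinear_mult_right mult.assoc)

lemma embed_multL: "embed a \<rhd> b = a * b" and embed_multR: "b \<lhd> embed a = b * a"
  by (transfer; simp)+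

text \<open>The algebra element a multiplier stands for; used for products that lie in the algebra.\<close>

definition element :: "'a::complex_algebra multiplier \<Rightarrow> 'a"
  where "element m = (THE a. embed a = m)"

lift_definition tensor_multiplier ::
    "'a::complex_algebra multiplier \<Rightarrow> 'b::complex_algebra multiplier \<Rightarrow> ('a, 'b) tensor multiplier"
    (infixr \<open>\<otimes>\<^sub>M\<close> 70)
  is "\<lambda>(L, R) (L', R'). (tensor_map L L', tensor_map R R')"
proof clarsimp
  fix L R :: "'a \<Rightarrow> 'a" and L' R' :: "'b \<Rightarrow> 'b"
  assume lin: "clinear L" "clinear R" "clinear L'" "clinear R'"
    and L: "\<forall>a b. L (a * b) = L a * b" "\<forall>a b. L' (a * b) = L' a * b"
    and R: "\<forall>a b. R (a * b) = a * R b" "\<forall>a b. R' (a * b) = a * R' b"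
    and LR: "\<forall>a b. R a * b = a * L b" "\<forall>a b. R' a * b = a * L' b"
  note cl = clinear_tensor_map[OF lin(1,3)] clinear_tensor_map[OF lin(2,4)]
  note simps = tensor_map_prod[OF lin(1,3)] tensor_map_prod[OF lin(2,4)] cl[THEN clinear_add]
    tensor_times_prod distrib_left distrib_right
  have 1: "tensor_map L L' (s * t) = tensor_map L L' s * t" for s t
  proof (induction s rule: tensor_induct)
    case (prod a b)
    show ?case by (induction t rule: tensor_induct) (simp_all add: simps L)
  qed (simp_all add: simps)
  have 2: "tensor_map R R' (s * t) = s * tensor_map R R' t" for s t
  proof (induction s rule: tensor_induct)
    case (prod a b)
    show ?case by (induction t rule: tensor_induct) (simp_all add: simps R)
  qed (simp_all add: simps)
  have 3: "tensor_map R R' s * t = s * tensor_map L L' t" for s t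
  proof (induction s rule: tensor_induct)
    case (prod a b)
    show ?case by (induction t rule: tensor_induct) (simp_all add: simps LR)
  qed (simp_all add: simps)
  show "clinear (tensor_map L L') \<and> clinear (tensor_map R R')
      \<and> (\<forall>s t. tensor_map L L' (s * t) = tensor_map L L' s * t)
      \<and> (\<forall>s t. tensor_map R R' (s * t) = s * tensor_map R R' t)
      \<and> (\<forall>s t. tensor_map R R' s * t = s * tensor_map L L' t)"
    by (intro conjI allI cl 1 2 3)
qed

lemma tensor_multiplier_multL: "(m \<otimes>\<^sub>M n) \<rhd> (a \<otimes> b) = (m \<rhd> a) \<otimes> (n \<rhd> b)"
  and tensor_multiplier_multR: "(a \<otimes> b) \<lhd> (m \<otimes>\<^sub>M n) = (a \<lhd> m) \<otimes> (b \<lhd> n)"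
proof -
  obtain L R where m: "Rep_multiplier m = (L, R)" "clinear L" "clinear R"
    using Rep_multiplier[of m] by auto
  obtain L' R' where n: "Rep_multiplier n = (L', R')" "clinear L'" "clinear R'"
    using Rep_multiplier[of n] by auto
  show "(m \<otimes>\<^sub>M n) \<rhd> (a \<otimes> b) = (m \<rhd> a) \<otimes> (n \<rhd> b)"
    "(a \<otimes> b) \<lhd> (m \<otimes>\<^sub>M n) = (a \<lhd> m) \<otimes> (b \<lhd> n)"
    using m n
    by (simp_all add: mult_left.rep_eq mult_right.rep_eq tensor_multiplier.rep_eq tensor_map_prod)
qed

definition transport ::
    "('a::complex_algebra \<Rightarrow> 'b::complex_algebra) \<Rightarrow> 'a multiplier \<Rightarrow> 'b multiplier"
  where "transport f m =
    (THE n. (\<forall>x. n \<rhd> f x = f (m \<rhd> x)) \<and> (\<forall>x. f x \<lhd> n = f (x \<lhd> m)))"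

text \<open>Extension of a homomorphism from the algebra to its multiplier algebra; for degenerate
  homomorphisms the value \<open>e\<close> at the identity has to be prescribed.\<close>

definition hom_extension ::
    "('a::complex_algebra \<Rightarrow> 'b::complex_algebra multiplier) \<Rightarrow> 'b multiplier
      \<Rightarrow> 'a multiplier \<Rightarrow> 'b multiplier"
  where "hom_extension f e =
    (THE F. clinear F \<and> (\<forall>x y. F (x * y) = F x * F y) \<and> (\<forall>a. F (embed a) = f a) \<and> F 1 = e)"

definition antihom_extension ::
    "('a::complex_algebra \<Rightarrow> 'b::complex_algebra multiplier) \<Rightarrow> 'a multiplier \<Rightarrow> 'b multiplier"
  where "antihom_extension f =
    (THE F. clinear F \<and> (\<forall>x y. F (x * y) = F y * F x) \<and> (\<forall>a. F (embed a) = f a) \<and> F 1 = 1)"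


section \<open>Weak multiplier Hopf algebras\<close>

definition T1 :: "('a::complex_algebra \<Rightarrow> ('a, 'a) tensor multiplier) \<Rightarrow> ('a, 'a) tensor \<Rightarrow> ('a, 'a) tensor"
  where "T1 \<Delta> = tensor_lift (\<lambda>a b. element (\<Delta> a * (1 \<otimes>\<^sub>M embed b)))"

definition T2 :: "('a::complex_algebra \<Rightarrow> ('a, 'a) tensor multiplier) \<Rightarrow> ('a, 'a) tensor \<Rightarrow> ('a, 'a) tensor"
  where "T2 \<Delta> = tensor_lift (\<lambda>a b. element ((embed a \<otimes>\<^sub>M 1) * \<Delta> b))"

definition coproduct_id ::
    "('a::complex_algebra \<Rightarrow> ('a, 'a) tensor multiplier)
      \<Rightarrow> ('a, 'a) tensor \<Rightarrow> ('a, ('a, 'a) tensor) tensor multiplier"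
  where "coproduct_id \<Delta> t = transport tensor_assoc (tensor_lift (\<lambda>a b. \<Delta> a \<otimes>\<^sub>M embed b) t)"

definition id_coproduct ::
    "('a::complex_algebra \<Rightarrow> ('a, 'a) tensor multiplier)
      \<Rightarrow> ('a, 'a) tensor \<Rightarrow> ('a, ('a, 'a) tensor) tensor multiplier"
  where "id_coproduct \<Delta> = tensor_lift (\<lambda>a b. embed a \<otimes>\<^sub>M \<Delta> b)"

definition coproduct :: "('a::complex_algebra \<Rightarrow> ('a, 'a) tensor multiplier) \<Rightarrow> bool"
  where "coproduct \<Delta> \<longleftrightarrow>
    clinear \<Delta> \<and> (\<forall>a b. \<Delta> (a * b) = \<Delta> a * \<Delta> b)
    \<and> (\<forall>a b. \<Delta> a * (1 \<otimes>\<^sub>M embed b) \<in> range embed)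
    \<and> (\<forall>a b. (embed a \<otimes>\<^sub>M 1) * \<Delta> b \<in> range embed)
    \<and> (\<forall>a b c. (embed a \<otimes>\<^sub>M 1 \<otimes>\<^sub>M 1) * coproduct_id \<Delta> (T1 \<Delta> (b \<otimes> c))
               = id_coproduct \<Delta> (T2 \<Delta> (a \<otimes> b)) * (1 \<otimes>\<^sub>M 1 \<otimes>\<^sub>M embed c))"

definition full_coproduct :: "('a::complex_algebra \<Rightarrow> ('a, 'a) tensor multiplier) \<Rightarrow> bool"
  where "full_coproduct \<Delta> \<longleftrightarrow>
    \<Inter>{V. cvec.subspace V \<and> (\<forall>a b. T1 \<Delta> (a \<otimes> b) \<in> tensor_sub V UNIV)} = UNIV
    \<and> \<Inter>{W. cvec.subspace W \<and> (\<forall>a b. T2 \<Delta> (a \<otimes> b) \<in> tensor_sub UNIV W)} = UNIV"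

definition counit ::
    "('a::complex_algebra \<Rightarrow> ('a, 'a) tensor multiplier) \<Rightarrow> ('a \<Rightarrow> complex) \<Rightarrow> bool"
  where "counit \<Delta> \<epsilon> \<longleftrightarrow> clinear \<epsilon>
    \<and> (\<forall>a b. slice_left \<epsilon> (T1 \<Delta> (a \<otimes> b)) = a * b)
    \<and> (\<forall>a c. slice_right \<epsilon> (T2 \<Delta> (c \<otimes> a)) = c * a)"

definition coproduct13 ::
    "('a::complex_algebra \<Rightarrow> ('a, 'a) tensor multiplier)
      \<Rightarrow> 'a \<Rightarrow> ('a, ('a, 'a) tensor) tensor multiplier"
  where "coproduct13 \<Delta> a = transport tensor_legs13 (\<Delta> a \<otimes>\<^sub>M 1)"

text \<open>\<open>E \<otimes> 1\<close> on \<open>A \<otimes> (A \<otimes> A)\<close>, whereas \<open>E \<otimes>\<^sub>M 1\<close> lives on \<open>(A \<otimes> A) \<otimes> A\<close>.\<close>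

definition E12 :: "('a::complex_algebra, 'a) tensor multiplier \<Rightarrow> ('a, ('a, 'a) tensor) tensor multiplier"
  where "E12 E = transport tensor_assoc (E \<otimes>\<^sub>M 1)"

definition map12 ::
    "(('a::complex_vector, 'a) tensor \<Rightarrow> ('a, 'a) tensor)
      \<Rightarrow> ('a, ('a, 'a) tensor) tensor \<Rightarrow> ('a, ('a, 'a) tensor) tensor"
  where "map12 G t = tensor_assoc (tensor_map G (\<lambda>x. x) (inv tensor_assoc t))"

definition is_G1 ::
    "('a::complex_algebra \<Rightarrow> ('a, 'a) tensor multiplier) \<Rightarrow> ('a, 'a) tensor multiplier
      \<Rightarrow> (('a, 'a) tensor \<Rightarrow> ('a, 'a) tensor) \<Rightarrow> bool"
  where "is_G1 \<Delta> E G \<longleftrightarrow> clinear G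
    \<and> (\<forall>a b c. embed (map12 G (element (coproduct13 \<Delta> a * (1 \<otimes>\<^sub>M embed b \<otimes>\<^sub>M embed c))))
               = coproduct13 \<Delta> a * (1 \<otimes>\<^sub>M E) * (1 \<otimes>\<^sub>M embed b \<otimes>\<^sub>M embed c))"

definition is_G2 ::
    "('a::complex_algebra \<Rightarrow> ('a, 'a) tensor multiplier) \<Rightarrow> ('a, 'a) tensor multiplier
      \<Rightarrow> (('a, 'a) tensor \<Rightarrow> ('a, 'a) tensor) \<Rightarrow> bool"
  where "is_G2 \<Delta> E G \<longleftrightarrow> clinear G
    \<and> (\<forall>a b c. embed (tensor_map (\<lambda>x. x) G
                 (element ((embed a \<otimes>\<^sub>M embed b \<otimes>\<^sub>M 1) * coproduct13 \<Delta> c)))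
               = (embed a \<otimes>\<^sub>M embed b \<otimes>\<^sub>M 1) * E12 E * coproduct13 \<Delta> c)"

text \<open>The counit \<open>\<epsilon>\<close>, the canonical idempotent \<open>E\<close> and the maps \<open>G1\<close>, \<open>G2\<close> are uniquely determined
  by \<open>\<Delta>\<close>; making them parameters only gives names to them. Since \<open>id \<otimes> \<Delta>\<close> is degenerate, its
  extension to multipliers is the one that sends \<open>1\<close> to \<open>1 \<otimes> \<Delta>(1) = 1 \<otimes> E\<close>.\<close>

locale weak_multiplier_hopf_algebra =
  fixes \<Delta> :: "'a::complex_algebra \<Rightarrow> ('a, 'a) tensor multiplier"
    and \<epsilon> :: "'a \<Rightarrow> complex"
    and E :: "('a, 'a) tensor multiplier"
    and G1 G2 :: "('a, 'a) tensor \<Rightarrow> ('a, 'a) tensor"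
  assumes nondegenerate_left: "(\<And>b::'a. a * b = 0) \<Longrightarrow> a = 0"
    and nondegenerate_right: "(\<And>b::'a. b * a = 0) \<Longrightarrow> a = 0"
    and idempotent_algebra: "cvec.span {a * b |a b :: 'a. True} = UNIV"
    and coproduct: "coproduct \<Delta>"
    and full_coproduct: "full_coproduct \<Delta>"
    and counit: "counit \<Delta> \<epsilon>"
    and E_idem: "E * E = E"
    and range_T1: "range (T1 \<Delta>) = range (\<lambda>x. E \<rhd> x)"
    and range_T2: "range (T2 \<Delta>) = range (\<lambda>x. x \<lhd> E)"
    and id_coproduct_E: "hom_extension (id_coproduct \<Delta>) (1 \<otimes>\<^sub>M E) E = E12 E * (1 \<otimes>\<^sub>M E)"
    and E_commute: "E12 E * (1 \<otimes>\<^sub>M E) = (1 \<otimes>\<^sub>M E) * E12 E"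
    and G1: "is_G1 \<Delta> E G1"
    and G2: "is_G2 \<Delta> E G2"
    and ker_T1: "{x. T1 \<Delta> x = 0} = range (\<lambda>x. x - G1 x)"
    and ker_T2: "{x. T2 \<Delta> x = 0} = range (\<lambda>x. x - G2 x)"

text \<open>\<open>R1 (a \<otimes> b)\<close> is \<open>\<Sum> a\<^sub>1 \<otimes> S(a\<^sub>2) b\<close>, an element of \<open>A \<otimes> A\<close> determined by its products
  with \<open>c \<otimes> 1\<close> from the left, where \<open>(c \<otimes> 1) \<Delta>(a)\<close> covers the first leg; similarly
  \<open>R2 (a \<otimes> b)\<close> is \<open>\<Sum> a S(b\<^sub>1) \<otimes> b\<^sub>2\<close>. The longer Sweedler expressions in the characterisation of
  the antipode are then composites; for example \<open>T1 (R1 (a \<otimes> b))\<close> is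
  \<open>\<Sum> a\<^sub>1 \<otimes> a\<^sub>2 S(a\<^sub>3) b\<close> and \<open>R1 (T1 (a \<otimes> b))\<close> is \<open>\<Sum> a\<^sub>1 \<otimes> S(a\<^sub>2) a\<^sub>3 b\<close>.\<close>

definition is_R1 ::
    "('a::complex_algebra \<Rightarrow> ('a, 'a) tensor multiplier) \<Rightarrow> ('a \<Rightarrow> 'a multiplier)
      \<Rightarrow> (('a, 'a) tensor \<Rightarrow> ('a, 'a) tensor) \<Rightarrow> bool"
  where "is_R1 \<Delta> S R \<longleftrightarrow> clinear R
    \<and> (\<forall>a b c. (embed c \<otimes>\<^sub>M 1) \<rhd> R (a \<otimes> b) = tensor_lift (\<lambda>p q. p \<otimes> (S q \<rhd> b)) (T2 \<Delta> (c \<otimes> a)))"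

definition is_R2 ::
    "('a::complex_algebra \<Rightarrow> ('a, 'a) tensor multiplier) \<Rightarrow> ('a \<Rightarrow> 'a multiplier)
      \<Rightarrow> (('a, 'a) tensor \<Rightarrow> ('a, 'a) tensor) \<Rightarrow> bool"
  where "is_R2 \<Delta> S R \<longleftrightarrow> clinear R
    \<and> (\<forall>a b c. R (a \<otimes> b) \<lhd> (1 \<otimes>\<^sub>M embed c) = tensor_lift (\<lambda>p q. (a \<lhd> S p) \<otimes> q) (T1 \<Delta> (b \<otimes> c)))"

text \<open>The last condition is \<open>\<Sum> S(a\<^sub>1) a\<^sub>2 S(a\<^sub>3) = S(a)\<close>, multiplied from the right by \<open>b\<close>.\<close>

definition antipode ::
    "('a::complex_algebra \<Rightarrow> ('a, 'a) tensor multiplier) \<Rightarrow> ('a, 'a) tensor multiplier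
      \<Rightarrow> (('a, 'a) tensor \<Rightarrow> ('a, 'a) tensor) \<Rightarrow> (('a, 'a) tensor \<Rightarrow> ('a, 'a) tensor)
      \<Rightarrow> ('a \<Rightarrow> 'a multiplier) \<Rightarrow> bool"
  where "antipode \<Delta> E G1 G2 S \<longleftrightarrow>
    clinear S \<and> (\<forall>a b. S (a * b) = S b * S a)
    \<and> cvec.span {S a \<rhd> b |a b. True} = UNIV \<and> cvec.span {b \<lhd> S a |a b. True} = UNIV
    \<and> (\<exists>R1 R2. is_R1 \<Delta> S R1 \<and> is_R2 \<Delta> S R2
        \<and> (\<forall>a b. E \<rhd> (a \<otimes> b) = T1 \<Delta> (R1 (a \<otimes> b)))
        \<and> (\<forall>a b. (a \<otimes> b) \<lhd> E = T2 \<Delta> (R2 (a \<otimes> b)))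
        \<and> (\<forall>a b. G1 (a \<otimes> b) = R1 (T1 \<Delta> (a \<otimes> b)))
        \<and> (\<forall>a b. G2 (a \<otimes> b) = R2 (T2 \<Delta> (a \<otimes> b)))
        \<and> (\<forall>a b. tensor_lift (\<lambda>p q. S p \<rhd> q) (T1 \<Delta> (R1 (a \<otimes> b))) = S a \<rhd> b))"

locale regular_weak_multiplier_hopf_algebra = weak_multiplier_hopf_algebra \<Delta> \<epsilon> E G1 G2
  for \<Delta> :: "'a::complex_algebra \<Rightarrow> ('a, 'a) tensor multiplier"
    and \<epsilon> E G1 G2 +
  fixes S :: "'a \<Rightarrow> 'a multiplier"
  assumes antipode: "antipode \<Delta> E G1 G2 S"
    and regular: "bij_betw S UNIV (range embed)"


section \<open>Cointegrals\<close>

text \<open>\<open>\<Sum> a\<^sub>1 S(a\<^sub>2)\<close>, as the multiplier with \<open>c (\<Sum> a\<^sub>1 S(a\<^sub>2)) = \<Sum> (c a\<^sub>1) S(a\<^sub>2)\<close>.\<close>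

definition eps_t ::
    "('a::complex_algebra \<Rightarrow> ('a, 'a) tensor multiplier) \<Rightarrow> ('a \<Rightarrow> 'a multiplier) \<Rightarrow> 'a \<Rightarrow> 'a multiplier"
  where "eps_t \<Delta> S a = (THE m. \<forall>c. c \<lhd> m = tensor_lift (\<lambda>p q. p \<lhd> S q) (T2 \<Delta> (c \<otimes> a)))"

definition source_algebra ::
    "('a::complex_algebra \<Rightarrow> ('a, 'a) tensor multiplier) \<Rightarrow> ('a, 'a) tensor multiplier \<Rightarrow> 'a multiplier set"
  where "source_algebra \<Delta> E = {y. hom_extension \<Delta> E y = E * (1 \<otimes>\<^sub>M y)}"

definition left_cointegral ::
    "('a::complex_algebra \<Rightarrow> ('a, 'a) tensor multiplier) \<Rightarrow> ('a \<Rightarrow> 'a multiplier) \<Rightarrow> 'a multiplier \<Rightarrow> bool"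
  where "left_cointegral \<Delta> S h \<longleftrightarrow> h \<noteq> 0 \<and> (\<forall>a. embed a * h = eps_t \<Delta> S a * h)"

definition cointegral_space ::
    "('a::complex_algebra \<Rightarrow> ('a, 'a) tensor multiplier) \<Rightarrow> ('a \<Rightarrow> 'a multiplier) \<Rightarrow> 'a set"
  where "cointegral_space \<Delta> S = {h. left_cointegral \<Delta> S (embed h)} \<union> {0}"

definition dual_space :: "('a::complex_vector \<Rightarrow> complex) set"
  where "dual_space = {\<omega>. clinear \<omega>}"

definition slice_coproduct ::
    "('a::complex_algebra \<Rightarrow> ('a, 'a) tensor multiplier) \<Rightarrow> ('a \<Rightarrow> complex) \<Rightarrow> 'a \<Rightarrow> 'a multiplier"
  where "slice_coproduct \<Delta> \<omega> a = (THE m.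
    (\<forall>b. m \<rhd> b = slice_left \<omega> (element (\<Delta> a * (1 \<otimes>\<^sub>M embed b))))
    \<and> (\<forall>b. b \<lhd> m = slice_left \<omega> (element ((1 \<otimes>\<^sub>M embed b) * \<Delta> a))))"

definition dual_action ::
    "('a::complex_algebra \<Rightarrow> 'a multiplier) \<Rightarrow> ('a \<Rightarrow> complex) \<Rightarrow> 'a multiplier \<Rightarrow> 'a \<Rightarrow> complex"
  where "dual_action S \<omega> y = (\<lambda>a. \<omega> (a \<lhd> antihom_extension S y))"

definition cointegral_action ::
    "('a::complex_algebra \<Rightarrow> 'a multiplier) \<Rightarrow> 'a multiplier \<Rightarrow> 'a \<Rightarrow> 'a"
  where "cointegral_action S y h = h \<lhd> antihom_extension S y"


section \<open>Balanced tensor products\<close>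

definition right_action ::
    "'y::{complex_algebra, monoid_mult} set \<Rightarrow> 'm::complex_vector set \<Rightarrow> ('m \<Rightarrow> 'y \<Rightarrow> 'm) \<Rightarrow> bool"
  where "right_action Y M r \<longleftrightarrow>
    (\<forall>m\<in>M. \<forall>y\<in>Y. r m y \<in> M)
    \<and> (\<forall>m\<in>M. \<forall>m'\<in>M. \<forall>y\<in>Y. r (m + m') y = r m y + r m' y)
    \<and> (\<forall>m\<in>M. \<forall>y\<in>Y. \<forall>z\<in>Y. r m (y + z) = r m y + r m z)
    \<and> (\<forall>c. \<forall>m\<in>M. \<forall>y\<in>Y. r (c *\<^sub>C m) y = c *\<^sub>C r m y \<and> r m (c *\<^sub>C y) = c *\<^sub>C r m y)
    \<and> (\<forall>m\<in>M. r m 1 = m)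
    \<and> (\<forall>m\<in>M. \<forall>y\<in>Y. \<forall>z\<in>Y. r m (y * z) = r (r m y) z)"

definition left_action ::
    "'y::{complex_algebra, monoid_mult} set \<Rightarrow> 'n::complex_vector set \<Rightarrow> ('y \<Rightarrow> 'n \<Rightarrow> 'n) \<Rightarrow> bool"
  where "left_action Y N l \<longleftrightarrow>
    (\<forall>n\<in>N. \<forall>y\<in>Y. l y n \<in> N)
    \<and> (\<forall>n\<in>N. \<forall>n'\<in>N. \<forall>y\<in>Y. l y (n + n') = l y n + l y n')
    \<and> (\<forall>n\<in>N. \<forall>y\<in>Y. \<forall>z\<in>Y. l (y + z) n = l y n + l z n)
    \<and> (\<forall>c. \<forall>n\<in>N. \<forall>y\<in>Y. l y (c *\<^sub>C n) = c *\<^sub>C l y n \<and> l (c *\<^sub>C y) n = c *\<^sub>C l y n)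
    \<and> (\<forall>n\<in>N. l 1 n = n)
    \<and> (\<forall>n\<in>N. \<forall>y\<in>Y. \<forall>z\<in>Y. l (y * z) n = l y (l z n))"

text \<open>\<open>M \<otimes>\<^sub>Y N\<close> is the quotient of \<open>M \<otimes> N\<close> by the span of the \<open>m y \<otimes> n - m \<otimes> y n\<close>.\<close>

definition balanced_rel ::
    "'m::complex_vector set \<Rightarrow> ('m \<Rightarrow> 'y \<Rightarrow> 'm) \<Rightarrow> 'y set \<Rightarrow> ('y \<Rightarrow> 'n \<Rightarrow> 'n) \<Rightarrow> 'n::complex_vector set
      \<Rightarrow> (('m, 'n) tensor \<times> ('m, 'n) tensor) set"
  where "balanced_rel M r Y l N = {(s, t). s \<in> tensor_sub M N \<and> t \<in> tensor_sub M N
    \<and> s - t \<in> cvec.span {r m y \<otimes> n - m \<otimes> l y n |m y n. m \<in> M \<and> y \<in> Y \<and> n \<in> N}}"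

definition balanced_tensor ::
    "'m::complex_vector set \<Rightarrow> ('m \<Rightarrow> 'y \<Rightarrow> 'm) \<Rightarrow> 'y set \<Rightarrow> ('y \<Rightarrow> 'n \<Rightarrow> 'n) \<Rightarrow> 'n::complex_vector set
      \<Rightarrow> ('m, 'n) tensor set set"
  where "balanced_tensor M r Y l N = tensor_sub M N // balanced_rel M r Y l N"

end

theory Submission
  imports Defs
begin

text \<open>
  Everything rests on \<open>(1 \<otimes> a) \<Delta>(h) = (S(a) \<otimes> 1) \<Delta>(h)\<close> for a cointegral \<open>h\<close>. If \<open>\<Sum> \<omega>\<^sub>i(h\<^sub>i\<^sub>1) h\<^sub>i\<^sub>2 = 0\<close>,
  it gives \<open>\<Sum> \<omega>\<^sub>i(a h\<^sub>i\<^sub>1) h\<^sub>i\<^sub>2 = 0\<close> for all \<open>a\<close>; applying \<open>\<Delta>\<close> to the second leg and multiplying the middle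
  leg back to the left, \<open>\<Sum> \<omega>\<^sub>i(a S\<^sup>-\<^sup>1(h\<^sub>i\<^sub>2) h\<^sub>i\<^sub>1) h\<^sub>i\<^sub>3 = \<Sum> \<omega>\<^sub>i(a S\<^sup>-\<^sup>1(E\<^sub>1)) h\<^sub>i E\<^sub>2\<close> vanishes. For fixed \<open>i\<close> the
  element \<open>S\<^sup>-\<^sup>2(E\<^sub>1) \<otimes> h\<^sub>i E\<^sub>2\<close> is a finite sum \<open>\<Sum> y\<^sub>k \<otimes> p\<^sub>k\<close> in \<open>A\<^sub>s \<otimes> H\<close> with \<open>\<Sum> p\<^sub>k S(y\<^sub>k) = h\<^sub>i\<close>, so modulo the
  balancing relations \<open>\<omega>\<^sub>i \<otimes> h\<^sub>i\<close> equals \<open>\<Sum> \<omega>\<^sub>i(\<cdot> S(y\<^sub>k)) \<otimes> p\<^sub>k\<close>, and the sum over \<open>i\<close> is zero.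

  Sweedler sums with an antipode are handled through the operators \<open>T1\<close>, \<open>T2\<close>, \<open>R1\<close>, \<open>R2\<close> on the legs of
  \<open>A \<otimes> A \<otimes> A\<close>. That \<open>S\<^sup>2\<close> maps the left leg of \<open>E\<close> onto itself follows from \<open>\<Delta>(S(a)) = (\<Sum> S(a\<^sub>2) \<otimes> S(a\<^sub>1)) E\<close>,
  which is the pentagon equation for \<open>T1\<close> read backwards for its generalised inverse \<open>R1\<close>.
\<close>

section \<open>Linear algebra of tensors\<close>

text \<open>The obstacle is that \<open>E\<close> and the values of \<open>\<Delta>\<close> are only
  multipliers: no Sweedler sum is finite until a leg is covered by an element of A. Identities are
  therefore tested with one leg multiplied by an arbitrary element, and non-degeneracy of that leg
  removes the test. The cointegral identity starts from E(a \<otimes> h) = \<Sum> a1 \<otimes>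
  \<open>\<epsilon>\<^sub>t\<close>(a2) h = \<Delta>(a)(1 \<otimes> h). The sum \<Sum> y_k \<otimes>
  p_k is finite by regularity: for h = x y, the element (1 \<otimes> x) \<Delta>(y) lies in A
  \<otimes> A, and (1 \<otimes> h) E = \<Sum> \<open>eps_s\<close>(y1) \<otimes> x y2. If the left
  legs are chosen independent, each right leg inherits the cointegral equation of h. The preimages
  of the left legs under S^2 come from \<open>\<epsilon>\<^sub>t\<close>(S(a)) =
  S(\<open>eps_s\<close>(a)) and \<open>eps_s\<close>(S(a)) =
  S(\<open>\<epsilon>\<^sub>t\<close>(a)). They lie in the source algebra because (\<Delta>
  \<otimes> id)(E) = (1 \<otimes> E)(E \<otimes> 1), which is not among the axioms and is derived
  from the pentagon equations.\<close>

lemma tensor_prod_add_left: "(a + a') \<otimes> b = a \<otimes> b + a' \<otimes> b"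
  and tensor_prod_add_right: "a \<otimes> (b + b') = a \<otimes> b + a \<otimes> b'"
  and tensor_prod_scale_left: "(c *\<^sub>C a) \<otimes> b = c *\<^sub>C (a \<otimes> b)"
  and tensor_prod_scale_right: "a \<otimes> (c *\<^sub>C b) = c *\<^sub>C (a \<otimes> b)"
  using cbilinear_tensor_prod[where ?'a = 'a and ?'b = 'b]
  by (simp_all add: cbilinear_def clinear_iff)

lemma clinear_tensor_prod_left: "clinear (\<lambda>a. a \<otimes> b)"
  and clinear_tensor_prod_right: "clinear (\<lambda>b. a \<otimes> b)"
  using cbilinear_tensor_prod by (auto simp: cbilinear_def)

lemma tensor_prod_zero_left [simp]: "0 \<otimes> b = 0"
  and tensor_prod_zero_right [simp]: "a \<otimes> 0 = 0"
  by (rule clinear_zero[OF clinear_tensor_prod_left] clinear_zero[OF clinear_tensor_prod_right])+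

lemma tensor_prod_diff_right: "a \<otimes> (b - b') = a \<otimes> b - a \<otimes> b'"
  by (rule clinear_diff[OF clinear_tensor_prod_right])

lemma clinear_sum: "clinear f \<Longrightarrow> f (sum g A) = (\<Sum>x\<in>A. f (g x))"
  by (induction A rule: infinite_finite_induct) (simp_all add: clinear_zero clinear_add)

lemma clinear_plus: "clinear f \<Longrightarrow> clinear g \<Longrightarrow> clinear (\<lambda>x. f x + g x)"
  by (simp add: clinear_iff algebra_simps scaleC_add_right)

lemma clinear_minus: "clinear f \<Longrightarrow> clinear g \<Longrightarrow> clinear (\<lambda>x. f x - g x)"
  by (simp add: clinear_iff algebra_simps cvec.scale_right_diff_distrib)

lemma clinear_const_zero: "clinear (\<lambda>_. 0)"
  by (simp add: clinear_iff)

lemma clinear_inv: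
  assumes "clinear f" "bij f"
  shows "clinear (inv f)"
proof (rule clinearI)
  have surj: "f (inv f y) = y" for y using assms(2) by (simp add: bij_is_surj surj_f_inv_f)
  have inj: "inj f" using assms(2) by (rule bij_is_inj)
  show "inv f (x + y) = inv f x + inv f y" for x y
    by (rule injD[OF inj]) (simp add: surj clinear_add[OF assms(1)])
  show "inv f (c *\<^sub>C x) = c *\<^sub>C inv f x" for c x
    by (rule injD[OF inj]) (simp add: surj clinear_scaleC[OF assms(1)])
qed

lemma subspace_range: "clinear f \<Longrightarrow> cvec.subspace (range f)"
  unfolding cvec.subspace_def
  by (auto simp flip: clinear_add clinear_scaleC) (metis clinear_zero rangeI)

lemma subspace_kernel: "clinear f \<Longrightarrow> clinear g \<Longrightarrow> cvec.subspace {x. f x = g x}"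
  unfolding cvec.subspace_def by (auto simp: clinear_add clinear_scaleC clinear_zero)

lemma clinear_extend:
  fixes f :: "'a::complex_vector \<Rightarrow> 'b::complex_vector"
  assumes "\<not> cvec.dependent B"
  obtains g where "clinear g" "\<And>x. x \<in> B \<Longrightarrow> g x = f x"
proof -
  interpret vector_space_pair "scaleC :: complex \<Rightarrow> 'a \<Rightarrow> 'a" "scaleC :: complex \<Rightarrow> 'b \<Rightarrow> 'b"
    by unfold_locales
  show ?thesis using linear_independent_extend[OF assms] that by metis
qed

lemma functional_separates:
  fixes v :: "'a::complex_vector"
  assumes "\<And>f :: 'a \<Rightarrow> complex. clinear f \<Longrightarrow> f v = 0"
  shows "v = 0"
proof (rule ccontr)
  assume "v \<noteq> 0"
  then have "\<not> cvec.dependent {v}" by simp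
  then obtain g :: "'a \<Rightarrow> complex" where "clinear g" "g v = 1"
    using clinear_extend[of "{v}" "\<lambda>_. 1 :: complex"] by blast
  with assms[of g] show False by simp
qed

lemma linear_projection:
  fixes V :: "'a::complex_vector set"
  assumes "cvec.subspace V"
  obtains P where "clinear P" "\<And>x. P x \<in> V" "\<And>x. x \<in> V \<Longrightarrow> P x = x"
proof -
  interpret vector_space_pair "scaleC :: complex \<Rightarrow> 'a \<Rightarrow> 'a" "scaleC :: complex \<Rightarrow> 'a \<Rightarrow> 'a"
    by unfold_locales
  obtain P where "P ` UNIV \<subseteq> V" "clinear P" "\<forall>v\<in>V. P v = v"
    using linear_exists_left_inverse_on[OF clinear_ident assms] by (auto simp: inj_on_def)
  then show ?thesis using that by blast
qed

text \<open>Once the first legs form an independent set, the tensor determines the second legs, and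
  functionals dual to \<open>I\<close> can read them off. Taking the set inside \<open>V\<close>
  keeps the information that the first legs lie there.\<close>

lemma tensor_sub_independent_sum:
  assumes V: "cvec.subspace V" and t: "t \<in> tensor_sub V UNIV"
  obtains I p where "finite I" "I \<subseteq> V" "\<not> cvec.dependent I" "t = (\<Sum>v\<in>I. v \<otimes> p v)"
proof -
  obtain Bs where Bs: "Bs \<subseteq> V" "\<not> cvec.dependent Bs" "V \<subseteq> cvec.span Bs"
    using cvec.maximal_independent_subset by blast
  have "\<exists>I p. finite I \<and> I \<subseteq> Bs \<and> t = (\<Sum>v\<in>I. v \<otimes> p v)"
    using t unfolding tensor_sub_def
  proof (induction rule: cvec.span_induct_alt)
    case base
    show ?case by (intro exI[of _ "{}"]) simp
  next
    case (step c x y)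
    then obtain v w where x: "x = v \<otimes> w" "v \<in> V" by blast
    obtain J r where J: "finite J" "J \<subseteq> Bs" "v = (\<Sum>b\<in>J. r b *\<^sub>C b)"
      using x(2) Bs(3) unfolding cvec.span_explicit by blast
    obtain I p where I: "finite I" "I \<subseteq> Bs" "y = (\<Sum>v\<in>I. v \<otimes> p v)" using step by blast
    \<comment> \<open>Zero terms outside \<open>I\<close> and outside \<open>J\<close> put both sums
      over the common index set \<open>I \<union> J\<close>.\<close>
    define q where "q b = (if b \<in> I then p b else 0) + (if b \<in> J then (c * r b) *\<^sub>C w else 0)" for b
    have "y = (\<Sum>b\<in>I \<union> J. b \<otimes> (if b \<in> I then p b else 0))"
      unfolding I(3) using I(1) J(1) by (intro sum.mono_neutral_cong_left) auto
    moreover have "c *\<^sub>C x = (\<Sum>b\<in>J. b \<otimes> ((c * r b) *\<^sub>C w))"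
      unfolding x J(3) clinear_sum[OF clinear_tensor_prod_left]
      by (simp add: cvec.scale_sum_right tensor_prod_scale_left tensor_prod_scale_right
          scaleC_scaleC)
    moreover have "\<dots> = (\<Sum>b\<in>I \<union> J. b \<otimes> (if b \<in> J then (c * r b) *\<^sub>C w else 0))"
      using I(1) J(1) by (intro sum.mono_neutral_cong_left) auto
    ultimately have "c *\<^sub>C x + y = (\<Sum>b\<in>I \<union> J. b \<otimes> q b)"
      by (simp add: q_def tensor_prod_add_right sum.distrib)
    then show ?case using I(1,2) J(1,2) by (intro exI[of _ "I \<union> J"] exI[of _ q]) auto
  qed
  then obtain I p where "finite I" "I \<subseteq> Bs" "t = (\<Sum>v\<in>I. v \<otimes> p v)" by blast
  then show ?thesis using that[of I p] Bs cvec.dependent_mono by blast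
qed

lemma tensor_sub_UNIV: "tensor_sub UNIV UNIV = UNIV"
proof -
  have "t \<in> tensor_sub UNIV UNIV" for t :: "('a, 'b) tensor"
    unfolding tensor_sub_def
    by (induction t rule: tensor_induct) (auto intro: cvec.span_base cvec.span_add)
  then show ?thesis by auto
qed

lemma cbilinear_slice: "clinear \<omega> \<Longrightarrow> cbilinear (\<lambda>p q. \<omega> p *\<^sub>C q)" "clinear \<omega>
    \<Longrightarrow> cbilinear (\<lambda>p q. \<omega> q *\<^sub>C p)"
  by (auto intro!: cbilinearI simp: clinear_add clinear_scaleC scaleC_add_left scaleC_add_right
      scaleC_scaleC scaleC_complex_def mult.commute)

lemma clinear_slice_left: "clinear \<omega> \<Longrightarrow> clinear (slice_left \<omega>)"
  and slice_left_prod: "clinear \<omega> \<Longrightarrow> slice_left \<omega> (p \<otimes> q) = \<omega> p *\<^sub>C q"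
  unfolding slice_left_def by (simp_all add: tensor_lift cbilinear_slice)

lemma clinear_slice_right: "clinear \<omega> \<Longrightarrow> clinear (slice_right \<omega>)"
  and slice_right_prod: "clinear \<omega> \<Longrightarrow> slice_right \<omega> (p \<otimes> q) = \<omega> q *\<^sub>C p"
  unfolding slice_right_def by (simp_all add: tensor_lift cbilinear_slice)

text \<open>The functional dual to one of the independent first legs isolates the second leg beside
  it.\<close>

lemma slice_left_eq_0:
  fixes t :: "('a::complex_vector, 'b::complex_vector) tensor"
  assumes "\<And>f. clinear f \<Longrightarrow> slice_left f t = 0"
  shows "t = 0"
proof -
  have "t \<in> tensor_sub UNIV UNIV" by (simp add: tensor_sub_UNIV)
  from tensor_sub_independent_sum[OF cvec.subspace_UNIV this]
  obtain I p where I: "finite I" "\<not> cvec.dependent I" and t: "t = (\<Sum>v\<in>I. v \<otimes> p v)" by blast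
  have "p v = 0" if v: "v \<in> I" for v
  proof -
    obtain f :: "'a \<Rightarrow> complex" where f: "clinear f" "\<And>x. x \<in> I \<Longrightarrow> f x = (if x = v then 1 else 0)"
      using clinear_extend[OF I(2), of "\<lambda>x. if x = v then 1 else 0"] by blast
    have "slice_left f t = (\<Sum>x\<in>I. if x = v then p v else 0)"
      unfolding t clinear_sum[OF clinear_slice_left[OF f(1)]]
      by (rule sum.cong) (auto simp: slice_left_prod f scaleC_one)
    with assms[OF f(1)] show ?thesis by (simp add: I(1) v)
  qed
  then show ?thesis by (simp add: t)
qed

lemma slice_right_eq_0:
  fixes t :: "('a::complex_vector, 'b::complex_vector) tensor"
  assumes "\<And>f. clinear f \<Longrightarrow> slice_right f t = 0"
  shows "t = 0"
proof (rule slice_left_eq_0, rule functional_separates)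
  fix f :: "'a \<Rightarrow> complex" and g :: "'b \<Rightarrow> complex" assume f: "clinear f" and g: "clinear g"
  have "g (slice_left f t) = f (slice_right g t)"
    by (induction t rule: tensor_induct)
      (simp_all add: slice_left_prod slice_right_prod f g clinear_scaleC clinear_add
          scaleC_complex_def
        clinear_add[OF clinear_slice_left[OF f]] clinear_add[OF clinear_slice_right[OF g]])
  then show "g (slice_left f t) = 0" by (simp add: assms[OF g] clinear_zero[OF f])
qed

text \<open>Point evaluations already separate functions, so they can replace arbitrary functionals
  on a function space. This tests tensors whose first leg is a functional on A.\<close>

lemma tensor_fun_eq_0:
  fixes t :: "('x \<Rightarrow> complex, 'b::complex_vector) tensor"
  assumes "\<And>x. slice_left (\<lambda>f. f x) t = 0"
  shows "t = 0"
proof (rule slice_right_eq_0)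
  fix g :: "'b \<Rightarrow> complex" assume g: "clinear g"
  have ev: "clinear (\<lambda>f :: 'x \<Rightarrow> complex. f x)" for x by (simp add: clinear_iff scaleC_fun_def)
  have "slice_right g t x = g (slice_left (\<lambda>f. f x) t)" for x
    by (induction t rule: tensor_induct)
      (simp_all add: slice_left_prod slice_right_prod ev g clinear_scaleC clinear_add scaleC_fun_def
        scaleC_complex_def clinear_add[OF clinear_slice_left[OF ev]]
            clinear_add[OF clinear_slice_right[OF g]])
  then show "slice_right g t = 0" by (auto simp: assms clinear_zero[OF g])
qed

lemma slice_eqI:
  fixes s t :: "('a::complex_vector, 'b::complex_vector) tensor"
  shows "(\<And>f. clinear f \<Longrightarrow> slice_left f s = slice_left f t) \<Longrightarrow> s = t"
    and "(\<And>f. clinear f \<Longrightarrow> slice_right f s = slice_right f t) \<Longrightarrow> s = t"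
  using slice_left_eq_0[of "s - t"] slice_right_eq_0[of "s - t"]
  by (simp_all add: clinear_diff[OF clinear_slice_left] clinear_diff[OF clinear_slice_right])


section \<open>Non-degenerate algebras and multipliers\<close>

text \<open>A predicate on the type, so that the property can be passed on to twofold and threefold
  tensor products.\<close>

definition nondegenerate :: "'a::complex_algebra itself \<Rightarrow> bool"
  where "nondegenerate _ \<longleftrightarrow>
    (\<forall>a :: 'a. (\<forall>b. a * b = 0) \<longrightarrow> a = 0) \<and> (\<forall>a :: 'a. (\<forall>b. b * a = 0) \<longrightarrow> a = 0)"

lemma nondegenerate_eqI:
  fixes a a' :: "'a::complex_algebra"
  assumes "nondegenerate TYPE('a)"
  shows "(\<And>b. a * b = a' * b) \<Longrightarrow> a = a'" and "(\<And>b. b * a = b * a') \<Longrightarrow> a = a'"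
proof -
  show "a = a'" if "\<And>b. a * b = a' * b"
    using assms that unfolding nondegenerate_def
    by (metis eq_iff_diff_eq_0 left_diff_distrib)
  show "a = a'" if "\<And>b. b * a = b * a'"
    using assms that unfolding nondegenerate_def
    by (metis eq_iff_diff_eq_0 right_diff_distrib)
qed

lemma multiplier_eqI:
  fixes m n :: "'a::complex_algebra multiplier"
  assumes nd: "nondegenerate TYPE('a)"
  shows "(\<And>a. m \<rhd> a = n \<rhd> a) \<Longrightarrow> m = n" and "(\<And>a. a \<lhd> m = a \<lhd> n) \<Longrightarrow> m = n"
proof -
  show "m = n" if eq: "\<And>a. m \<rhd> a = n \<rhd> a"
  proof -
    have "a \<lhd> m = a \<lhd> n" for a
      by (rule nondegenerate_eqI(1)[OF nd]) (simp add: mult_balanced eq)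
    with eq show ?thesis by (simp add: multiplier_eq_iff)
  qed
  show "m = n" if eq: "\<And>a. a \<lhd> m = a \<lhd> n"
  proof -
    have "m \<rhd> a = n \<rhd> a" for a
      by (rule nondegenerate_eqI(2)[OF nd]) (simp add: mult_balanced[symmetric] eq)
    with eq show ?thesis by (simp add: multiplier_eq_iff)
  qed
qed

lemma embed_inject:
  assumes "nondegenerate TYPE('a::complex_algebra)"
  shows "embed (a :: 'a) = embed b \<longleftrightarrow> a = b"
  by (metis assms embed_multL nondegenerate_eqI(1))

lemma element_embed:
  assumes "nondegenerate TYPE('a::complex_algebra)"
  shows "element (embed (a :: 'a)) = a"
  unfolding element_def by (rule the_equality) (auto simp: embed_inject[OF assms])

lemma clinear_embed: "clinear embed"
  by (rule clinearI) (auto simp: multiplier_eq_iff embed_multL embed_multR multiplier_simps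
      distrib_left distrib_right mult_scaleC_left mult_scaleC_right)

lemma embed_mult: "embed (a * b) = embed a * embed b"
  by (auto simp: multiplier_eq_iff embed_multL embed_multR multiplier_simps mult.assoc)

lemma embed_multiplier: "m * embed a = embed (m \<rhd> a)" "embed a * m = embed (a \<lhd> m)"
  by (auto simp: multiplier_eq_iff embed_multL embed_multR multiplier_simps mult_balanced
      multL_mult multR_mult)

definition multiplier_of :: "('a::complex_algebra \<Rightarrow> 'a) \<Rightarrow> ('a \<Rightarrow> 'a) \<Rightarrow> 'a multiplier"
  where "multiplier_of L R = (THE m. (\<forall>a. m \<rhd> a = L a) \<and> (\<forall>a. a \<lhd> m = R a))"

text \<open>\<open>L\<close> is tested by left factors and \<open>R\<close> by right factors;
  balance moves each test to the other side, where the law is a law of the product. Hence any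
  balanced pair of maps gives a multiplier.\<close>

lemma nondegenerate_clinearI:
  fixes L R :: "'a::complex_algebra \<Rightarrow> 'a"
  assumes nd: "nondegenerate TYPE('a)" and LR: "\<And>a b. R a * b = a * L b"
  shows "clinear L" "clinear R" "L (a * b) = L a * b" "R (a * b) = a * R b"
proof -
  note l = nondegenerate_eqI(2)[OF nd] and r = nondegenerate_eqI(1)[OF nd]
  show "clinear L" by (intro clinearI; rule l) (simp_all flip: LR add: distrib_left
      mult_scaleC_right)
  show "clinear R" by (intro clinearI; rule r) (simp_all add: LR distrib_right mult_scaleC_left)
  show "L (a * b) = L a * b" by (rule l) (simp flip: LR mult.assoc)
  show "R (a * b) = a * R b" by (rule r) (simp add: LR mult.assoc)
qed

lemma multiplier_of:
  fixes L R :: "'a::complex_algebra \<Rightarrow> 'a"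
  assumes nd: "nondegenerate TYPE('a)" and LR: "\<And>a b. R a * b = a * L b"
  shows "multiplier_of L R \<rhd> a = L a" "a \<lhd> multiplier_of L R = R a"
proof -
  define m where "m = Abs_multiplier (L, R)"
  have rep: "Rep_multiplier m = (L, R)"
    unfolding m_def using nondegenerate_clinearI[OF assms] LR
    by (intro Abs_multiplier_inverse) auto
  have m: "m \<rhd> a = L a" "a \<lhd> m = R a" for a
    by (simp_all add: mult_left.rep_eq mult_right.rep_eq rep)
  then have "multiplier_of L R = m"
    unfolding multiplier_of_def by (intro the_equality) (auto simp: multiplier_eq_iff)
  then show "multiplier_of L R \<rhd> a = L a" "a \<lhd> multiplier_of L R = R a" by (simp_all add: m)
qed

lemma transport:
  fixes f :: "'a::complex_algebra \<Rightarrow> 'b::complex_algebra"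
  assumes nd: "nondegenerate TYPE('b)" and f: "bij f" "\<And>x y. f (x * y) = f x * f y"
  shows "transport f m \<rhd> f x = f (m \<rhd> x)" "f x \<lhd> transport f m = f (x \<lhd> m)"
proof -
  have [simp]: "inv f (f x) = x" "f (inv f y) = y" for x y
    using f(1) by (simp_all add: bij_is_inj bij_is_surj surj_f_inv_f)
  define n where "n = multiplier_of (\<lambda>y. f (m \<rhd> inv f y)) (\<lambda>y. f (inv f y \<lhd> m))"
  have "f (inv f a \<lhd> m) * b = a * f (m \<rhd> inv f b)" for a b
    using f(2)[of "inv f a \<lhd> m" "inv f b"] f(2)[of "inv f a" "m \<rhd> inv f b"]
        by (simp add: mult_balanced)
  note n = multiplier_of[OF nd this, folded n_def]
  have n': "n \<rhd> f x = f (m \<rhd> x)" "f x \<lhd> n = f (x \<lhd> m)" for x by (simp_all add: n)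
  have "transport f m = n"
    unfolding transport_def
  proof (rule the_equality)
    fix k assume k: "(\<forall>x. k \<rhd> f x = f (m \<rhd> x)) \<and> (\<forall>x. f x \<lhd> k = f (x \<lhd> m))"
    show "k = n" using k n by (metis \<open>\<And>y. f (inv f y) = y\<close> multiplier_eq_iff)
  qed (simp add: n')
  then show "transport f m \<rhd> f x = f (m \<rhd> x)" "f x \<lhd> transport f m = f (x \<lhd> m)"
      by (simp_all add: n')
qed

section \<open>Multiplying and cancelling single legs\<close>

abbreviation in_fst :: "'a::complex_algebra \<Rightarrow> ('a, 'b::complex_algebra) tensor multiplier"
  where "in_fst a \<equiv> embed a \<otimes>\<^sub>M 1"

abbreviation in_snd :: "'b::complex_algebra \<Rightarrow> ('a::complex_algebra, 'b) tensor multiplier"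
  where "in_snd b \<equiv> 1 \<otimes>\<^sub>M embed b"

lemma slice_left_mult:
  fixes t :: "('a::complex_algebra, 'b::complex_algebra) tensor"
  assumes f: "clinear f"
  shows "slice_left f ((1 \<otimes>\<^sub>M m) \<rhd> t) = m \<rhd> slice_left f t"
    and "slice_left f (t \<lhd> (1 \<otimes>\<^sub>M m)) = slice_left f t \<lhd> m"
  by (induction t rule: tensor_induct)
    (simp_all add: tensor_multiplier_multL tensor_multiplier_multR slice_left_prod f
        multiplier_simps
      clinear_add[OF clinear_slice_left[OF f]])

lemma slice_right_mult:
  fixes t :: "('a::complex_algebra, 'b::complex_algebra) tensor"
  assumes f: "clinear f"
  shows "slice_right f ((m \<otimes>\<^sub>M 1) \<rhd> t) = m \<rhd> slice_right f t"
    and "slice_right f (t \<lhd> (m \<otimes>\<^sub>M 1)) = slice_right f t \<lhd> m"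
  by (induction t rule: tensor_induct)
    (simp_all add: tensor_multiplier_multL tensor_multiplier_multR slice_right_prod f
        multiplier_simps
      clinear_add[OF clinear_slice_right[OF f]])

text \<open>Slicing the other leg by a functional commutes with multiplication on this leg, so
  non-degeneracy of one factor is enough. Most Sweedler identities below are verified with one leg
  covered in this way.\<close>

lemma cancel_left_leg:
  fixes s t :: "('a::complex_algebra, 'b::complex_algebra) tensor"
  assumes nd: "nondegenerate TYPE('a)"
  shows "(\<And>c. in_fst c \<rhd> s = in_fst c \<rhd> t) \<Longrightarrow> s = t"
    and "(\<And>c. s \<lhd> in_fst c = t \<lhd> in_fst c) \<Longrightarrow> s = t"
proof -
  show "s = t" if eq: "\<And>c. in_fst c \<rhd> s = in_fst c \<rhd> t"
  proof (rule slice_eqI(2), rule nondegenerate_eqI(2)[OF nd])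
    fix f :: "'b \<Rightarrow> complex" and b :: 'a assume f: "clinear f"
    show "b * slice_right f s = b * slice_right f t"
      using eq[of b] by (metis embed_multL slice_right_mult(1)[OF f])
  qed
  show "s = t" if eq: "\<And>c. s \<lhd> in_fst c = t \<lhd> in_fst c"
  proof (rule slice_eqI(2), rule nondegenerate_eqI(1)[OF nd])
    fix f :: "'b \<Rightarrow> complex" and b :: 'a assume f: "clinear f"
    show "slice_right f s * b = slice_right f t * b"
      using eq[of b] by (metis embed_multR slice_right_mult(2)[OF f])
  qed
qed

lemma cancel_right_leg:
  fixes s t :: "('a::complex_algebra, 'b::complex_algebra) tensor"
  assumes nd: "nondegenerate TYPE('b)"
  shows "(\<And>c. in_snd c \<rhd> s = in_snd c \<rhd> t) \<Longrightarrow> s = t"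
    and "(\<And>c. s \<lhd> in_snd c = t \<lhd> in_snd c) \<Longrightarrow> s = t"
proof -
  show "s = t" if eq: "\<And>c. in_snd c \<rhd> s = in_snd c \<rhd> t"
  proof (rule slice_eqI(1), rule nondegenerate_eqI(2)[OF nd])
    fix f :: "'a \<Rightarrow> complex" and b :: 'b assume f: "clinear f"
    show "b * slice_left f s = b * slice_left f t"
      using eq[of b] by (metis embed_multL slice_left_mult(1)[OF f])
  qed
  show "s = t" if eq: "\<And>c. s \<lhd> in_snd c = t \<lhd> in_snd c"
  proof (rule slice_eqI(1), rule nondegenerate_eqI(1)[OF nd])
    fix f :: "'a \<Rightarrow> complex" and b :: 'b assume f: "clinear f"
    show "slice_left f s * b = slice_left f t * b"
      using eq[of b] by (metis embed_multR slice_left_mult(2)[OF f])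
  qed
qed

lemma tensor_multiplier_mult: "(m \<otimes>\<^sub>M n) * (m' \<otimes>\<^sub>M n') = (m * m') \<otimes>\<^sub>M (n * n')"
proof -
  have "(m \<otimes>\<^sub>M n) \<rhd> (m' \<otimes>\<^sub>M n') \<rhd> t = ((m * m') \<otimes>\<^sub>M (n * n')) \<rhd> t"
    "t \<lhd> (m \<otimes>\<^sub>M n) \<lhd> (m' \<otimes>\<^sub>M n') = t \<lhd> ((m * m') \<otimes>\<^sub>M (n * n'))" for t
    by (induction t rule: tensor_induct)
      (simp_all add: tensor_multiplier_multL tensor_multiplier_multR multiplier_simps)
  then show ?thesis by (simp add: multiplier_eq_iff multiplier_simps)
qed

lemma tensor_multiplier_one: "1 \<otimes>\<^sub>M 1 = 1"
proof -
  have "(1 \<otimes>\<^sub>M 1) \<rhd> t = t" "t \<lhd> (1 \<otimes>\<^sub>M 1) = t" for t :: "('a, 'b) tensor"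
    by (induction t rule: tensor_induct)
      (simp_all add: tensor_multiplier_multL tensor_multiplier_multR multiplier_simps)
  then show ?thesis by (simp add: multiplier_eq_iff multiplier_simps)
qed

lemma embed_tensor: "embed (a \<otimes> b) = embed a \<otimes>\<^sub>M embed b"
proof -
  have "(a \<otimes> b) * t = (embed a \<otimes>\<^sub>M embed b) \<rhd> t" "t * (a \<otimes> b) = t \<lhd> (embed a \<otimes>\<^sub>M embed b)" for t
    by (induction t rule: tensor_induct)
      (simp_all add: tensor_multiplier_multL tensor_multiplier_multR multiplier_simps
          embed_multL embed_multR tensor_times_prod distrib_left distrib_right)
  then show ?thesis by (simp add: multiplier_eq_iff embed_multL embed_multR)
qed

lemma nondegenerate_tensor:
  assumes nd: "nondegenerate TYPE('a::complex_algebra)" "nondegenerate TYPE('b::complex_algebra)"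
  shows "nondegenerate TYPE(('a, 'b) tensor)"
proof -
  have "t = 0" if t: "\<And>u. t * u = 0" for t :: "('a, 'b) tensor"
  proof -
    have 0: "t \<lhd> in_snd d = 0" for d
    proof (rule cancel_left_leg(2)[OF nd(1)])
      fix c
      have "t \<lhd> in_snd d \<lhd> in_fst c = t * (c \<otimes> d)"
        by (simp only: times_multR[symmetric] embed_multR[of t "c \<otimes> d", symmetric]
            tensor_multiplier_mult embed_tensor mult_1_left mult_1_right)
      then show "t \<lhd> in_snd d \<lhd> in_fst c = 0 \<lhd> in_fst c"
        by (simp add: t clinear_zero[OF clinear_multR])
    qed
    show ?thesis
      by (rule cancel_right_leg(2)[OF nd(2)]) (simp add: 0 clinear_zero[OF clinear_multR])
  qed
  moreover have "t = 0" if t: "\<And>u. u * t = 0" for t :: "('a, 'b) tensor"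
  proof -
    have 0: "in_snd d \<rhd> t = 0" for d
    proof (rule cancel_left_leg(1)[OF nd(1)])
      fix c
      have "in_fst c \<rhd> in_snd d \<rhd> t = (c \<otimes> d) * t"
        by (simp only: times_multL[symmetric] embed_multL[of "c \<otimes> d" t, symmetric]
            tensor_multiplier_mult embed_tensor mult_1_left mult_1_right)
      then show "in_fst c \<rhd> in_snd d \<rhd> t = in_fst c \<rhd> 0"
        by (simp add: t clinear_zero[OF clinear_multL])
    qed
    show ?thesis
      by (rule cancel_right_leg(1)[OF nd(2)]) (simp add: 0 clinear_zero[OF clinear_multL])
  qed
  ultimately show ?thesis unfolding nondegenerate_def by blast
qed

section \<open>Extensions to multiplier algebras\<close>

text \<open>A homomorphism into multipliers that may be degenerate: \<open>e\<close> is to be its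
  value at 1, and the covering assumptions bound eB by f(A)B and Be by Bf(A). The instances are
  \<open>\<Delta>\<close> with \<open>E\<close> and id \<otimes> \<Delta> with 1 \<otimes>
  E.\<close>

locale extendable_hom =
  fixes f :: "'a::complex_algebra \<Rightarrow> 'b::complex_algebra multiplier" and e :: "'b multiplier"
  assumes nd: "nondegenerate TYPE('b)"
    and linear_f: "clinear f" and mult_f: "\<And>a b. f (a * b) = f a * f b"
    and unit_f: "e * f a = f a" "f a * e = f a" and idem: "e * e = e"
    and cover_left: "e \<rhd> x \<in> cvec.span {f a \<rhd> y |a y. True}"
    and cover_right: "x \<lhd> e \<in> cvec.span {y \<lhd> f a |a y. True}"
begin

text \<open>Writing x e as a combination of terms y f(a) shows that the products f(a) m fix x m = (x
  e) m.\<close>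

lemma determined:
  assumes "e * m = m" "e * n = n" "\<And>a. f a * m = f a * n"
  shows "m = n"
proof (rule multiplier_eqI(2)[OF nd])
  fix x
  have "y \<lhd> f a \<lhd> m = y \<lhd> f a \<lhd> n" for y a
    by (metis assms(3) times_multR)
  then have "cvec.span {y \<lhd> f a |a y. True} \<subseteq> {v. v \<lhd> m = v \<lhd> n}"
    by (intro cvec.span_minimal subspace_kernel clinear_multR) auto
  with cover_right[of x] have "x \<lhd> e \<lhd> m = x \<lhd> e \<lhd> n" by auto
  then show "x \<lhd> m = x \<lhd> n" by (metis assms(1,2) times_multR)
qed

text \<open>\<open>u\<close> is a candidate for the value of the extension of \<open>m\<close> at
  \<open>x\<close>. A relation avoids choosing a decomposition of e x into terms f(b) y, from which
  the candidate \<Sum> f(m b) y is built.\<close>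

definition ext_left :: "'a multiplier \<Rightarrow> 'b \<Rightarrow> 'b \<Rightarrow> bool"
  where "ext_left m x u \<longleftrightarrow> e \<rhd> u = u \<and> (\<forall>a. f a \<rhd> u = f (a \<lhd> m) \<rhd> x)"

lemma ext_left_exists: "\<exists>u. ext_left m x u"
proof -
  have "\<exists>u. ext_left m v u" if "v \<in> cvec.span {f a \<rhd> y |a y. True}" for v
    using that
  proof (induction rule: cvec.span_induct_alt)
    case base
    show ?case unfolding ext_left_def
      by (intro exI[of _ 0]) (simp add: clinear_zero[OF clinear_multL])
  next
    case (step c x w)
    then obtain b y u where x: "x = f b \<rhd> y" and u: "ext_left m w u" by blast
    have "f a * f (m \<rhd> b) = f (a \<lhd> m) * f b" for a by (simp flip: mult_f add: mult_balanced)
    then have "f a \<rhd> f (m \<rhd> b) \<rhd> y = f (a \<lhd> m) \<rhd> f b \<rhd> y" for a by (metis times_multL)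
    moreover have "e \<rhd> f (m \<rhd> b) \<rhd> y = f (m \<rhd> b) \<rhd> y" by (metis times_multL unit_f(1))
    ultimately have "ext_left m (c *\<^sub>C x + w) (c *\<^sub>C (f (m \<rhd> b) \<rhd> y) + u)"
      using u unfolding ext_left_def x by (simp add: multiplier_simps)
    then show ?case by blast
  qed
  from this[OF cover_left[of x]] obtain u where "ext_left m (e \<rhd> x) u" by blast
  then have "ext_left m x u" unfolding ext_left_def by (metis times_multL unit_f(2))
  then show ?thesis by blast
qed

text \<open>One right-hand candidate balances with every left-hand candidate at once. This joins the
  two sides to a multiplier, whatever decompositions were used.\<close>

lemma ext_right_exists:
  "\<exists>r. (\<forall>a. r \<lhd> f a = x \<lhd> f (m \<rhd> a)) \<and> (\<forall>y u. ext_left m y u \<longrightarrow> r * y = x * u)"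
proof -
  have "\<exists>r. (\<forall>a. r \<lhd> f a = v \<lhd> f (m \<rhd> a)) \<and> (\<forall>y u. ext_left m y u \<longrightarrow> r * y = v * u)"
    if "v \<in> cvec.span {y \<lhd> f a |a y. True}" for v
    using that
  proof (induction rule: cvec.span_induct_alt)
    case base
    show ?case by (intro exI[of _ 0]) (simp add: clinear_zero[OF clinear_multR])
  next
    case (step c x w)
    then obtain b z r where x: "x = z \<lhd> f b"
      and r: "\<And>a. r \<lhd> f a = w \<lhd> f (m \<rhd> a)" "\<And>y u. ext_left m y u \<Longrightarrow> r * y = w * u" by blast
    have "f (b \<lhd> m) * f a = f b * f (m \<rhd> a)" for a by (simp flip: mult_f add: mult_balanced)
    then have 1: "z \<lhd> f (b \<lhd> m) \<lhd> f a = z \<lhd> f b \<lhd> f (m \<rhd> a)" for a by (metis times_multR)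
    have 2: "(z \<lhd> f (b \<lhd> m)) * y = (z \<lhd> f b) * u" if "ext_left m y u" for y u
      using that by (simp add: ext_left_def mult_balanced)
    show ?case
      by (intro exI[of _ "c *\<^sub>C (z \<lhd> f (b \<lhd> m)) + r"])
        (simp add: x r 1 2 multiplier_simps distrib_right mult_scaleC_left)
  qed
  from this[OF cover_right[of x]] obtain r
    where r: "\<And>a. r \<lhd> f a = x \<lhd> e \<lhd> f (m \<rhd> a)" "\<And>y u. ext_left m y u \<Longrightarrow> r * y = x \<lhd> e * u"
    by blast
  have "r * y = x * u" if "ext_left m y u" for y u
    using r(2)[OF that] that by (simp add: mult_balanced ext_left_def)
  moreover have "r \<lhd> f a = x \<lhd> f (m \<rhd> a)" for a
    using r(1)[of a] by (metis times_multR unit_f(1))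
  ultimately show ?thesis by blast
qed

lemma ext_exists: "\<exists>n. e * n = n \<and> (\<forall>a. f a * n = f (a \<lhd> m))"
proof -
  have "\<exists>L. \<forall>x. ext_left m x (L x)" using ext_left_exists by (rule choice[OF allI])
  then obtain L where L: "\<And>x. ext_left m x (L x)" by blast
  have "\<exists>r. \<forall>y u. ext_left m y u \<longrightarrow> r * y = x * u" for x using ext_right_exists by blast
  then have "\<exists>R. \<forall>x y u. ext_left m y u \<longrightarrow> R x * y = x * u" by (intro choice allI)
  then obtain R where R: "\<And>x y u. ext_left m y u \<Longrightarrow> R x * y = x * u" by blast
  define n where "n = multiplier_of L R"
  have n: "n \<rhd> x = L x" for x unfolding n_def by (rule multiplier_of[OF nd]) (rule R[OF L])
  have "e * n = n"
  proof (rule multiplier_eqI(1)[OF nd])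
    show "(e * n) \<rhd> a = n \<rhd> a" for a using L[of a] by (simp add: times_multL n ext_left_def)
  qed
  moreover have "f a * n = f (a \<lhd> m)" for a
  proof (rule multiplier_eqI(1)[OF nd])
    show "(f a * n) \<rhd> b = f (a \<lhd> m) \<rhd> b" for b using L[of b]
        by (simp add: times_multL n ext_left_def)
  qed
  ultimately show ?thesis by blast
qed

lemma hom_extension:
  shows clinear_hom_extension: "clinear (hom_extension f e)"
    and hom_extension_mult: "hom_extension f e (x * y) = hom_extension f e x * hom_extension f e y"
    and hom_extension_embed: "hom_extension f e (embed a) = f a"
    and unit_hom_extension: "e * hom_extension f e m = hom_extension f e m"
proof -
  obtain F where F: "\<And>m. e * F m = F m" "\<And>m a. f a * F m = f (a \<lhd> m)" using ext_exists by metis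
  note det = determined[OF _ F(1)]
  have lin: "clinear F"
  proof (rule clinearI)
    show "F (x + y) = F x + F y" for x y
      by (rule det[symmetric]) (simp_all add: F distrib_left multiplier_simps
          clinear_add[OF linear_f])
    show "F (c *\<^sub>C x) = c *\<^sub>C F x" for c x
      by (rule det[symmetric]) (simp_all add: F mult_scaleC_right multiplier_simps
          clinear_scaleC[OF linear_f])
  qed
  have mult: "F (x * y) = F x * F y" for x y
  proof (rule det[symmetric])
    show "e * (F x * F y) = F x * F y" by (simp flip: mult.assoc add: F(1))
    show "f a * (F x * F y) = f a * F (x * y)" for a
      by (simp add: F multiplier_simps flip: mult.assoc)
  qed
  have emb: "F (embed a) = f a" for a
    by (rule det[symmetric]) (simp_all add: unit_f F embed_multR mult_f)
  have one: "F 1 = e"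
    by (rule det[symmetric]) (simp_all add: unit_f F idem one_multR)
  have "hom_extension f e = F"
    unfolding hom_extension_def
  proof (rule the_equality)
    \<comment> \<open>Uniqueness behind the description of \<open>hom_extension\<close>: a
      competitor satisfies e G(m) = G(1) G(m) = G(m), so \<open>determined\<close> applies.\<close>
    fix G assume G: "clinear G \<and> (\<forall>x y. G (x * y) = G x * G y) \<and> (\<forall>a. G (embed a) = f a) \<and> G 1 = e"
    show "G = F"
    proof (rule ext, rule det)
      fix m
      show "e * G m = G m" using G by (metis mult_1_left)
      show "f a * G m = f a * F m" for a using G F(2) by (metis embed_multiplier(2))
    qed
  qed (use lin mult emb one in auto)
  then show "clinear (hom_extension f e)"
    "hom_extension f e (x * y) = hom_extension f e x * hom_extension f e y"
    "hom_extension f e (embed a) = f a"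
    "e * hom_extension f e m = hom_extension f e m"
    using lin mult emb one F(1) by auto
qed

lemma hom_extension_times:
  "hom_extension f e m * f a = f (m \<rhd> a)" "f a * hom_extension f e m = f (a \<lhd> m)"
  by (metis embed_multiplier hom_extension_embed hom_extension_mult)+

lemma hom_extension_eqI:
  assumes "e * n = n" "\<And>a. f (a \<lhd> m) = f a * n"
  shows "hom_extension f e m = n"
  by (rule determined) (simp_all add: assms unit_hom_extension hom_extension_times)

end

text \<open>Every element is some s(a), so F(m) s(a) = s(a m) and s(a) F(m) = s(m a) already define
  the extension.\<close>

lemma antihom_extension:
  fixes S :: "'a::complex_algebra \<Rightarrow> 'a multiplier" and s :: "'a \<Rightarrow> 'a"
  assumes nd: "nondegenerate TYPE('a)" and S: "\<And>a. S a = embed (s a)"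
    and s: "clinear s" "bij s" "\<And>a b. s (a * b) = s b * s a"
  shows antihom_extension_left: "antihom_extension S m \<rhd> s a = s (a \<lhd> m)"
    and antihom_extension_right: "s a \<lhd> antihom_extension S m = s (m \<rhd> a)"
    and clinear_antihom_extension: "clinear (antihom_extension S)"
    and antihom_extension_mult: "antihom_extension S (x * y)
        = antihom_extension S y * antihom_extension S x"
    and antihom_extension_one: "antihom_extension S 1 = 1"
proof -
  have surj: "\<exists>a. b = s a" for b using s(2) by (metis bij_pointE)
  have inv: "inv s (s a) = a" for a using s(2) by (simp add: bij_is_inj)
  define F where "F m = multiplier_of (\<lambda>b. s (inv s b \<lhd> m)) (\<lambda>b. s (m \<rhd> inv s b))" for m
  have LR: "s (m \<rhd> inv s a) * b = a * s (inv s b \<lhd> m)" for a b m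
  proof -
    obtain a' b' where "a = s a'" "b = s b'" using surj by metis
    then show ?thesis by (simp add: inv mult_balanced flip: s(3))
  qed
  have F: "F m \<rhd> s a = s (a \<lhd> m)" "s a \<lhd> F m = s (m \<rhd> a)" for m a
    unfolding F_def by (simp_all add: multiplier_of[OF nd LR] inv)
  have eqI: "m = n" if "\<And>a. m \<rhd> s a = n \<rhd> s a" for m n
    using that surj by (metis multiplier_eqI(1)[OF nd])
  have lin: "clinear F"
    by (rule clinearI; rule eqI) (simp_all add: F multiplier_simps clinear_add[OF s(1)]
        clinear_scaleC[OF s(1)])
  have mult: "F (x * y) = F y * F x" for x y
    by (rule eqI) (simp add: F multiplier_simps)
  have emb: "F (embed a) = S a" for a
    by (rule eqI) (simp add: F S embed_multL embed_multR s(3))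
  have one: "F 1 = 1"
    by (rule eqI) (simp add: F multiplier_simps)
  have "antihom_extension S = F"
    unfolding antihom_extension_def
  proof (rule the_equality)
    fix G assume G: "clinear G \<and> (\<forall>x y. G (x * y) = G y * G x) \<and> (\<forall>a. G (embed a) = S a) \<and> G 1 = 1"
    show "G = F"
    proof (rule ext, rule eqI)
      fix m a
      have "embed (G m \<rhd> s a) = G m * G (embed a)" by (simp add: G S embed_multiplier)
      also have "\<dots> = embed (s (a \<lhd> m))" using G by (metis S embed_multiplier(2))
      finally show "G m \<rhd> s a = F m \<rhd> s a" by (simp add: F embed_inject[OF nd])
    qed
  qed (use lin mult emb one in auto)
  then show "antihom_extension S m \<rhd> s a = s (a \<lhd> m)" "s a \<lhd> antihom_extension S m = s (m \<rhd> a)"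
    "clinear (antihom_extension S)" "antihom_extension S (x * y)
        = antihom_extension S y * antihom_extension S x"
    "antihom_extension S 1 = 1"
    using F lin mult emb one by auto
qed


section \<open>Operators on legs of threefold tensor products\<close>

lemma tensor_map_add: "clinear f \<Longrightarrow> clinear g \<Longrightarrow> tensor_map f g (s + t)
    = tensor_map f g s + tensor_map f g t"
  by (rule clinear_add[OF clinear_tensor_map])

lemma tensor_eqI:
  assumes "clinear F" "clinear G" "\<And>a b. F (a \<otimes> b) = G (a \<otimes> b)"
  shows "F t = G t"
  using clinear_tensor_eqI[OF assms] by simp

lemma tensor_eqI3:
  fixes F G :: "('a::complex_vector, ('b::complex_vector, 'c::complex_vector) tensor) tensor \<Rightarrow>
      'd::complex_vector"
  assumes "clinear F" "clinear G" "\<And>a b c. F (a \<otimes> b \<otimes> c) = G (a \<otimes> b \<otimes> c)"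
  shows "F t = G t"
proof (rule tensor_eqI[OF assms(1,2)])
  show "F (a \<otimes> b) = G (a \<otimes> b)" for a b
    by (rule tensor_eqI[OF clinear_compose[OF assms(1) clinear_tensor_prod_right]
          clinear_compose[OF assms(2) clinear_tensor_prod_right]]) (rule assms(3))
qed

definition insert3 :: "'c::complex_vector \<Rightarrow> ('a::complex_vector, 'b::complex_vector) tensor \<Rightarrow>
    ('a, ('b, 'c) tensor) tensor"
  where "insert3 c = tensor_map (\<lambda>x. x) (\<lambda>b. b \<otimes> c)"

definition insert2 :: "'b::complex_vector \<Rightarrow> ('a::complex_vector, 'c::complex_vector) tensor \<Rightarrow>
    ('a, ('b, 'c) tensor) tensor"
  where "insert2 b = tensor_map (\<lambda>x. x) (\<lambda>c. b \<otimes> c)"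

lemma clinear_insert3: "clinear (insert3 c)"
  and insert3_prod: "insert3 c (a \<otimes> b) = a \<otimes> b \<otimes> c"
  unfolding insert3_def
  by (simp_all add: clinear_tensor_map tensor_map_prod clinear_ident clinear_tensor_prod_left)

lemma clinear_insert2: "clinear (insert2 c)"
  and insert2_prod: "insert2 b (a \<otimes> c') = a \<otimes> b \<otimes> c'"
  unfolding insert2_def
  by (simp_all add: clinear_tensor_map tensor_map_prod clinear_ident clinear_tensor_prod_right)

lemma clinear_insert3_right: "clinear (\<lambda>c. insert3 c t)"
proof -
  have "insert3 (c + d) t = insert3 c t + insert3 d t" "insert3 (k *\<^sub>C c) t = k *\<^sub>C insert3 c t"
      for c d :: 'a and k
    by (induction t rule: tensor_induct)
      (simp_all add: insert3_prod tensor_prod_add_right tensor_prod_scale_right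
          clinear_add[OF clinear_insert3]
        scaleC_add_right)
  then show ?thesis by (rule clinearI)
qed

lemma clinear_insert2_right: "clinear (\<lambda>c. insert2 c t)"
proof -
  have "insert2 (c + d) t = insert2 c t + insert2 d t" "insert2 (k *\<^sub>C c) t = k *\<^sub>C insert2 c t"
      for c d :: 'a and k
    by (induction t rule: tensor_induct)
      (simp_all add: insert2_prod tensor_prod_add_left tensor_prod_add_right tensor_prod_scale_left
        tensor_prod_scale_right clinear_add[OF clinear_insert2] scaleC_add_right)
  then show ?thesis by (rule clinearI)
qed

text \<open>Threefold products are nested to the right, so legs 1 and 2 do not form a factor to
  which \<open>tensor_map\<close> could be applied.\<close>

definition leg12 :: "(('a::complex_vector, 'b::complex_vector) tensor \<Rightarrow>
    ('c::complex_vector, 'd::complex_vector) tensor)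
    \<Rightarrow> ('a, ('b, 'e::complex_vector) tensor) tensor \<Rightarrow> ('c, ('d, 'e) tensor) tensor"
  where "leg12 F = tensor_lift (\<lambda>a t. tensor_lift (\<lambda>b c. insert3 c (F (a \<otimes> b))) t)"

definition leg13 :: "(('a::complex_vector, 'b::complex_vector) tensor \<Rightarrow>
    ('c::complex_vector, 'd::complex_vector) tensor)
    \<Rightarrow> ('a, ('e::complex_vector, 'b) tensor) tensor \<Rightarrow> ('c, ('e, 'd) tensor) tensor"
  where "leg13 F = tensor_lift (\<lambda>a t. tensor_lift (\<lambda>b c. insert2 b (F (a \<otimes> c))) t)"

abbreviation leg23 ::
    "(('a::complex_vector, 'b::complex_vector) tensor \<Rightarrow> ('c::complex_vector, 'd::complex_vector)
    tensor)
    \<Rightarrow> ('e::complex_vector, ('a, 'b) tensor) tensor \<Rightarrow> ('e, ('c, 'd) tensor) tensor"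
  where "leg23 F \<equiv> tensor_map (\<lambda>x. x) F"

lemma tensor_lift3:
  fixes g :: "'a::complex_vector \<Rightarrow> 'b::complex_vector \<Rightarrow> 'c::complex_vector \<Rightarrow> 'd::complex_vector"
  assumes "\<And>b c. clinear (\<lambda>a. g a b c)" "\<And>a c. clinear (\<lambda>b. g a b c)" "\<And>a b. clinear (\<lambda>c. g a b c)"
  shows "clinear (tensor_lift (\<lambda>a t. tensor_lift (g a) t))"
    and "tensor_lift (\<lambda>a t. tensor_lift (g a) t) (a \<otimes> b \<otimes> c) = g a b c"
proof -
  have 1: "cbilinear (g a)" for a unfolding cbilinear_def using assms by simp
  have "tensor_lift (g (a + a')) t = tensor_lift (g a) t + tensor_lift (g a') t"
    "tensor_lift (g (k *\<^sub>C a)) t = k *\<^sub>C tensor_lift (g a) t" for a a' k t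
    by (induction t rule: tensor_induct)
      (simp_all add: tensor_lift_prod[OF 1] clinear_add[OF clinear_tensor_lift[OF 1]]
          scaleC_add_right
        clinear_add[OF assms(1)] clinear_scaleC[OF assms(1)])
  then have 2: "cbilinear (\<lambda>a t. tensor_lift (g a) t)"
    unfolding cbilinear_def by (auto intro: clinearI clinear_tensor_lift[OF 1])
  show "clinear (tensor_lift (\<lambda>a t. tensor_lift (g a) t))"
    "tensor_lift (\<lambda>a t. tensor_lift (g a) t) (a \<otimes> b \<otimes> c) = g a b c"
    by (rule clinear_tensor_lift[OF 2]) (simp add: tensor_lift_prod[OF 2] tensor_lift_prod[OF 1])
qed

lemma clinear_leg12: "clinear F \<Longrightarrow> clinear (leg12 F)"
  and leg12_prod: "clinear F \<Longrightarrow> leg12 F (a \<otimes> b \<otimes> c) = insert3 c (F (a \<otimes> b))"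
proof -
  assume F: "clinear F"
  have "clinear (\<lambda>a. insert3 c (F (a \<otimes> b)))" "clinear (\<lambda>b. insert3 c (F (a \<otimes> b)))"
    "clinear (\<lambda>c. insert3 c (F (a \<otimes> b)))" for a b c
    by (rule clinear_compose[OF clinear_insert3 clinear_compose[OF F]] clinear_tensor_prod_left
        clinear_tensor_prod_right clinear_insert3_right)+
  note * = tensor_lift3[OF this]
  show "clinear (leg12 F)" "leg12 F (a \<otimes> b \<otimes> c) = insert3 c (F (a \<otimes> b))"
    unfolding leg12_def by (rule *)+
qed

lemma clinear_leg13: "clinear F \<Longrightarrow> clinear (leg13 F)"
  and leg13_prod: "clinear F \<Longrightarrow> leg13 F (a \<otimes> b \<otimes> c) = insert2 b (F (a \<otimes> c))"
proof -
  assume F: "clinear F"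
  have "clinear (\<lambda>a. insert2 c (F (a \<otimes> b)))" "clinear (\<lambda>b. insert2 c (F (a \<otimes> b)))"
    "clinear (\<lambda>c. insert2 c (F (a \<otimes> b)))" for a b c
    by (rule clinear_compose[OF clinear_insert2 clinear_compose[OF F]] clinear_tensor_prod_left
        clinear_tensor_prod_right clinear_insert2_right)+
  note * = tensor_lift3[OF this(1,3,2)]
  show "clinear (leg13 F)" "leg13 F (a \<otimes> b \<otimes> c) = insert2 b (F (a \<otimes> c))"
    unfolding leg13_def by (rule *)+
qed

lemma leg23_prod: "clinear F \<Longrightarrow> leg23 F (a \<otimes> t) = a \<otimes> F t"
  and clinear_leg23: "clinear F \<Longrightarrow> clinear (leg23 F)"
  by (simp_all add: tensor_map_prod clinear_ident clinear_tensor_map)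

lemma leg12_insert3: "clinear F \<Longrightarrow> leg12 F (insert3 c t) = insert3 c (F t)"
  by (rule tensor_eqI)
    (simp_all add: leg12_prod insert3_prod clinear_compose[OF clinear_leg12 clinear_insert3]
      clinear_compose[OF clinear_insert3])

lemma leg13_insert2: "clinear F \<Longrightarrow> leg13 F (insert2 c t) = insert2 c (F t)"
  by (rule tensor_eqI)
    (simp_all add: leg13_prod insert2_prod clinear_compose[OF clinear_leg13 clinear_insert2]
      clinear_compose[OF clinear_insert2])

lemma leg12_leg12:
  assumes F: "clinear F" and G: "clinear G"
  shows "leg12 F (leg12 G t) = leg12 (\<lambda>x. F (G x)) t"
  by (rule tensor_eqI3[OF clinear_compose[OF clinear_leg12[OF F] clinear_leg12[OF G]]
        clinear_leg12[OF clinear_compose[OF F G]]])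
    (simp add: leg12_prod[OF G] leg12_prod[OF clinear_compose[OF F G]] leg12_insert3[OF F])

lemma leg13_leg13:
  assumes F: "clinear F" and G: "clinear G"
  shows "leg13 F (leg13 G t) = leg13 (\<lambda>x. F (G x)) t"
  by (rule tensor_eqI3[OF clinear_compose[OF clinear_leg13[OF F] clinear_leg13[OF G]]
        clinear_leg13[OF clinear_compose[OF F G]]])
    (simp add: leg13_prod[OF G] leg13_prod[OF clinear_compose[OF F G]] leg13_insert2[OF F])

lemma leg23_leg23:
  assumes F: "clinear F" and G: "clinear G"
  shows "leg23 F (leg23 G t) = leg23 (\<lambda>x. F (G x)) t"
  by (rule tensor_eqI[OF clinear_compose[OF clinear_leg23[OF F] clinear_leg23[OF G]]
        clinear_leg23[OF clinear_compose[OF F G]]])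
    (simp add: leg23_prod F G clinear_compose[OF F G])

lemma tensor_assoc_lift: "tensor_lift (\<lambda>a b. a \<otimes> b \<otimes> c) t = insert3 c t"
  unfolding insert3_def tensor_map_def ..

lemma cbilinear_insert3: "cbilinear (\<lambda>s c. insert3 c s)"
  unfolding cbilinear_def by (simp add: clinear_insert3 clinear_insert3_right)

lemma clinear_tensor_assoc: "clinear tensor_assoc"
  unfolding tensor_assoc_def tensor_assoc_lift by (rule clinear_tensor_lift[OF cbilinear_insert3])

lemma tensor_assoc_insert: "tensor_assoc (t \<otimes> c) = insert3 c t"
  unfolding tensor_assoc_def tensor_assoc_lift by (rule tensor_lift_prod[OF cbilinear_insert3])

lemma bij_tensor_assoc: "bij tensor_assoc"
proof -
  define U :: "('a, ('b, 'c) tensor) tensor \<Rightarrow> (('a, 'b) tensor, 'c) tensor"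
    where "U = tensor_lift (\<lambda>a t. tensor_lift (\<lambda>b c. (a \<otimes> b) \<otimes> c) t)"
  have "clinear (\<lambda>a. (a \<otimes> b) \<otimes> c)" "clinear (\<lambda>b. (a \<otimes> b) \<otimes> c)" "clinear (\<lambda>c. (a \<otimes> b) \<otimes> c)"
    for a :: 'a and b :: 'b and c :: 'c
    by (rule clinear_compose[OF clinear_tensor_prod_left clinear_tensor_prod_left]
        clinear_compose[OF clinear_tensor_prod_left clinear_tensor_prod_right]
            clinear_tensor_prod_right)+
  note U = tensor_lift3[OF this, folded U_def]
  have 1: "tensor_assoc (U t) = t" for t
    by (rule tensor_eqI3[OF clinear_compose[OF clinear_tensor_assoc U(1)] clinear_ident])
      (simp add: U tensor_assoc_insert insert3_prod)
  have 2: "U (insert3 c s) = s \<otimes> c" for s c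
    by (rule tensor_eqI[OF clinear_compose[OF U(1) clinear_insert3] clinear_tensor_prod_left])
      (simp add: U insert3_prod)
  have 3: "U (tensor_assoc t) = t" for t
    by (rule tensor_eqI[OF clinear_compose[OF U(1) clinear_tensor_assoc] clinear_ident])
      (simp add: tensor_assoc_insert 2)
  show ?thesis by (rule o_bij[of U]) (auto simp: 1 3)
qed

lemma tensor_assoc_mult: "tensor_assoc (x * y) = tensor_assoc x * tensor_assoc y"
proof -
  have *: "insert3 (c * d) (s * t) = insert3 c s * insert3 d t" for s t c d
  proof (induction s rule: tensor_induct)
    case (prod a b)
    show ?case
      by (induction t rule: tensor_induct)
        (simp_all add: tensor_times_prod insert3_prod clinear_add[OF clinear_insert3] distrib_left)
  qed (simp add: clinear_add[OF clinear_insert3] distrib_right)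
  show ?thesis
  proof (induction x rule: tensor_induct)
    case (prod s c)
    show ?case
      by (induction y rule: tensor_induct)
        (simp_all add: tensor_times_prod tensor_assoc_insert clinear_add[OF clinear_tensor_assoc]
            distrib_left *)
  qed (simp add: clinear_add[OF clinear_tensor_assoc] distrib_right)
qed

lemma transport_assoc:
  fixes M :: "('a::complex_algebra, 'b::complex_algebra) tensor multiplier"
    and n :: "'c::complex_algebra multiplier"
  assumes nd: "nondegenerate TYPE('a)" "nondegenerate TYPE('b)" "nondegenerate TYPE('c)"
  shows "transport tensor_assoc (M \<otimes>\<^sub>M n) \<rhd> insert3 c t = insert3 (n \<rhd> c) (M \<rhd> t)"
    and "insert3 c t \<lhd> transport tensor_assoc (M \<otimes>\<^sub>M n) = insert3 (c \<lhd> n) (t \<lhd> M)"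
  using transport[OF nondegenerate_tensor[OF nd(1) nondegenerate_tensor[OF nd(2,3)]]
      bij_tensor_assoc
      tensor_assoc_mult, where m = "M \<otimes>\<^sub>M n" and x = "t \<otimes> c"]
  by (simp_all add: tensor_assoc_insert tensor_multiplier_multL tensor_multiplier_multR)

lemma mult_left_right:
  assumes nd: "nondegenerate TYPE('a::complex_algebra)"
  shows "(m \<rhd> x) \<lhd> n = m \<rhd> (x \<lhd> (n :: 'a multiplier))"
proof (rule nondegenerate_eqI(2)[OF nd])
  show "y * ((m \<rhd> x) \<lhd> n) = y * (m \<rhd> (x \<lhd> n))" for y
    by (simp flip: multR_mult mult_balanced)
qed

lemma cancel_leg3:
  fixes s t :: "('a::complex_vector, ('b::complex_algebra, 'c::complex_algebra) tensor) tensor"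
  assumes nd: "nondegenerate TYPE('c)"
  shows "(\<And>d. tensor_map (\<lambda>x. x) (\<lambda>u. u \<lhd> in_snd d) s = tensor_map (\<lambda>x. x) (\<lambda>u. u \<lhd> in_snd d) t)
      \<Longrightarrow> s = t"
proof (rule slice_eqI(1), rule cancel_right_leg(2)[OF nd])
  fix f :: "'a \<Rightarrow> complex" and d assume f: "clinear f"
    and eq: "\<And>d. tensor_map (\<lambda>x. x) (\<lambda>u. u \<lhd> in_snd d) s = tensor_map (\<lambda>x. x) (\<lambda>u. u \<lhd> in_snd d) t"
  have "slice_left f (tensor_map (\<lambda>x. x) (\<lambda>u. u \<lhd> in_snd d) r) = slice_left f r \<lhd> in_snd d"
      for r :: "('a, ('b, 'c) tensor) tensor"
    by (rule tensor_eqI[OF clinear_compose[OF clinear_slice_left[OF f]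
        clinear_tensor_map[OF clinear_ident clinear_multR]]
          clinear_compose[OF clinear_multR clinear_slice_left[OF f]]])
      (simp add: tensor_map_prod[OF clinear_ident clinear_multR] slice_left_prod f multiplier_simps)
  then show "slice_left f s \<lhd> in_snd d = slice_left f t \<lhd> in_snd d"
    using eq[of d] by metis
qed

definition tensor_product :: "('a::complex_algebra, 'a) tensor \<Rightarrow> 'a"
  where "tensor_product = tensor_lift (*)"

lemma clinear_tensor_product: "clinear tensor_product"
  and tensor_product_prod: "tensor_product (a \<otimes> b) = a * b"
proof -
  have "cbilinear ((*) :: 'x::complex_algebra \<Rightarrow> 'x \<Rightarrow> 'x)"
    by (simp add: cbilinear_def clinear_mult_left clinear_mult_right)
  note * = tensor_lift[OF this, folded tensor_product_def]
  show "clinear (tensor_product :: ('x::complex_algebra, 'x) tensor \<Rightarrow> 'x)" by (rule *)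
  show "tensor_product (a \<otimes> b) = a * b" by (rule *)
qed

definition contract12 :: "(('a::complex_vector, 'b::complex_vector) tensor \<Rightarrow> 'd::complex_vector)
    \<Rightarrow> ('a, ('b, 'c::complex_vector) tensor) tensor \<Rightarrow> ('d, 'c) tensor"
  where "contract12 F = tensor_lift (\<lambda>a t. tensor_lift (\<lambda>b c. F (a \<otimes> b) \<otimes> c) t)"

lemma clinear_contract12: "clinear F \<Longrightarrow> clinear (contract12 F)"
  and contract12_prod: "clinear F \<Longrightarrow> contract12 F (a \<otimes> b \<otimes> c) = F (a \<otimes> b) \<otimes> c"
proof -
  assume F: "clinear F"
  have "clinear (\<lambda>a. F (a \<otimes> b) \<otimes> c)" "clinear (\<lambda>b. F (a \<otimes> b) \<otimes> c)"
    "clinear (\<lambda>c. F (a \<otimes> b) \<otimes> c)" for a b c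
    by (rule clinear_compose[OF clinear_tensor_prod_left clinear_compose[OF F]]
        clinear_tensor_prod_left
        clinear_tensor_prod_right)+
  note * = tensor_lift3[OF this]
  show "clinear (contract12 F)" "contract12 F (a \<otimes> b \<otimes> c) = F (a \<otimes> b) \<otimes> c"
    unfolding contract12_def by (rule *)+
qed

lemma clinear_scaleC_left: "clinear (\<lambda>c. c *\<^sub>C x)"
  by (rule clinearI) (simp_all add: scaleC_add_left scaleC_scaleC scaleC_complex_def)

lemmas clinear_tensor_rules =
  clinear_ident clinear_const_zero
  clinear_compose[OF clinear_tensor_product]
  clinear_compose[OF clinear_tensor_map]
  clinear_compose[OF clinear_leg12] clinear_compose[OF clinear_leg13]
  clinear_compose[OF clinear_contract12]
  clinear_compose[OF clinear_insert3] clinear_compose[OF clinear_insert2]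
  clinear_compose[OF clinear_tensor_prod_left] clinear_compose[OF clinear_tensor_prod_right]
  clinear_compose[OF clinear_multL] clinear_compose[OF clinear_multR]
  clinear_compose[OF clinear_mult_left] clinear_compose[OF clinear_mult_right]
  clinear_compose[OF clinear_slice_left] clinear_compose[OF clinear_slice_right]
  clinear_plus clinear_minus

lemma contract12_insert3: "clinear F \<Longrightarrow> contract12 F (insert3 c t) = F t \<otimes> c"
  by (rule tensor_eqI) (simp_all add: clinear_tensor_rules contract12_prod insert3_prod)

lemma contract12_leg12: "clinear F \<Longrightarrow> clinear G \<Longrightarrow> contract12 F (leg12 G t)
    = contract12 (\<lambda>x. F (G x)) t"
  by (rule tensor_eqI3)
    (simp_all add: clinear_tensor_rules clinear_compose[of F G] leg12_prod contract12_prod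
        contract12_insert3)

lemma tensor_map_tensor_map:
  assumes "clinear f" "clinear g" "clinear f'" "clinear g'"
  shows "tensor_map f g (tensor_map f' g' t) = tensor_map (\<lambda>x. f (f' x)) (\<lambda>x. g (g' x)) t"
  by (rule tensor_eqI[of "\<lambda>t. tensor_map f g (tensor_map f' g' t)"])
    (simp_all add: clinear_tensor_rules assms clinear_compose[OF assms(1,3)]
        clinear_compose[OF assms(2,4)] tensor_map_prod)

lemma tensor_map_ident: "tensor_map (\<lambda>x. x) (\<lambda>x. x) t = t"
  by (rule tensor_eqI) (simp_all add: clinear_tensor_rules tensor_map_prod)

lemma leg12_map3:
  fixes F :: "('a::complex_vector, 'b::complex_vector) tensor \<Rightarrow>
      ('c::complex_vector, 'd::complex_vector) tensor"
    and g :: "'e::complex_vector \<Rightarrow> 'f::complex_vector"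
  assumes "clinear F" "clinear g"
  shows "leg12 F (leg23 (tensor_map (\<lambda>x. x) g) t) = leg23 (tensor_map (\<lambda>x. x) g) (leg12 F t)"
proof (rule tensor_eqI3[where t = t])
  have *: "leg23 (tensor_map (\<lambda>x. x) g) (insert3 c u) = insert3 (g c) u" for c :: 'e
      and u :: "('c, 'd) tensor"
    by (rule tensor_eqI[where t = u]) (simp_all add: clinear_tensor_rules assms insert3_prod
        tensor_map_prod)
  show "leg12 F (leg23 (tensor_map (\<lambda>x. x) g) (a \<otimes> b \<otimes> c))
      = leg23 (tensor_map (\<lambda>x. x) g) (leg12 F (a \<otimes> b \<otimes> c))" for a b c
    by (simp add: clinear_tensor_rules assms tensor_map_prod leg12_prod *)
qed (simp_all add: clinear_tensor_rules assms)

lemma tensor_multiplier_eq: "(m \<otimes>\<^sub>M n) \<rhd> t = tensor_map ((\<rhd>) m) ((\<rhd>) n) t"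
  and tensor_multiplier_eqR: "t \<lhd> (m \<otimes>\<^sub>M n) = tensor_map (\<lambda>x. x \<lhd> m) (\<lambda>x. x \<lhd> n) t"
  by (rule tensor_eqI; simp add: clinear_tensor_rules tensor_map_prod tensor_multiplier_multL
      tensor_multiplier_multR)+


lemma tensor_multiplier_linear:
  shows "(m + m') \<otimes>\<^sub>M n = m \<otimes>\<^sub>M n + m' \<otimes>\<^sub>M n" "(c *\<^sub>C m) \<otimes>\<^sub>M n = c *\<^sub>C (m \<otimes>\<^sub>M n)"
    "m \<otimes>\<^sub>M (n + n') = m \<otimes>\<^sub>M n + m \<otimes>\<^sub>M n'" "m \<otimes>\<^sub>M (c *\<^sub>C n) = c *\<^sub>C (m \<otimes>\<^sub>M n)"
proof -
  have *: "M = N" if "\<And>a b. M \<rhd> (a \<otimes> b) = N \<rhd> (a \<otimes> b)" "\<And>a b. (a \<otimes> b) \<lhd> M = (a \<otimes> b) \<lhd> N"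
    for M N :: "('a, 'b) tensor multiplier"
    unfolding multiplier_eq_iff
    using tensor_eqI[OF clinear_multL clinear_multL that(1)]
        tensor_eqI[OF clinear_multR clinear_multR that(2)]
    by blast
  show "(m + m') \<otimes>\<^sub>M n = m \<otimes>\<^sub>M n + m' \<otimes>\<^sub>M n" "(c *\<^sub>C m) \<otimes>\<^sub>M n = c *\<^sub>C (m \<otimes>\<^sub>M n)"
    "m \<otimes>\<^sub>M (n + n') = m \<otimes>\<^sub>M n + m \<otimes>\<^sub>M n'" "m \<otimes>\<^sub>M (c *\<^sub>C n) = c *\<^sub>C (m \<otimes>\<^sub>M n)"
    by (rule *; simp add: tensor_multiplier_multL tensor_multiplier_multR multiplier_simps
        tensor_prod_add_left tensor_prod_add_right tensor_prod_scale_left tensor_prod_scale_right)+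
qed


lemmas leg_mult_simps = tensor_multiplier_multL tensor_multiplier_multR one_multL one_multR

section \<open>Weak multiplier Hopf algebras\<close>

text \<open>Regularity replaces the multiplier-valued \<open>S\<close> by a bijection
  \<open>s\<close> of the algebra; \<open>R1\<close> and \<open>R2\<close> name the witnesses whose
  existence is part of being an antipode.\<close>

locale antipode_data = regular_weak_multiplier_hopf_algebra \<Delta> \<epsilon> E G1 G2 S
  for \<Delta> :: "'a::complex_algebra \<Rightarrow> ('a, 'a) tensor multiplier" and \<epsilon> E G1 G2 S +
  fixes s :: "'a \<Rightarrow> 'a" and R1 R2 :: "('a, 'a) tensor \<Rightarrow> ('a, 'a) tensor"
  assumes S_eq: "S a = embed (s a)" and bij_s: "bij s"
    and is_R1: "is_R1 \<Delta> S R1" and is_R2: "is_R2 \<Delta> S R2"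
    and T1_R1_prod: "E \<rhd> (a \<otimes> b) = T1 \<Delta> (R1 (a \<otimes> b))"
    and T2_R2_prod: "(a \<otimes> b) \<lhd> E = T2 \<Delta> (R2 (a \<otimes> b))"
    and antipode_S: "tensor_lift (\<lambda>p q. S p \<rhd> q) (T1 \<Delta> (R1 (a \<otimes> b))) = S a \<rhd> b"
begin

abbreviation "t1 \<equiv> T1 \<Delta>"
abbreviation "t2 \<equiv> T2 \<Delta>"

lemma nd: "nondegenerate TYPE('a)"
  unfolding nondegenerate_def using nondegenerate_left nondegenerate_right by blast

lemma nd2: "nondegenerate TYPE(('a, 'a) tensor)"
  by (rule nondegenerate_tensor[OF nd nd])

lemma nd3: "nondegenerate TYPE(('a, ('a, 'a) tensor) tensor)"
  by (rule nondegenerate_tensor[OF nd nd2])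

lemma clinear_\<Delta>: "clinear \<Delta>" and \<Delta>_mult: "\<Delta> (a * b) = \<Delta> a * \<Delta> b"
  using coproduct unfolding coproduct_def by auto

lemma clinear_\<Delta>_L: "clinear h \<Longrightarrow> clinear (\<lambda>x. \<Delta> (h x) \<rhd> \<xi>)"
  and clinear_\<Delta>_R: "clinear h \<Longrightarrow> clinear (\<lambda>x. \<xi> \<lhd> \<Delta> (h x))"
  by (rule clinearI; simp add: clinear_add clinear_scaleC clinear_add[OF clinear_\<Delta>]
      clinear_scaleC[OF clinear_\<Delta>] multiplier_simps)+

lemma embed_t1: "embed (t1 (a \<otimes> b)) = \<Delta> a * in_snd b"
  and clinear_t1: "clinear t1"
proof -
  define g where "g a b = element (\<Delta> a * in_snd b)" for a b
  have g: "embed (g a b) = \<Delta> a * in_snd b" for a b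
    using coproduct element_embed[OF nd2] unfolding g_def coproduct_def by (metis imageE)
  have bil: "cbilinear g"
    by (rule cbilinearI; rule embed_inject[OF nd2, THEN iffD1])
      (simp_all add: g clinear_add[OF clinear_embed] clinear_scaleC[OF clinear_embed]
          tensor_multiplier_linear clinear_add[OF clinear_\<Delta>] clinear_scaleC[OF clinear_\<Delta>]
          distrib_left distrib_right mult_scaleC_left mult_scaleC_right)
  have t1: "t1 = tensor_lift g" unfolding T1_def g_def ..
  show "clinear t1" "embed (t1 (a \<otimes> b)) = \<Delta> a * in_snd b"
    unfolding t1 by (simp_all add: clinear_tensor_lift[OF bil] tensor_lift_prod[OF bil] g)
qed

lemma embed_t2: "embed (t2 (a \<otimes> b)) = in_fst a * \<Delta> b"
  and clinear_t2: "clinear t2"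
proof -
  define g where "g a b = element (in_fst a * \<Delta> b)" for a b
  have g: "embed (g a b) = in_fst a * \<Delta> b" for a b
    using coproduct element_embed[OF nd2] unfolding g_def coproduct_def by (metis imageE)
  have bil: "cbilinear g"
    by (rule cbilinearI; rule embed_inject[OF nd2, THEN iffD1])
      (simp_all add: g clinear_add[OF clinear_embed] clinear_scaleC[OF clinear_embed]
          tensor_multiplier_linear clinear_add[OF clinear_\<Delta>] clinear_scaleC[OF clinear_\<Delta>]
          distrib_left distrib_right mult_scaleC_left mult_scaleC_right)
  have t2: "t2 = tensor_lift g" unfolding T2_def g_def ..
  show "clinear t2" "embed (t2 (a \<otimes> b)) = in_fst a * \<Delta> b"
    unfolding t2 by (simp_all add: clinear_tensor_lift[OF bil] tensor_lift_prod[OF bil] g)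
qed

lemmas embed_eqI = embed_inject[OF nd2, THEN iffD1]

lemma \<Delta>_multL: "\<Delta> a \<rhd> (x \<otimes> y) = t1 (a \<otimes> y) \<lhd> in_fst x"
  by (rule embed_eqI) (simp add: embed_multiplier[symmetric] embed_t1 embed_tensor mult.assoc
      tensor_multiplier_mult)

lemma \<Delta>_multR: "(x \<otimes> y) \<lhd> \<Delta> a = in_snd y \<rhd> t2 (x \<otimes> a)"
  by (rule embed_eqI) (simp add: embed_multiplier[symmetric] embed_t2 embed_tensor
      mult.assoc[symmetric] tensor_multiplier_mult)

lemma t1_t2: "in_fst e \<rhd> t1 (a \<otimes> b) = t2 (e \<otimes> a) \<lhd> in_snd b"
  by (rule embed_eqI) (simp add: embed_multiplier[symmetric] embed_t1 embed_t2 mult.assoc)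

lemma t1_mult_left: "t1 ((a * b) \<otimes> c) = \<Delta> a \<rhd> t1 (b \<otimes> c)"
  by (rule embed_eqI) (simp add: embed_multiplier[symmetric] embed_t1 \<Delta>_mult mult.assoc)

lemma t2_mult_right: "t2 (c \<otimes> (a * b)) = t2 (c \<otimes> a) \<lhd> \<Delta> b"
  by (rule embed_eqI) (simp add: embed_multiplier[symmetric] embed_t2 \<Delta>_mult mult.assoc)

lemma t2_times: "t2 (a \<otimes> b) * \<xi> = in_fst a \<rhd> \<Delta> b \<rhd> \<xi>"
  by (simp flip: embed_multL times_multL add: embed_t2)

lemma times_t1: "\<xi> * t1 (a \<otimes> b) = \<xi> \<lhd> \<Delta> a \<lhd> in_snd b"
  by (simp flip: embed_multR times_multR add: embed_t1)

lemma E_t1: "E \<rhd> t1 x = t1 x" and E_t2: "t2 x \<lhd> E = t2 x"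
proof -
  obtain y where "t1 x = E \<rhd> y" using range_T1 by (metis (no_types, lifting) rangeE rangeI)
  then show "E \<rhd> t1 x = t1 x" by (metis E_idem times_multL)
  obtain y where "t2 x = y \<lhd> E" using range_T2 by (metis (no_types, lifting) rangeE rangeI)
  then show "t2 x \<lhd> E = t2 x" by (metis E_idem times_multR)
qed

text \<open>\<Delta>(a)(x \<otimes> y) is T1(a \<otimes> y)(x \<otimes> 1), and \<open>E\<close>
  fixes the range of T1; the other side is the same with T2.\<close>

lemma E_\<Delta>: "E * \<Delta> a = \<Delta> a" and \<Delta>_E: "\<Delta> a * E = \<Delta> a"
proof -
  show "E * \<Delta> a = \<Delta> a"
  proof (rule multiplier_eqI(1)[OF nd2])
    show "(E * \<Delta> a) \<rhd> t = \<Delta> a \<rhd> t" for t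
      by (rule tensor_eqI) (simp_all add: clinear_tensor_rules clinear_\<Delta>_L times_multL \<Delta>_multL
          E_t1 flip: mult_left_right[OF nd2])
  qed
  show "\<Delta> a * E = \<Delta> a"
  proof (rule multiplier_eqI(2)[OF nd2])
    show "t \<lhd> (\<Delta> a * E) = t \<lhd> \<Delta> a" for t
      by (rule tensor_eqI) (simp_all add: clinear_tensor_rules clinear_\<Delta>_R times_multR \<Delta>_multR
          E_t2 mult_left_right[OF nd2])
  qed
qed

lemma \<Delta>_EL: "\<Delta> a \<rhd> E \<rhd> x = \<Delta> a \<rhd> x"
  by (simp flip: times_multL add: \<Delta>_E)

lemma square_span: "x \<in> cvec.span {a * b |a b :: 'a. True}"
  using idempotent_algebra by blast

lemma square_induct [case_names mult add]:
  assumes "\<And>a b :: 'a. P (a * b)" "\<And>x y. P x \<Longrightarrow> P y \<Longrightarrow> P (x + y)"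
  shows "P x"
proof -
  have "x \<in> cvec.span {a * b |a b :: 'a. True}" by (rule square_span)
  then show ?thesis
  proof (induction rule: cvec.span_induct_alt)
    case base
    show ?case using assms(1)[of 0 0] by simp
  next
    case (step c x y)
    then obtain a b where "x = a * b" by blast
    then have "c *\<^sub>C x = (c *\<^sub>C a) * b" by (simp add: mult_scaleC_left)
    then show ?case using assms step by metis
  qed
qed

lemma square_tensor_induct [case_names mult add]:
  fixes t :: "('a, 'a) tensor"
  assumes "\<And>a b c d. P ((a \<otimes> b) * (c \<otimes> d))" "\<And>x y. P x \<Longrightarrow> P y \<Longrightarrow> P (x + y)"
  shows "P t"
proof (induction t rule: tensor_induct)
  case (prod x y)
  show ?case
  proof (induction x rule: square_induct)
    case (mult a c)
    show ?case
      by (induction y rule: square_induct)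
        (use assms in \<open>simp_all add: tensor_times_prod tensor_prod_add_right\<close>)
  qed (use assms(2) in \<open>simp add: tensor_prod_add_left\<close>)
qed (rule assms(2))

text \<open>In T1(u \<otimes> v) = \<Delta>(u)(1 \<otimes> v) the right factor is only a multiplier.
  Idempotency of the algebra supplies a further factor c \<otimes> d that turns it into an
  element.\<close>

lemma cover_\<Delta>_left: "E \<rhd> x \<in> cvec.span {\<Delta> a \<rhd> y |a y. True}"
proof (induction x rule: square_tensor_induct)
  case (mult a b c d)
  have *: "t1 r * (c \<otimes> d) \<in> cvec.span {\<Delta> a \<rhd> y |a y. True}" for r
  proof (induction r rule: tensor_induct)
    case (prod u v)
    have "t1 (u \<otimes> v) * (c \<otimes> d) = \<Delta> u \<rhd> in_snd v \<rhd> (c \<otimes> d)"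
      by (simp flip: embed_multL times_multL add: embed_t1)
    then show ?case by (auto intro: cvec.span_base)
  qed (simp add: clinear_add[OF clinear_t1] distrib_right cvec.span_add)
  obtain r where "E \<rhd> (a \<otimes> b) = t1 r" using range_T1 by (metis (no_types, lifting) rangeE rangeI)
  then show ?case using * by (simp add: multL_mult)
qed (simp add: multiplier_simps cvec.span_add)

lemma cover_\<Delta>_right: "x \<lhd> E \<in> cvec.span {y \<lhd> \<Delta> a |a y. True}"
proof (induction x rule: square_tensor_induct)
  case (mult a b c d)
  have *: "(a \<otimes> b) * t2 r \<in> cvec.span {y \<lhd> \<Delta> a |a y. True}" for r
  proof (induction r rule: tensor_induct)
    case (prod u v)
    have "(a \<otimes> b) * t2 (u \<otimes> v) = (a \<otimes> b) \<lhd> in_fst u \<lhd> \<Delta> v"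
      by (simp flip: embed_multR times_multR add: embed_t2)
    then show ?case by (auto intro: cvec.span_base)
  qed (simp add: clinear_add[OF clinear_t2] distrib_left cvec.span_add)
  obtain r where "(c \<otimes> d) \<lhd> E = t2 r" using range_T2 by (metis (no_types, lifting) rangeE rangeI)
  then show ?case using * by (simp add: multR_mult)
qed (simp add: multiplier_simps cvec.span_add)

sublocale \<Delta>: extendable_hom \<Delta> E
  by (rule extendable_hom.intro)
    (rule nd2 clinear_\<Delta> \<Delta>_mult E_\<Delta> \<Delta>_E E_idem cover_\<Delta>_left cover_\<Delta>_right)+

end

lemma mult_left_eta: "(\<rhd>) 1 = (\<lambda>x. x)" "(\<rhd>) (embed a) = (*) a"
  by (simp_all add: fun_eq_iff one_multL embed_multL)

lemma insert3_mult: "insert3 c s * insert3 d t = insert3 (c * d) (s * t)"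
  by (metis tensor_assoc_insert tensor_assoc_mult tensor_times_prod)

lemma tensor_multiplier_insert3:
  "(m \<otimes>\<^sub>M n \<otimes>\<^sub>M k) \<rhd> insert3 c t = insert3 (k \<rhd> c) ((m \<otimes>\<^sub>M n) \<rhd> t)"
  "insert3 c t \<lhd> (m \<otimes>\<^sub>M n \<otimes>\<^sub>M k) = insert3 (c \<lhd> k) (t \<lhd> (m \<otimes>\<^sub>M n))"
  by (rule tensor_eqI[where t = t];
      simp add: clinear_tensor_rules insert3_prod leg_mult_simps)+

lemma tensor_multiplier_insert2:
  "(m \<otimes>\<^sub>M n \<otimes>\<^sub>M k) \<rhd> insert2 c t = insert2 (n \<rhd> c) ((m \<otimes>\<^sub>M k) \<rhd> t)"
  "insert2 c t \<lhd> (m \<otimes>\<^sub>M n \<otimes>\<^sub>M k) = insert2 (c \<lhd> n) (t \<lhd> (m \<otimes>\<^sub>M k))"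
  by (rule tensor_eqI[where t = t];
      simp add: clinear_tensor_rules insert2_prod leg_mult_simps)+

lemma leg12_multiplier_insert:
  assumes nd: "nondegenerate TYPE('a::complex_algebra)" "nondegenerate TYPE('b::complex_algebra)"
    "nondegenerate TYPE('c::complex_algebra)"
  shows "transport tensor_assoc ((M :: ('a, 'b) tensor multiplier) \<otimes>\<^sub>M (1 :: 'c multiplier)) \<rhd> x
      = leg12 ((\<rhd>) M) x"
    "x \<lhd> transport tensor_assoc ((M :: ('a, 'b) tensor multiplier) \<otimes>\<^sub>M (1 :: 'c multiplier))
        = leg12 (\<lambda>x. x \<lhd> M) x"
  by (rule tensor_eqI3[where t = x];
      simp add: clinear_tensor_rules leg12_insert3 transport_assoc[OF nd, where n
          = 1, unfolded one_multL one_multR] flip: insert3_prod)+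

context antipode_data
begin

section \<open>The antipode as a bijection of the algebra\<close>

lemma clinear_s: "clinear s" and s_mult: "s (a * b) = s b * s a"
proof -
  have S: "clinear S" "S (a * b) = S b * S a" for a b using antipode unfolding antipode_def by auto
  show "clinear s"
    by (rule clinearI; rule embed_inject[OF nd, THEN iffD1])
      (simp_all flip: S_eq add: clinear_add[OF clinear_embed] clinear_scaleC[OF clinear_embed]
        clinear_add[OF S(1)] clinear_scaleC[OF S(1)])
  show "s (a * b) = s b * s a"
    by (rule embed_inject[OF nd, THEN iffD1]) (simp flip: S_eq add: embed_mult S(2))
qed

abbreviation "s' \<equiv> inv s"

lemma s_s' [simp]: "s (s' a) = a" and s'_s [simp]: "s' (s a) = a"
  using bij_s by (simp_all add: bij_is_inj bij_is_surj surj_f_inv_f)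

lemma clinear_s': "clinear s'"
  by (rule clinear_inv[OF clinear_s bij_s])

lemma s'_mult: "s' (a * b) = s' b * s' a"
proof -
  have "s (s' b * s' a) = a * b" by (simp add: s_mult)
  then show ?thesis by (metis s'_s)
qed

lemma clinear_R1: "clinear R1" and clinear_R2: "clinear R2"
  using is_R1 is_R2 unfolding is_R1_def is_R2_def by auto

lemmas clinear_op_rules
    = clinear_tensor_rules clinear_compose[OF clinear_t1] clinear_compose[OF clinear_t2]
  clinear_compose[OF clinear_R1] clinear_compose[OF clinear_R2]
  clinear_compose[OF clinear_s] clinear_compose[OF clinear_s'] clinear_\<Delta>_L clinear_\<Delta>_R

lemma T1_R1: "E \<rhd> x = t1 (R1 x)" and T2_R2: "x \<lhd> E = t2 (R2 x)"
  by (rule tensor_eqI[where t = x]; intro clinear_op_rules T1_R1_prod T2_R2_prod)+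

text \<open>This is \<Sum> S(a1) a2 S(a3) = S(a): T1 R1 is left multiplication by \<open>E\<close>,
  so the antipode identity computes the contraction of E(a \<otimes> b) by S(u) v.\<close>

lemma antipode_cancel: "tensor_product (tensor_map s (\<lambda>x. x) (E \<rhd> (a \<otimes> b))) = s a * b"
proof -
  have "cbilinear (\<lambda>p q. s p * q)" unfolding cbilinear_def by (intro conjI allI clinear_op_rules)
  note 1 = tensor_lift[OF this]
  have "tensor_product (tensor_map s (\<lambda>x. x) r) = tensor_lift (\<lambda>p q. s p * q) r" for r
    by (rule tensor_eqI[where t = r]) (simp_all add: clinear_op_rules 1 clinear_s tensor_map_prod
        tensor_product_prod)
  then show ?thesis
    using antipode_S[of a b] by (simp add: T1_R1 S_eq embed_multL)
qed

lemma R1_left: "in_fst c \<rhd> R1 (a \<otimes> b) = tensor_map (\<lambda>x. x) (\<lambda>q. s q * b) (t2 (c \<otimes> a))"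
  using is_R1 unfolding is_R1_def tensor_map_def by (simp add: S_eq embed_multL)

lemma R2_right: "R2 (a \<otimes> b) \<lhd> in_snd c = tensor_map (\<lambda>p. a * s p) (\<lambda>x. x) (t1 (b \<otimes> c))"
  using is_R2 unfolding is_R2_def tensor_map_def by (simp add: S_eq embed_multR)

text \<open>Regularity: \<open>t3 (c \<otimes> a) = \<Delta>(a) (c \<otimes> 1)\<close> and \<open>t4 (a \<otimes> b) = (1 \<otimes> b) \<Delta>(a)\<close> lie in \<open>A \<otimes> A\<close>.\<close>

definition "t3 x = tensor_map s' (\<lambda>x. x) (R2 (tensor_map s (\<lambda>x. x) x))"
definition "t4 x = tensor_map (\<lambda>x. x) s' (R1 (tensor_map (\<lambda>x. x) s x))"

lemma clinear_t3: "clinear t3" and clinear_t4: "clinear t4"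
  unfolding t3_def[abs_def] t4_def[abs_def] by (intro clinear_op_rules)+

lemma t4_left: "in_fst c \<rhd> t4 (a \<otimes> b) = in_snd b \<rhd> t2 (c \<otimes> a)"
proof -
  have "in_fst c \<rhd> t4 (a \<otimes> b) = tensor_map (\<lambda>x. x) s' (in_fst c \<rhd> R1 (a \<otimes> s b))"
    unfolding t4_def by (simp add: tensor_map_prod clinear_op_rules tensor_multiplier_eq
        tensor_map_tensor_map one_multL)
  also have "\<dots> = in_snd b \<rhd> t2 (c \<otimes> a)"
    unfolding R1_left by (simp add: mult_left_eta tensor_multiplier_eq tensor_map_tensor_map
        clinear_op_rules one_multL embed_multL s'_mult)
  finally show ?thesis .
qed

lemma t3_right: "t3 (c \<otimes> a) \<lhd> in_snd b = t1 (a \<otimes> b) \<lhd> in_fst c"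
proof -
  have "t3 (c \<otimes> a) \<lhd> in_snd b = tensor_map s' (\<lambda>x. x) (R2 (s c \<otimes> a) \<lhd> in_snd b)"
    unfolding t3_def by (simp add: tensor_map_prod clinear_op_rules tensor_multiplier_eqR
        tensor_map_tensor_map one_multR)
  also have "\<dots> = t1 (a \<otimes> b) \<lhd> in_fst c"
    unfolding R2_right by (simp add: tensor_multiplier_eqR tensor_map_tensor_map clinear_op_rules
        one_multR embed_multR s'_mult)
  finally show ?thesis .
qed

lemma embed_t4: "embed (t4 (a \<otimes> b)) = in_snd b * \<Delta> a"
proof (rule multiplier_eqI(1)[OF nd2], rule cancel_left_leg(1)[OF nd])
  fix \<xi> c
  have "in_fst c \<rhd> embed (t4 (a \<otimes> b)) \<rhd> \<xi> = (in_snd b \<rhd> t2 (c \<otimes> a)) * \<xi>"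
    by (simp add: embed_multL multL_mult t4_left)
  also have "\<dots> = in_snd b \<rhd> in_fst c \<rhd> \<Delta> a \<rhd> \<xi>"
    by (simp add: multL_mult[symmetric] t2_times)
  also have "\<dots> = in_fst c \<rhd> (in_snd b * \<Delta> a) \<rhd> \<xi>"
    by (simp flip: times_multL add: mult.assoc[symmetric] tensor_multiplier_mult)
  finally show "in_fst c \<rhd> embed (t4 (a \<otimes> b)) \<rhd> \<xi> = in_fst c \<rhd> (in_snd b * \<Delta> a) \<rhd> \<xi>" .
qed

lemma embed_t3: "embed (t3 (c \<otimes> a)) = \<Delta> a * in_fst c"
proof (rule multiplier_eqI(2)[OF nd2], rule cancel_right_leg(2)[OF nd])
  fix \<xi> b
  have "\<xi> \<lhd> embed (t3 (c \<otimes> a)) \<lhd> in_snd b = \<xi> * (t1 (a \<otimes> b) \<lhd> in_fst c)"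
    by (simp add: embed_multR multR_mult t3_right)
  also have "\<dots> = \<xi> \<lhd> \<Delta> a \<lhd> in_snd b \<lhd> in_fst c"
    by (simp add: multR_mult[symmetric] times_t1)
  also have "\<dots> = \<xi> \<lhd> (\<Delta> a * in_fst c) \<lhd> in_snd b"
    by (simp flip: times_multR add: mult.assoc tensor_multiplier_mult)
  finally show "\<xi> \<lhd> embed (t3 (c \<otimes> a)) \<lhd> in_snd b = \<xi> \<lhd> (\<Delta> a * in_fst c) \<lhd> in_snd b" .
qed

lemma t4_right: "t4 (a \<otimes> b) \<lhd> in_snd d = in_snd b \<rhd> t1 (a \<otimes> d)"
  by (rule embed_eqI) (simp add: embed_multiplier[symmetric] embed_t4 embed_t1 mult.assoc)

lemma t3_left: "in_fst e \<rhd> t3 (c \<otimes> a) = t2 (e \<otimes> a) \<lhd> in_fst c"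
  by (rule embed_eqI) (simp add: embed_multiplier[symmetric] embed_t3 embed_t2 mult.assoc)


subsection \<open>Coassociativity\<close>

lemma coproduct_id_prod: "coproduct_id \<Delta> (p \<otimes> q) \<rhd> insert3 z u = insert3 (q * z) (\<Delta> p \<rhd> u)"
  and coproduct_id_add: "coproduct_id \<Delta> (t + t') \<rhd> x = coproduct_id \<Delta> t \<rhd> x + coproduct_id \<Delta> t' \<rhd> x"
proof -
  have bil: "cbilinear (\<lambda>a b. \<Delta> a \<otimes>\<^sub>M embed b)"
    by (rule cbilinearI) (simp_all add: clinear_add[OF clinear_\<Delta>] clinear_scaleC[OF clinear_\<Delta>]
        clinear_add[OF clinear_embed] clinear_scaleC[OF clinear_embed] tensor_multiplier_linear)
  show "coproduct_id \<Delta> (p \<otimes> q) \<rhd> insert3 z u = insert3 (q * z) (\<Delta> p \<rhd> u)"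
    unfolding coproduct_id_def
        by (simp add: tensor_lift_prod[OF bil] transport_assoc[OF nd nd nd] embed_multL)
  obtain y where x: "x = tensor_assoc y" using bij_tensor_assoc by (metis bij_pointE)
  show "coproduct_id \<Delta> (t + t') \<rhd> x = coproduct_id \<Delta> t \<rhd> x + coproduct_id \<Delta> t' \<rhd> x"
    unfolding coproduct_id_def x transport(1)[OF nd3 bij_tensor_assoc tensor_assoc_mult]
      clinear_add[OF clinear_tensor_lift[OF bil]] plus_multL clinear_add[OF clinear_tensor_assoc] ..
qed

lemma coproduct_id_t2: "(embed a \<otimes>\<^sub>M 1 \<otimes>\<^sub>M 1) \<rhd> coproduct_id \<Delta> t \<rhd> insert3 z u
    = leg12 t2 (a \<otimes> t) * insert3 z u"
proof (induction t rule: tensor_induct)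
  case (prod p q)
  show ?case
    by (simp add: coproduct_id_prod tensor_multiplier_insert3 one_multL leg12_prod[OF clinear_t2]
        insert3_mult t2_times)
next
  case (add t t')
  then show ?case
    by (simp add: coproduct_id_add multiplier_simps tensor_prod_add_right
        clinear_add[OF clinear_leg12[OF clinear_t2]] distrib_right)
qed

lemma clinear_id_coproduct: "clinear (id_coproduct \<Delta>)"
  and id_coproduct_prod: "id_coproduct \<Delta> (a \<otimes> b) = embed a \<otimes>\<^sub>M \<Delta> b"
proof -
  have bil: "cbilinear (\<lambda>a b. embed a \<otimes>\<^sub>M \<Delta> b)"
    by (rule cbilinearI) (simp_all add: clinear_add[OF clinear_\<Delta>] clinear_scaleC[OF clinear_\<Delta>]
        clinear_add[OF clinear_embed] clinear_scaleC[OF clinear_embed] tensor_multiplier_linear)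
  show "clinear (id_coproduct \<Delta>)" "id_coproduct \<Delta> (a \<otimes> b) = embed a \<otimes>\<^sub>M \<Delta> b"
    unfolding id_coproduct_def
        by (simp_all add: clinear_tensor_lift[OF bil] tensor_lift_prod[OF bil])
qed

lemma id_coproduct_t1: "id_coproduct \<Delta> t * (1 \<otimes>\<^sub>M 1 \<otimes>\<^sub>M embed c) = embed (leg23 t1 (insert3 c t))"
proof (induction t rule: tensor_induct)
  case (prod p q)
  show ?case
    by (simp add: id_coproduct_prod tensor_multiplier_mult embed_t1[symmetric] insert3_prod
        tensor_map_prod clinear_op_rules embed_tensor)
next
  case (add t t')
  then show ?case
    by (simp add: clinear_add[OF clinear_id_coproduct] distrib_right
        clinear_add[OF clinear_insert3] tensor_map_add clinear_op_rules
        clinear_add[OF clinear_embed])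
qed

text \<open>The axiom equates multipliers of the threefold product. Acting on x \<otimes> y
  \<otimes> z, both sides become products with images under the leg operators, and non-degeneracy
  removes the test element.\<close>

lemma coassoc: "leg12 t2 (leg23 t1 x) = leg23 t1 (leg12 t2 x)"
proof (rule tensor_eqI3[where t = x])
  fix a b c
  have "leg12 t2 (a \<otimes> t1 (b \<otimes> c)) = leg23 t1 (insert3 c (t2 (a \<otimes> b)))"
  proof (rule nondegenerate_eqI(1)[OF nd3])
    fix \<xi>
    have eq: "(embed a \<otimes>\<^sub>M 1 \<otimes>\<^sub>M 1) * coproduct_id \<Delta> (t1 (b \<otimes> c))
        = id_coproduct \<Delta> (t2 (a \<otimes> b)) * (1 \<otimes>\<^sub>M 1 \<otimes>\<^sub>M embed c)"
      using coproduct unfolding coproduct_def by blast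
    show "leg12 t2 (a \<otimes> t1 (b \<otimes> c)) * \<xi> = leg23 t1 (insert3 c (t2 (a \<otimes> b))) * \<xi>"
    proof (rule tensor_eqI3[where t = \<xi>])
      fix x y z
      have "leg12 t2 (a \<otimes> t1 (b \<otimes> c)) * insert3 z (x \<otimes> y)
          = ((embed a \<otimes>\<^sub>M 1 \<otimes>\<^sub>M 1) * coproduct_id \<Delta> (t1 (b \<otimes> c))) \<rhd> insert3 z (x \<otimes> y)"
        by (simp add: times_multL coproduct_id_t2)
      also have "\<dots> = leg23 t1 (insert3 c (t2 (a \<otimes> b))) * insert3 z (x \<otimes> y)"
        unfolding eq id_coproduct_t1 embed_multL ..
      finally show "leg12 t2 (a \<otimes> t1 (b \<otimes> c)) * (x \<otimes> y \<otimes> z)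
          = leg23 t1 (insert3 c (t2 (a \<otimes> b))) * (x \<otimes> y \<otimes> z)"
        by (simp add: insert3_prod)
    qed (intro clinear_op_rules)+
  qed
  then show "leg12 t2 (leg23 t1 (a \<otimes> b \<otimes> c)) = leg23 t1 (leg12 t2 (a \<otimes> b \<otimes> c))"
    by (simp add: leg12_prod tensor_map_prod clinear_t1 clinear_t2 clinear_ident)
qed (intro clinear_op_rules clinear_t1 clinear_t2)+

lemmas clinear_op_rules'
    = clinear_op_rules clinear_t1 clinear_t2 clinear_R1 clinear_R2 clinear_t3 clinear_t4 clinear_s
    clinear_s'
  clinear_multL clinear_multR clinear_tensor_product
  clinear_compose[OF clinear_t3] clinear_compose[OF clinear_t4]

lemma coassoc_t1: "leg12 t2 (a \<otimes> t1 (b \<otimes> c)) = leg23 t1 (insert3 c (t2 (a \<otimes> b)))"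
  using coassoc[of "a \<otimes> b \<otimes> c"] by (simp add: leg12_prod tensor_map_prod clinear_op_rules')

text \<open>A further factor d on the third leg turns t4(b \<otimes> c) into (1 \<otimes> c) T1(b
  \<otimes> d), to which the hypothesis on \<open>t1\<close> applies. \<open>F\<close> is left open
  because the law is needed for both \<open>t2\<close> and \<open>R2\<close>.\<close>

lemma coassoc_t4:
  fixes F :: "('a, 'a) tensor \<Rightarrow> ('a, 'a) tensor"
  assumes F: "clinear F"
    and co: "\<And>c. leg12 F (a \<otimes> t1 (b \<otimes> c)) = leg23 t1 (insert3 c (F (a \<otimes> b)))"
  shows "leg12 F (a \<otimes> t4 (b \<otimes> c)) = leg23 t4 (insert3 c (F (a \<otimes> b)))"
proof (rule cancel_leg3[OF nd])
  fix d :: 'a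
  let ?D = "leg23 (\<lambda>u. u \<lhd> in_snd d)"
  have 1: "?D (leg12 F x) = leg12 F (?D x)" for x
    unfolding tensor_multiplier_eqR one_multR
        by (rule leg12_map3[symmetric]) (simp_all add: clinear_op_rules' F)
  have 2: "leg12 F (a \<otimes> (in_snd c \<rhd> r)) = (1 \<otimes>\<^sub>M 1 \<otimes>\<^sub>M embed c) \<rhd> leg12 F (a \<otimes> r)" for r
    by (rule tensor_eqI[where t = r]) (simp_all add: clinear_op_rules' F leg_mult_simps leg12_prod
        tensor_multiplier_insert3 tensor_multiplier_one)
  have 3: "(1 \<otimes>\<^sub>M 1 \<otimes>\<^sub>M embed c) \<rhd> leg23 t1 (insert3 d u) = ?D (leg23 t4 (insert3 c u))" for u
    by (rule tensor_eqI[where t = u]) (simp_all add: clinear_op_rules' insert3_prod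
        tensor_map_prod leg_mult_simps t4_right)
  have "?D (leg12 F (a \<otimes> t4 (b \<otimes> c))) = leg12 F (a \<otimes> (in_snd c \<rhd> t1 (b \<otimes> d)))"
    by (simp add: 1 tensor_map_prod clinear_op_rules' t4_right)
  also have "\<dots> = ?D (leg23 t4 (insert3 c (F (a \<otimes> b))))"
    unfolding 2 co 3 ..
  finally show "?D (leg12 F (a \<otimes> t4 (b \<otimes> c))) = ?D (leg23 t4 (insert3 c (F (a \<otimes> b))))" .
qed

lemma coassoc_t3: "leg12 t3 (c \<otimes> t1 (a \<otimes> d)) = leg23 t1 (insert3 d (t3 (c \<otimes> a)))"
proof (rule cancel_left_leg(1)[OF nd])
  fix e
  have 1: "in_fst e \<rhd> leg12 t3 (c \<otimes> r) = leg12 t2 (e \<otimes> r) \<lhd> (embed c \<otimes>\<^sub>M 1 \<otimes>\<^sub>M 1)" for r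
    unfolding tensor_multiplier_one[symmetric]
    by (rule tensor_eqI[where t = r]) (simp_all add: clinear_op_rules' leg12_prod
        tensor_multiplier_insert3 leg_mult_simps t3_left)
  have 2: "leg23 t1 (insert3 d (u \<lhd> in_fst c)) = leg23 t1 (insert3 d u) \<lhd> (embed c \<otimes>\<^sub>M 1 \<otimes>\<^sub>M 1)"
      for u
    by (rule tensor_eqI[where t = u]) (simp_all add: clinear_op_rules' insert3_prod
        tensor_map_prod leg_mult_simps tensor_multiplier_one)
  have 3: "in_fst e \<rhd> leg23 t1 (insert3 d u) = leg23 t1 (insert3 d (in_fst e \<rhd> u))" for u
    by (rule tensor_eqI[where t = u]) (simp_all add: clinear_op_rules' insert3_prod
        tensor_map_prod leg_mult_simps)
  show "in_fst e \<rhd> leg12 t3 (c \<otimes> t1 (a \<otimes> d)) = in_fst e \<rhd> leg23 t1 (insert3 d (t3 (c \<otimes> a)))"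
    unfolding 1 3 coassoc_t1 t3_left 2 ..
qed

text \<open>\<Sum> a1 \<otimes> S(a2) b is the image under id \<otimes> S of \<Sum> a1 \<otimes>
  S^-1(b) a2. Coassociativity thus passes from \<open>t4\<close> to \<open>R1\<close>.\<close>

lemma R1_t4: "R1 (a \<otimes> b) = tensor_map (\<lambda>x. x) s (t4 (a \<otimes> s' b))"
  unfolding t4_def by (simp add: tensor_map_prod clinear_op_rules' tensor_map_tensor_map
      tensor_map_ident)

lemma R2_t3: "R2 (a \<otimes> b) = tensor_map s (\<lambda>x. x) (t3 (s' a \<otimes> b))"
  unfolding t3_def by (simp add: tensor_map_prod clinear_op_rules' tensor_map_tensor_map
      tensor_map_ident)

lemma coassoc_R2: "leg12 R2 (a \<otimes> t1 (b \<otimes> c)) = leg23 t1 (insert3 c (R2 (a \<otimes> b)))"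
proof -
  let ?S = "tensor_map s (\<lambda>x. x)"
  have 1: "leg12 R2 (a \<otimes> r) = ?S (leg12 t3 (s' a \<otimes> r))" for r
  proof (rule tensor_eqI[where t = r])
    have "insert3 c (tensor_map s (\<lambda>x. x) u) = tensor_map s (\<lambda>x. x) (insert3 c u)" for c
        and u :: "('a, 'a) tensor"
      by (rule tensor_eqI[where t = u]) (simp_all add: clinear_op_rules' insert3_prod
          tensor_map_prod)
    then show "leg12 R2 (a \<otimes> b \<otimes> c) = ?S (leg12 t3 (s' a \<otimes> b \<otimes> c))" for b c
      by (simp add: leg12_prod clinear_op_rules' R2_t3)
  qed (simp_all add: clinear_op_rules')
  have 2: "leg23 t1 (insert3 c (?S u)) = ?S (leg23 t1 (insert3 c u))" for u
    by (rule tensor_eqI[where t = u]) (simp_all add: clinear_op_rules' insert3_prod tensor_map_prod)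
  show ?thesis unfolding 1 R2_t3 2 coassoc_t3 ..
qed

lemma coassoc_R1_gen:
  fixes F :: "('a, 'a) tensor \<Rightarrow> ('a, 'a) tensor"
  assumes F: "clinear F"
    and co: "\<And>c. leg12 F (a \<otimes> t1 (b \<otimes> c)) = leg23 t1 (insert3 c (F (a \<otimes> b)))"
  shows "leg12 F (a \<otimes> R1 (b \<otimes> c)) = leg23 R1 (insert3 c (F (a \<otimes> b)))"
proof -
  let ?S = "leg23 (tensor_map (\<lambda>x. x) s)"
  have "leg12 F (a \<otimes> R1 (b \<otimes> c)) = leg12 F (?S (a \<otimes> t4 (b \<otimes> s' c)))"
    by (simp add: R1_t4 tensor_map_prod clinear_op_rules')
  also have "\<dots> = ?S (leg23 t4 (insert3 (s' c) (F (a \<otimes> b))))"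
    by (simp add: leg12_map3 clinear_op_rules' F coassoc_t4[OF assms])
  also have "?S (leg23 t4 (insert3 (s' c) u)) = leg23 R1 (insert3 c u)" for u
    by (rule tensor_eqI[where t = u]) (simp_all add: clinear_op_rules' insert3_prod
        tensor_map_prod R1_t4)
  finally show ?thesis .
qed

lemma coassoc_R1: "leg12 t2 (a \<otimes> R1 (b \<otimes> c)) = leg23 R1 (insert3 c (t2 (a \<otimes> b)))"
  and coassoc_R2_R1: "leg12 R2 (a \<otimes> R1 (b \<otimes> c)) = leg23 R1 (insert3 c (R2 (a \<otimes> b)))"
  by (rule coassoc_R1_gen[OF clinear_t2 coassoc_t1] coassoc_R1_gen[OF clinear_R2 coassoc_R2])+

end

lemma tensor_product_mult:
  "tensor_product ((m \<otimes>\<^sub>M 1) \<rhd> t) = m \<rhd> tensor_product t"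
  "tensor_product (t \<lhd> (1 \<otimes>\<^sub>M m)) = tensor_product t \<lhd> m"
  by (rule tensor_eqI[where t = t]; simp add: clinear_tensor_rules clinear_tensor_product
      clinear_multL clinear_multR leg_mult_simps tensor_product_prod multL_mult multR_mult)+

lemma slice_left_leg23:
  assumes "clinear f" "clinear F"
  shows "slice_left f (tensor_map (\<lambda>x. x) F x) = F (slice_left f x)"
  by (rule tensor_eqI[where t = x])
    (simp_all add: clinear_tensor_rules assms clinear_compose[OF assms(2)] slice_left_prod
        tensor_map_prod clinear_scaleC)

lemma leg12_slice_right:
  fixes F :: "('a::complex_vector, 'b::complex_vector) tensor \<Rightarrow>
      ('c::complex_vector, 'd::complex_vector) tensor"
  assumes f: "clinear f" and F: "clinear F"
  shows "tensor_map (\<lambda>x. x) (slice_right f) (leg12 F x) = F (tensor_map (\<lambda>x. x) (slice_right f) x)"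
proof (rule tensor_eqI3[where t = x])
  have ins: "tensor_map (\<lambda>x. x) (slice_right f) (insert3 c u) = f c *\<^sub>C u" for c
      and u :: "('c, 'd) tensor"
    by (rule tensor_eqI[where t = u])
      (simp_all add: clinear_tensor_rules f clinear_slice_right insert3_prod tensor_map_prod
          slice_right_prod tensor_prod_scale_right cvec.linear_scale_self)
  show "tensor_map (\<lambda>x. x) (slice_right f) (leg12 F (a \<otimes> b \<otimes> c))
      = F (tensor_map (\<lambda>x. x) (slice_right f) (a \<otimes> b \<otimes> c))" for a b c
    by (simp add: leg12_prod F ins tensor_map_prod clinear_tensor_rules f clinear_slice_right
        slice_right_prod tensor_prod_scale_right clinear_scaleC)
qed (simp_all add: clinear_tensor_rules assms clinear_compose[OF F] clinear_slice_right)

lemma times_tensor_prod: "t * (b \<otimes> c) = t \<lhd> in_snd c \<lhd> in_fst b"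
proof -
  have "t * (b \<otimes> c) = t \<lhd> (in_snd c * in_fst b)"
    unfolding tensor_multiplier_mult mult_1_left mult_1_right embed_tensor[symmetric] embed_multR ..
  then show ?thesis by (simp add: times_multR)
qed

lemma tensor_prod_times: "(a \<otimes> b) * t = in_fst a \<rhd> in_snd b \<rhd> t"
proof -
  have "(a \<otimes> b) * t = (in_fst a * in_snd b) \<rhd> t"
    unfolding tensor_multiplier_mult mult_1_left mult_1_right embed_tensor[symmetric] embed_multL ..
  then show ?thesis by (simp add: times_multL)
qed

context antipode_data
begin

section \<open>Source and target counital maps\<close>

lemma clinear_tensor_multiplier:
  "clinear h \<Longrightarrow> clinear (\<lambda>x. in_snd (h x) \<rhd> w)"
  by (rule clinearI) (simp_all add: clinear_add clinear_scaleC clinear_add[OF clinear_embed]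
      clinear_scaleC[OF clinear_embed] tensor_multiplier_linear multiplier_simps)

text \<open>The multiplier \<Sum> S(p1) p2. A left factor c makes \<Sum> c S(p1) \<otimes> p2 an
  element through \<open>R2\<close>; a right factor b covers p2 through \<open>t1\<close>.\<close>

definition "eps_s p = multiplier_of (\<lambda>b. tensor_product (tensor_map s (\<lambda>x. x) (t1 (p \<otimes> b))))
    (\<lambda>c. tensor_product (R2 (c \<otimes> p)))"

definition "\<epsilon>\<^sub>t q = multiplier_of (\<lambda>b. tensor_product (R1 (q \<otimes> b)))
    (\<lambda>c. tensor_product (tensor_map (\<lambda>x. x) s (t2 (c \<otimes> q))))"

lemma eps_s_left: "eps_s p \<rhd> b = tensor_product (tensor_map s (\<lambda>x. x) (t1 (p \<otimes> b)))"
  and eps_s_right: "c \<lhd> eps_s p = tensor_product (R2 (c \<otimes> p))"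
proof -
  have "tensor_product (R2 (c \<otimes> p)) * b = c * tensor_product (tensor_map s (\<lambda>x. x) (t1 (p \<otimes> b)))"
      for c b
  proof -
    have "tensor_product (R2 (c \<otimes> p)) * b = tensor_product (R2 (c \<otimes> p) \<lhd> in_snd b)"
      by (simp add: tensor_product_mult embed_multR)
    also have "\<dots> = tensor_product (in_fst c \<rhd> tensor_map s (\<lambda>x. x) (t1 (p \<otimes> b)))"
      unfolding R2_right by (simp add: mult_left_eta tensor_multiplier_eq tensor_map_tensor_map
          clinear_op_rules')
    finally show ?thesis by (simp add: tensor_product_mult embed_multL)
  qed
  note * = multiplier_of[OF nd, OF this, folded eps_s_def]
  show "eps_s p \<rhd> b = tensor_product (tensor_map s (\<lambda>x. x) (t1 (p \<otimes> b)))"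
    "c \<lhd> eps_s p = tensor_product (R2 (c \<otimes> p))" by (rule *)+
qed

lemma \<epsilon>\<^sub>t_left: "\<epsilon>\<^sub>t q \<rhd> b = tensor_product (R1 (q \<otimes> b))"
  and \<epsilon>\<^sub>t_right: "c \<lhd> \<epsilon>\<^sub>t q = tensor_product (tensor_map (\<lambda>x. x) s (t2 (c \<otimes> q)))"
proof -
  have "tensor_product (tensor_map (\<lambda>x. x) s (t2 (c \<otimes> q))) * b = c * tensor_product (R1 (q \<otimes> b))"
      for c b
  proof -
    have "c * tensor_product (R1 (q \<otimes> b)) = tensor_product (in_fst c \<rhd> R1 (q \<otimes> b))"
      by (simp add: tensor_product_mult embed_multL)
    also have "\<dots> = tensor_product (tensor_map (\<lambda>x. x) s (t2 (c \<otimes> q)) \<lhd> in_snd b)"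
      unfolding R1_left by (simp add: embed_multR one_multR tensor_multiplier_eqR
          tensor_map_tensor_map clinear_op_rules')
    finally show ?thesis by (simp add: tensor_product_mult embed_multR)
  qed
  note * = multiplier_of[OF nd, OF this, folded \<epsilon>\<^sub>t_def]
  show "\<epsilon>\<^sub>t q \<rhd> b = tensor_product (R1 (q \<otimes> b))"
    "c \<lhd> \<epsilon>\<^sub>t q = tensor_product (tensor_map (\<lambda>x. x) s (t2 (c \<otimes> q)))" by (rule *)+
qed

lemma eps_t_eq: "eps_t \<Delta> S a = \<epsilon>\<^sub>t a"
  unfolding eps_t_def
proof (rule the_equality)
  have *: "tensor_lift (\<lambda>p q. p \<lhd> S q) r = tensor_product (tensor_map (\<lambda>x. x) s r)" for r
  proof -
    have "cbilinear (\<lambda>p q. p * s q)"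
      by (simp add: cbilinear_def clinear_op_rules')
    note 1 = tensor_lift[OF this]
    show ?thesis
      unfolding S_eq embed_multR
      by (rule tensor_eqI[where t = r]) (simp_all add: 1 clinear_op_rules' tensor_map_prod
          tensor_product_prod)
  qed
  show "\<forall>c. c \<lhd> \<epsilon>\<^sub>t a = tensor_lift (\<lambda>p q. p \<lhd> S q) (t2 (c \<otimes> a))"
    by (simp add: \<epsilon>\<^sub>t_right *)
  show "m = \<epsilon>\<^sub>t a" if "\<forall>c. c \<lhd> m = tensor_lift (\<lambda>p q. p \<lhd> S q) (t2 (c \<otimes> a))" for m
    by (rule multiplier_eqI(2)[OF nd]) (simp add: \<epsilon>\<^sub>t_right that *)
qed

lemma clinear_eps_s: "clinear eps_s" and clinear_eps_t: "clinear \<epsilon>\<^sub>t"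
proof -
  have l1: "clinear (\<lambda>p. tensor_product (tensor_map s (\<lambda>x. x) (t1 (p \<otimes> b))))"
      and l2: "clinear (\<lambda>p. tensor_product (R1 (p \<otimes> b)))" for b
    by (intro clinear_op_rules')+
  show "clinear eps_s"
    by (rule clinearI; rule multiplier_eqI(1)[OF nd])
      (simp_all only: eps_s_left multiplier_simps clinear_add[OF l1] clinear_scaleC[OF l1])
  show "clinear \<epsilon>\<^sub>t"
    by (rule clinearI; rule multiplier_eqI(1)[OF nd])
      (simp_all only: \<epsilon>\<^sub>t_left multiplier_simps clinear_add[OF l2] clinear_scaleC[OF l2])
qed

lemma clinear_eps_L: "clinear h \<Longrightarrow> clinear (\<lambda>x. eps_s (h x) \<rhd> b)" "clinear h
    \<Longrightarrow> clinear (\<lambda>x. \<epsilon>\<^sub>t (h x) \<rhd> b)"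
  and clinear_eps_R: "clinear h \<Longrightarrow> clinear (\<lambda>x. b \<lhd> eps_s (h x))" "clinear h
      \<Longrightarrow> clinear (\<lambda>x. b \<lhd> \<epsilon>\<^sub>t (h x))"
proof -
  assume h: "clinear h"
  note [simp] = clinear_add[OF h] clinear_scaleC[OF h] clinear_add[OF clinear_eps_s]
      clinear_scaleC[OF clinear_eps_s]
    clinear_add[OF clinear_eps_t] clinear_scaleC[OF clinear_eps_t]
  show "clinear (\<lambda>x. eps_s (h x) \<rhd> b)" "clinear (\<lambda>x. \<epsilon>\<^sub>t (h x) \<rhd> b)"
    "clinear (\<lambda>x. b \<lhd> eps_s (h x))" "clinear (\<lambda>x. b \<lhd> \<epsilon>\<^sub>t (h x))"
    by (auto intro!: clinearI simp: multiplier_simps)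
qed

lemma clinear_\<epsilon>: "clinear \<epsilon>"
  and slice_t1: "slice_left \<epsilon> (t1 x) = tensor_product x"
  and slice_t2: "slice_right \<epsilon> (t2 x) = tensor_product x"
proof -
  show \<epsilon>: "clinear \<epsilon>" using counit unfolding counit_def by blast
  have *: "slice_left \<epsilon> (t1 (a \<otimes> b)) = a * b" "slice_right \<epsilon> (t2 (a \<otimes> b)) = a * b" for a b
    using counit unfolding counit_def by blast+
  show "slice_left \<epsilon> (t1 x) = tensor_product x"
    by (rule tensor_eqI[where t = x]) (simp_all add: clinear_op_rules' \<epsilon> tensor_product_prod *)
  show "slice_right \<epsilon> (t2 x) = tensor_product x"
    by (rule tensor_eqI[where t = x]) (simp_all add: clinear_op_rules' \<epsilon> tensor_product_prod *)
qed

lemmas clinear_rules = clinear_op_rules' clinear_eps_L clinear_eps_R clinear_\<epsilon>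
    clinear_tensor_multiplier
  clinear_slice_left[OF clinear_\<epsilon>] clinear_slice_right[OF clinear_\<epsilon>]

lemmas tensor_rules = clinear_rules insert3_prod insert2_prod tensor_map_prod

text \<open>E is T1 R1, and the counit turns T1 into the product. So
  \<open>\<epsilon>\<^sub>t\<close> and \<open>eps_s\<close> are counit slices of \<open>E\<close>,
  and relations for \<open>E\<close> on three legs can be sliced into relations for them.\<close>

lemma slice_E_left: "slice_left \<epsilon> (E \<rhd> (a \<otimes> b)) = \<epsilon>\<^sub>t a \<rhd> b"
  by (simp add: T1_R1 slice_t1 \<epsilon>\<^sub>t_left)

lemma slice_E_right: "slice_right \<epsilon> ((a \<otimes> b) \<lhd> E) = a \<lhd> eps_s b"
  by (simp add: T2_R2 slice_t2 eps_s_right)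

lemma tensor_product_R1_t1: "tensor_product (R1 (t1 x)) = tensor_product x"
  by (metis E_t1 T1_R1 slice_t1)

lemma tensor_product_R2_t2: "tensor_product (R2 (t2 x)) = tensor_product x"
  by (metis E_t2 T2_R2 slice_t2)

text \<open>A is spanned by A \<open>eps_s\<close>(A): the product of R2(b \<otimes> a) is b
  \<open>eps_s\<close>(a), R2 T2 does not change products, and products span A.\<close>

lemma eps_s_induct [case_names eps add]:
  assumes "\<And>b a. P (b \<lhd> eps_s a)" "\<And>x y. P x \<Longrightarrow> P y \<Longrightarrow> P (x + y)"
  shows "P x"
proof (induction x rule: square_induct)
  case (mult a b)
  have "P (tensor_product (R2 r))" for r
    by (induction r rule: tensor_induct)
      (use assms in \<open>simp_all add: eps_s_right clinear_add[OF clinear_tensor_product]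
          clinear_add[OF clinear_R2]\<close>)
  from this[of "t2 (a \<otimes> b)"] show ?case by (simp add: tensor_product_R2_t2 tensor_product_prod)
qed (rule assms(2))

lemma eps_t_induct [case_names eps add]:
  assumes "\<And>b a. P (\<epsilon>\<^sub>t a \<rhd> b)" "\<And>x y. P x \<Longrightarrow> P y \<Longrightarrow> P (x + y)"
  shows "P x"
proof (induction x rule: square_induct)
  case (mult a b)
  have "P (tensor_product (R1 r))" for r
    by (induction r rule: tensor_induct)
      (use assms in \<open>simp_all add: \<epsilon>\<^sub>t_left clinear_add[OF clinear_tensor_product]
          clinear_add[OF clinear_R1]\<close>)
  from this[of "t1 (a \<otimes> b)"] show ?case by (simp add: tensor_product_R1_t1 tensor_product_prod)
qed (rule assms(2))

lemma contract12_product: "contract12 tensor_product (x \<otimes> r) = in_fst x \<rhd> r"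
  by (rule tensor_eqI[where t = r])
    (simp_all add: clinear_rules contract12_prod tensor_product_prod leg_mult_simps embed_multL)

lemma product_insert3: "tensor_map (\<lambda>x. x) tensor_product (insert3 y v) = v \<lhd> in_snd y"
  by (rule tensor_eqI[where t = v])
    (simp_all add: tensor_rules tensor_product_prod leg_mult_simps embed_multR)

text \<open>\<Sum> \<open>eps_s\<close>(a1) \<otimes> a2 = (1 \<otimes> a) E. Coassociativity moves
  \<open>R2\<close> onto d \<otimes> a, and the contraction then leaves T2 R2, which is right
  multiplication by \<open>E\<close>.\<close>

lemma E_eps_s: "tensor_map (\<lambda>p. eps_s p \<rhd> b) (\<lambda>x. x) (t1 (a \<otimes> c)) = in_snd a \<rhd> E \<rhd> (b \<otimes> c)"
proof (rule cancel_left_leg(1)[OF nd])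
  fix d
  have 1: "in_fst d \<rhd> tensor_map (\<lambda>p. eps_s p \<rhd> b) (\<lambda>x. x) r
      = contract12 (\<lambda>x. tensor_product (R2 x)) (d \<otimes> r) \<lhd> in_fst b" for r :: "('a, 'a) tensor"
    by (rule tensor_eqI[where t = r])
      (simp_all add: clinear_rules tensor_map_prod contract12_prod leg_mult_simps embed_multL
          embed_multR mult_balanced flip: eps_s_right)
  have 2: "contract12 tensor_product (leg23 t1 (insert3 c u)) = t2 u \<lhd> in_snd c" for u
    by (rule tensor_eqI[where t = u])
      (simp_all add: tensor_rules contract12_product t1_t2)
  have "in_fst d \<rhd> tensor_map (\<lambda>p. eps_s p \<rhd> b) (\<lambda>x. x) (t1 (a \<otimes> c))
      = ((d \<otimes> a) \<lhd> E) \<lhd> in_snd c \<lhd> in_fst b"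
    unfolding 1 T2_R2 2[symmetric] coassoc_R2[symmetric]
        by (simp add: contract12_leg12 clinear_rules)
  also have "\<dots> = ((d \<otimes> a) \<lhd> E) * (b \<otimes> c)"
    by (simp add: times_tensor_prod)
  also have "\<dots> = in_fst d \<rhd> in_snd a \<rhd> E \<rhd> (b \<otimes> c)"
    by (simp add: mult_balanced tensor_prod_times)
  finally show "in_fst d \<rhd> tensor_map (\<lambda>p. eps_s p \<rhd> b) (\<lambda>x. x) (t1 (a \<otimes> c))
      = in_fst d \<rhd> in_snd a \<rhd> E \<rhd> (b \<otimes> c)" .
qed

lemma leg12_t2_product: "in_fst e \<rhd> t1 u = tensor_map (\<lambda>x. x) tensor_product (leg12 t2 (e \<otimes> u))"
  by (rule tensor_eqI[where t = u]) (simp_all add: clinear_rules t1_t2 leg12_prod product_insert3)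

text \<open>Coassociativity of \<open>R1\<close> in E = T1 R1 gives E(a \<otimes> b) = \<Sum> a1
  \<otimes> a2 S(a3) b, and the last two factors of the second leg combine to
  \<open>\<epsilon>\<^sub>t\<close>.\<close>

lemma E_eps_t: "in_fst e \<rhd> E \<rhd> (a \<otimes> b) = tensor_map (\<lambda>x. x) (\<lambda>q. \<epsilon>\<^sub>t q \<rhd> b) (t2 (e \<otimes> a))"
proof -
  have "tensor_map (\<lambda>x. x) tensor_product (leg23 R1 (insert3 b v))
      = tensor_map (\<lambda>x. x) (\<lambda>q. \<epsilon>\<^sub>t q \<rhd> b) v" for v :: "('a, 'a) tensor"
    by (rule tensor_eqI[where t = v]) (simp_all add: tensor_rules \<epsilon>\<^sub>t_left)
  then show ?thesis by (simp add: T1_R1 leg12_t2_product coassoc_R1)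
qed

lemma R1_eps: "in_fst e \<rhd> R1 u
    = tensor_map (\<lambda>x. x) (\<lambda>x. tensor_product (tensor_map s (\<lambda>x. x) x)) (leg12 t2 (e \<otimes> u))"
proof -
  have "tensor_map (\<lambda>x. x) (\<lambda>x. tensor_product (tensor_map s (\<lambda>x. x) x)) (insert3 b v)
      = tensor_map (\<lambda>x. x) (\<lambda>q. s q * b) v" for b and v :: "('a, 'a) tensor"
    by (rule tensor_eqI[where t = v]) (simp_all add: tensor_rules tensor_product_prod)
  then show ?thesis
    using tensor_eqI[where t = u, of "\<lambda>u. in_fst e \<rhd> R1 u"
        "\<lambda>u. tensor_map (\<lambda>x. x) (\<lambda>x. tensor_product (tensor_map s (\<lambda>x. x) x)) (leg12 t2 (e \<otimes> u))"]
    by (simp add: clinear_rules R1_left leg12_prod)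
qed

lemma G_left: "in_fst e \<rhd> R1 (t1 (a \<otimes> b)) = tensor_map (\<lambda>x. x) (\<lambda>q. eps_s q \<rhd> b) (t2 (e \<otimes> a))"
proof -
  have "tensor_map (\<lambda>x. x) (\<lambda>x. tensor_product (tensor_map s (\<lambda>x. x) x)) (leg23 t1 (insert3 b v))
      = tensor_map (\<lambda>x. x) (\<lambda>q. eps_s q \<rhd> b) v" for v :: "('a, 'a) tensor"
    by (rule tensor_eqI[where t = v]) (simp_all add: tensor_rules eps_s_left)
  then show ?thesis by (simp add: R1_eps coassoc_t1)
qed

text \<open>With E = T1 R1 this is R1 T1 R1 = R1, the identity \<open>antipode_cancel\<close> read
  in the second leg. Together with \<open>t1_G\<close> it makes \<open>R1\<close> a generalised
  inverse of \<open>t1\<close>.\<close>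

lemma R1_E: "R1 (E \<rhd> x) = R1 x"
proof (rule tensor_eqI[where t = x], rule_tac [3] cancel_left_leg(1)[OF nd])
  fix a b e
  let ?m = "\<lambda>x. tensor_product (tensor_map s (\<lambda>x. x) (t1 x))"
  have 1: "tensor_map (\<lambda>x. x) ?m (insert3 c v) = tensor_map (\<lambda>x. x) (\<lambda>q. eps_s q \<rhd> c) v" for c
      and v :: "('a, 'a) tensor"
    by (rule tensor_eqI[where t = v]) (simp_all add: tensor_rules eps_s_left)
  have 2: "in_fst e \<rhd> R1 (t1 u) = tensor_map (\<lambda>x. x) ?m (leg12 t2 (e \<otimes> u))" for u
    by (rule tensor_eqI[where t = u]) (simp_all add: clinear_rules G_left leg12_prod 1)
  have 3: "tensor_map (\<lambda>x. x) ?m (leg23 R1 (insert3 b v)) = tensor_map (\<lambda>x. x) (\<lambda>q. s q * b) v"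
      for v :: "('a, 'a) tensor"
    by (rule tensor_eqI[where t = v]) (simp_all add: clinear_rules insert3_prod tensor_map_prod
        antipode_cancel flip: T1_R1)
  show "in_fst e \<rhd> R1 (E \<rhd> (a \<otimes> b)) = in_fst e \<rhd> R1 (a \<otimes> b)"
    by (simp add: T1_R1 2 coassoc_R1 3 R1_left)
qed (simp_all add: clinear_rules)

lemma t1_G: "t1 (R1 (t1 x)) = t1 x"
  by (simp add: E_t1 flip: T1_R1)

text \<open>\<Sum> a S(b1) b2 S(b3) c can be grouped as a S(b1)
  \<open>\<epsilon>\<^sub>t\<close>(b2) c or as a \<open>eps_s\<close>(b1) S(b2) c.
  \<open>coassoc_R2_R1\<close> equates the groupings, and \<open>antipode_cancel\<close> evaluates
  the second.\<close>

lemma antipode_cancel': "tensor_product (tensor_map (\<lambda>x. x) s ((a \<otimes> b) \<lhd> E)) = a * s b"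
proof (rule nondegenerate_eqI(1)[OF nd])
  fix c
  have 1: "tensor_product (tensor_map (\<lambda>x. x) s (t2 u)) * c
      = tensor_product (tensor_map (\<lambda>x. x) tensor_product (leg23 R1 (insert3 c u)))" for u
    by (rule tensor_eqI[where t = u])
      (simp_all add: clinear_rules insert3_prod tensor_map_prod tensor_product_prod mult_balanced
          flip: \<epsilon>\<^sub>t_right \<epsilon>\<^sub>t_left)
  have 2: "tensor_product (tensor_map (\<lambda>x. x) tensor_product (leg12 R2 (a \<otimes> r)))
      = a * tensor_product (tensor_map s (\<lambda>x. x) (t1 r))" for r
    by (rule tensor_eqI[where t = r])
      (simp_all add: clinear_rules leg12_prod product_insert3 tensor_product_mult embed_multR
          mult_balanced flip: eps_s_right eps_s_left)
  show "tensor_product (tensor_map (\<lambda>x. x) s ((a \<otimes> b) \<lhd> E)) * c = a * s b * c"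
    by (simp add: T2_R2 1 2 antipode_cancel mult.assoc flip: coassoc_R2_R1 T1_R1)
qed

end

lemma clinear_scale_compose: "clinear h \<Longrightarrow> clinear (\<lambda>x. c *\<^sub>C h x)"
  by (simp add: clinear_iff scaleC_add_right scaleC_scaleC mult.commute)

context antipode_data
begin

subsection \<open>The base algebras\<close>

lemma E12_leg12: "E12 E \<rhd> x = leg12 ((\<rhd>) E) x" "x \<lhd> E12 E = leg12 (\<lambda>x. x \<lhd> E) x"
  unfolding E12_def by (rule leg12_multiplier_insert[OF nd nd nd])+

lemma E_leg23: "(1 \<otimes>\<^sub>M E) \<rhd> x = leg23 ((\<rhd>) E) x" "x \<lhd> (1 \<otimes>\<^sub>M E) = leg23 (\<lambda>x. x \<lhd> E) x"
  by (simp_all add: tensor_multiplier_eq tensor_multiplier_eqR mult_left_eta one_multR)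

lemma E_leg_commute: "leg12 ((\<rhd>) E) (leg23 ((\<rhd>) E) x) = leg23 ((\<rhd>) E) (leg12 ((\<rhd>) E) x)"
  "leg12 (\<lambda>x. x \<lhd> E) (leg23 (\<lambda>x. x \<lhd> E) x) = leg23 (\<lambda>x. x \<lhd> E) (leg12 (\<lambda>x. x \<lhd> E) x)"
  unfolding E12_leg12[symmetric] E_leg23[symmetric]
      by (simp_all flip: times_multL times_multR add: E_commute)

lemma clinear_E: "clinear ((\<rhd>) E)" "clinear (\<lambda>x. x \<lhd> E)"
  by (rule clinear_multL clinear_multR)+

text \<open>Slicing the third leg by the counit turns right multiplication by \<open>E\<close> on
  legs 2 and 3 into 1 \<otimes> \<open>eps_s\<close>(c), and \<open>E\<close> on legs 1 and 2
  commutes with the former by axiom.\<close>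

lemma E_eps_s_commute: "E * (1 \<otimes>\<^sub>M eps_s c) = (1 \<otimes>\<^sub>M eps_s c) * E"
proof (rule multiplier_eqI(2)[OF nd2])
  fix u
  let ?sl = "tensor_map (\<lambda>x. x) (slice_right \<epsilon>)"
  have 1: "?sl (leg23 (\<lambda>x. x \<lhd> E) (insert3 c v)) = v \<lhd> (1 \<otimes>\<^sub>M eps_s c)" for v :: "('a, 'a) tensor"
    by (rule tensor_eqI[where t = v])
      (simp_all add: tensor_rules slice_E_right leg_mult_simps)
  have "u \<lhd> E \<lhd> (1 \<otimes>\<^sub>M eps_s c) = ?sl (leg23 (\<lambda>x. x \<lhd> E) (leg12 (\<lambda>x. x \<lhd> E) (insert3 c u)))"
    by (simp add: leg12_insert3[OF clinear_E(2)] 1)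
  also have "\<dots> = u \<lhd> (1 \<otimes>\<^sub>M eps_s c) \<lhd> E"
    unfolding E_leg_commute(2)[symmetric] leg12_slice_right[OF clinear_\<epsilon> clinear_E(2)] 1 ..
  finally show "u \<lhd> (E * (1 \<otimes>\<^sub>M eps_s c)) = u \<lhd> ((1 \<otimes>\<^sub>M eps_s c) * E)"
    by (simp add: times_multR)
qed

lemma E_eps_t_commute: "E * (\<epsilon>\<^sub>t a \<otimes>\<^sub>M 1) = (\<epsilon>\<^sub>t a \<otimes>\<^sub>M 1) * E"
proof (rule multiplier_eqI(1)[OF nd2])
  fix u
  have 1: "slice_left \<epsilon> (leg12 ((\<rhd>) E) (a \<otimes> v)) = (\<epsilon>\<^sub>t a \<otimes>\<^sub>M 1) \<rhd> v" for v :: "('a, 'a) tensor"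
  proof (rule tensor_eqI[where t = v])
    have *: "slice_left \<epsilon> (insert3 c v) = slice_left \<epsilon> v \<otimes> c" for c :: 'a and v :: "('a, 'a) tensor"
      by (rule tensor_eqI[where t = v])
        (simp_all add: tensor_rules slice_left_prod tensor_prod_scale_left)
    show "slice_left \<epsilon> (leg12 ((\<rhd>) E) (a \<otimes> x \<otimes> y)) = (\<epsilon>\<^sub>t a \<otimes>\<^sub>M 1) \<rhd> (x \<otimes> y)" for x y :: 'a
      by (simp add: leg12_prod[OF clinear_multL] * slice_E_left leg_mult_simps)
  qed (simp_all add: clinear_rules)
  have "(\<epsilon>\<^sub>t a \<otimes>\<^sub>M 1) \<rhd> E \<rhd> u = slice_left \<epsilon> (leg12 ((\<rhd>) E) (leg23 ((\<rhd>) E) (a \<otimes> u)))"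
    by (simp add: tensor_rules 1)
  also have "\<dots> = E \<rhd> (\<epsilon>\<^sub>t a \<otimes>\<^sub>M 1) \<rhd> u"
    unfolding E_leg_commute slice_left_leg23[OF clinear_\<epsilon> clinear_E(1)] 1 ..
  finally show "(E * (\<epsilon>\<^sub>t a \<otimes>\<^sub>M 1)) \<rhd> u = ((\<epsilon>\<^sub>t a \<otimes>\<^sub>M 1) * E) \<rhd> u"
    by (simp add: times_multL)
qed

text \<open>Slice the previous kind of relation, \<open>E_eps_s_commute\<close>, on its first leg by
  the counit, which turns \<open>E\<close> into \<open>\<epsilon>\<^sub>t\<close>.\<close>

lemma eps_commute: "eps_s c * \<epsilon>\<^sub>t a = \<epsilon>\<^sub>t a * eps_s c"
proof (rule multiplier_eqI(1)[OF nd])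
  fix b
  have "\<epsilon>\<^sub>t a \<rhd> eps_s c \<rhd> b = slice_left \<epsilon> ((E * (1 \<otimes>\<^sub>M eps_s c)) \<rhd> (a \<otimes> b))"
    by (simp add: times_multL leg_mult_simps slice_E_left)
  also have "\<dots> = eps_s c \<rhd> \<epsilon>\<^sub>t a \<rhd> b"
    unfolding E_eps_s_commute by (simp add: times_multL slice_left_mult clinear_\<epsilon> slice_E_left)
  finally show "(eps_s c * \<epsilon>\<^sub>t a) \<rhd> b = (\<epsilon>\<^sub>t a * eps_s c) \<rhd> b"
    by (simp add: times_multL)
qed


subsection \<open>Pentagon equations\<close>

lemma left_insert3: "in_fst e \<rhd> insert3 c u = insert3 c (in_fst e \<rhd> u)"
  and left_insert2: "in_fst e \<rhd> insert2 c u = insert2 c (in_fst e \<rhd> u)"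
  for u :: "('a, 'a) tensor" and c :: 'a
  unfolding tensor_multiplier_one[symmetric, where ?'a = 'a and ?'b = 'a]
  by (simp_all add: tensor_multiplier_insert3 tensor_multiplier_insert2 one_multL)

lemma left_leg23: "clinear F \<Longrightarrow> in_fst e \<rhd> tensor_map (\<lambda>x. x) F x
    = tensor_map (\<lambda>x. x) F (in_fst e \<rhd> x)"
  by (simp add: tensor_multiplier_eq mult_left_eta tensor_map_tensor_map clinear_rules)

lemma leg12_t1_insert2:
  "in_fst e \<rhd> leg12 t1 (insert2 w r) = leg12 t2 (e \<otimes> r) \<lhd> (1 \<otimes>\<^sub>M embed w \<otimes>\<^sub>M 1)"
  for r :: "('a, 'a) tensor"
  by (rule tensor_eqI[where t = r])
    (simp_all add: tensor_rules leg12_prod left_insert3 t1_t2 tensor_multiplier_insert3 one_multR)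

text \<open>Both sides send a \<otimes> b \<otimes> c to \<Sum> a1 \<otimes> a2 b1 \<otimes> a3 b2
  c, by coassociativity and multiplicativity of \<open>\<Delta>\<close>.\<close>

lemma pentagon1: "leg23 t1 (leg12 t1 x) = leg12 t1 (leg13 t1 (leg23 t1 x))"
proof (rule tensor_eqI3[where t = x], rule_tac [3] cancel_left_leg(1)[OF nd])
  fix a b c e
  let ?M = "\<lambda>w. tensor_map (\<lambda>x. x) (\<lambda>q. \<Delta> q \<rhd> w) (t2 (e \<otimes> a))"
  have 1: "leg23 t1 (insert3 c (u \<lhd> in_snd b)) = tensor_map (\<lambda>x. x) (\<lambda>q. \<Delta> q \<rhd> t1 (b \<otimes> c)) u"
      for u :: "('a, 'a) tensor"
    by (rule tensor_eqI[where t = u])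
      (simp_all add: tensor_rules leg_mult_simps embed_multR t1_mult_left)
  have 2: "leg23 t1 (insert3 v u) \<lhd> (1 \<otimes>\<^sub>M embed w \<otimes>\<^sub>M 1)
      = tensor_map (\<lambda>x. x) (\<lambda>q. \<Delta> q \<rhd> (w \<otimes> v)) u" for v w and u :: "('a, 'a) tensor"
    by (rule tensor_eqI[where t = u])
      (simp_all add: tensor_rules leg_mult_simps \<Delta>_multL)
  have 3: "in_fst e \<rhd> leg12 t1 (leg13 t1 (a \<otimes> w)) = ?M w" for w
  proof (rule tensor_eqI[where t = w])
    show "in_fst e \<rhd> leg12 t1 (leg13 t1 (a \<otimes> x \<otimes> y)) = ?M (x \<otimes> y)" for x y
      by (simp add: leg13_prod clinear_rules leg12_t1_insert2 coassoc_t1 2)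
    have *: "clinear (\<lambda>w. tensor_map (\<lambda>x. x) (\<lambda>q. \<Delta> q \<rhd> w) v)" for v :: "('a, 'a) tensor"
      by (rule clinearI; induction v rule: tensor_induct)
        (simp_all add: tensor_rules clinear_scale_compose tensor_map_add multiplier_simps
            tensor_prod_add_right tensor_prod_scale_right scaleC_add_right)
    show "clinear ?M" by (rule *)
  qed (simp_all add: clinear_rules)
  show "in_fst e \<rhd> leg23 t1 (leg12 t1 (a \<otimes> b \<otimes> c))
      = in_fst e \<rhd> leg12 t1 (leg13 t1 (leg23 t1 (a \<otimes> b \<otimes> c)))"
    by (simp add: left_leg23 leg12_prod tensor_rules left_insert3 t1_t2 1 3)
qed (simp_all add: clinear_rules)

lemma pentagon2: "leg12 t2 (leg23 t2 x) = leg23 t2 (leg13 t2 (leg12 t2 x))"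
proof (rule tensor_eqI3[where t = x], rule_tac [3] cancel_leg3[OF nd])
  fix a b c and d :: 'a
  let ?D = "leg23 (\<lambda>u. u \<lhd> in_snd d)"
  have D: "?D (leg12 t2 x) = leg12 t2 (?D x)" for x :: "('a, ('a, 'a) tensor) tensor"
    unfolding tensor_multiplier_eqR one_multR
        by (rule leg12_map3[symmetric]) (simp_all add: clinear_rules)
  have 1: "?D (leg23 t2 (insert2 q r)) = (1 \<otimes>\<^sub>M embed q \<otimes>\<^sub>M 1) \<rhd> leg23 t1 (insert3 d r)" for q
      and r :: "('a, 'a) tensor"
    by (rule tensor_eqI[where t = r])
      (simp_all add: tensor_rules t1_t2[symmetric] leg_mult_simps)
  \<comment> \<open>\<open>K\<close> puts w \<Delta>(u) on the first two legs and v on the third,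
    the common form of both sides: \<Sum> a b1 c1 \<otimes> b2 c2 \<otimes> c3 d.\<close>
  define K where "K w = tensor_lift (\<lambda>u (v :: 'a). insert3 v (w \<lhd> \<Delta> u))" for w :: "('a, 'a) tensor"
  have K: "clinear (K w)" "K w (u \<otimes> v) = insert3 v (w \<lhd> \<Delta> u)" for u w and v :: 'a
  proof -
    have "cbilinear (\<lambda>u v :: 'a. insert3 v (w \<lhd> \<Delta> u))"
      by (simp add: cbilinear_def clinear_rules clinear_insert3_right)
    then show "clinear (K w)" "K w (u \<otimes> v) = insert3 v (w \<lhd> \<Delta> u)"
      unfolding K_def by (rule tensor_lift)+
  qed
  have K_left: "clinear (\<lambda>w. K w r)" for r
    by (rule clinearI; induction r rule: tensor_induct)
      (simp_all add: K(2) clinear_add[OF K(1)] multiplier_simps clinear_add[OF clinear_insert3]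
        clinear_scaleC[OF clinear_insert3] scaleC_add_right)
  have 2: "(1 \<otimes>\<^sub>M embed q \<otimes>\<^sub>M 1) \<rhd> leg12 t2 (p \<otimes> r) = K (p \<otimes> q) r" for p q r
    by (rule tensor_eqI[where t = r])
      (simp_all add: clinear_rules K leg12_prod tensor_multiplier_insert3 one_multL \<Delta>_multR)
  have 3: "leg12 t2 (a \<otimes> (in_fst b \<rhd> r)) = K (t2 (a \<otimes> b)) r" for r
    by (rule tensor_eqI[where t = r])
      (simp_all add: clinear_rules K leg12_prod leg_mult_simps embed_multL t2_mult_right)
  have 4: "?D (leg23 t2 (leg13 t2 (insert3 c w))) = K w (t1 (c \<otimes> d))" for w
    by (rule tensor_eqI[where t = w])
      (simp_all add: clinear_rules K_left insert3_prod leg13_prod 1 2 flip: coassoc_t1)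
  show "?D (leg12 t2 (leg23 t2 (a \<otimes> b \<otimes> c))) = ?D (leg23 t2 (leg13 t2 (leg12 t2 (a \<otimes> b \<otimes> c))))"
    unfolding D by (simp add: leg12_prod tensor_map_prod clinear_rules 4 3 flip: t1_t2)
qed (simp_all add: clinear_rules)

text \<open>This is the axiom (id \<otimes> \<Delta>)(E) = (E \<otimes> 1)(1 \<otimes> E) applied to
  elements; the values of id \<otimes> \<Delta> absorb the factor 1 \<otimes> E.\<close>

lemma E_t1_leg: "leg12 ((\<rhd>) E) (leg23 t1 x) = leg23 t1 (leg12 ((\<rhd>) E) x)"
proof -
  \<comment> \<open>The axiom names the extension only by a description, so id \<otimes> \<Delta>
    must first be shown to be extendable with 1 \<otimes> E as its value at 1.\<close>
  interpret idc: extendable_hom "id_coproduct \<Delta>" "1 \<otimes>\<^sub>M E"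
  proof (rule extendable_hom.intro)
    show "nondegenerate TYPE(('a, ('a, 'a) tensor) tensor)" by (rule nd3)
    show "clinear (id_coproduct \<Delta>)" by (rule clinear_id_coproduct)
    note add = clinear_add[OF clinear_id_coproduct]
    show "id_coproduct \<Delta> (x * y) = id_coproduct \<Delta> x * id_coproduct \<Delta> y" for x y
    proof (induction x rule: tensor_induct)
      case (prod a b)
      show ?case
        by (induction y rule: tensor_induct)
          (simp_all add: tensor_times_prod id_coproduct_prod embed_mult \<Delta>_mult
              tensor_multiplier_mult add distrib_left)
    qed (simp add: add distrib_right)
    show "(1 \<otimes>\<^sub>M E) * id_coproduct \<Delta> x = id_coproduct \<Delta> x" "id_coproduct \<Delta> x * (1 \<otimes>\<^sub>M E)
        = id_coproduct \<Delta> x" for x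
      by (induction x rule: tensor_induct)
        (simp_all add: id_coproduct_prod tensor_multiplier_mult E_\<Delta> \<Delta>_E add distrib_left
            distrib_right)
    show "(1 \<otimes>\<^sub>M E) * (1 \<otimes>\<^sub>M E) = (1 :: 'a multiplier) \<otimes>\<^sub>M E"
        by (simp add: tensor_multiplier_mult E_idem)
    show "(1 \<otimes>\<^sub>M E) \<rhd> x \<in> cvec.span {id_coproduct \<Delta> a \<rhd> y |a y. True}"
        for x :: "('a, ('a, 'a) tensor) tensor"
    proof (induction x rule: tensor_induct)
      case (prod a u)
      show ?case
      proof (induction a rule: square_induct)
        case (mult a b)
        have "(a * b) \<otimes> v \<in> cvec.span {id_coproduct \<Delta> a \<rhd> y |a y. True}"
            if "v \<in> cvec.span {\<Delta> a \<rhd> y |a y. True}" for v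
          using that
        proof (induction rule: cvec.span_induct_alt)
          case (step c x y)
          then obtain p w where "x = \<Delta> p \<rhd> w" by blast
          then have "(a * b) \<otimes> x = id_coproduct \<Delta> (a \<otimes> p) \<rhd> (b \<otimes> w)"
            by (simp add: id_coproduct_prod tensor_multiplier_multL embed_multL)
          then have "(a * b) \<otimes> x \<in> cvec.span {id_coproduct \<Delta> a \<rhd> y |a y. True}"
              by (auto intro: cvec.span_base)
          with step show ?case
            by (simp add: tensor_prod_add_right tensor_prod_scale_right cvec.span_add
                cvec.span_scale)
        qed (simp add: cvec.span_zero)
        then show ?case using cover_\<Delta>_left[of u] by (simp add: leg_mult_simps)
      qed (simp add: tensor_prod_add_left multiplier_simps cvec.span_add)
    qed (simp add: multiplier_simps cvec.span_add)
    show "x \<lhd> (1 \<otimes>\<^sub>M E) \<in> cvec.span {y \<lhd> id_coproduct \<Delta> a |a y. True}"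
        for x :: "('a, ('a, 'a) tensor) tensor"
    proof (induction x rule: tensor_induct)
      case (prod a u)
      show ?case
      proof (induction a rule: square_induct)
        case (mult a b)
        have "(a * b) \<otimes> v \<in> cvec.span {y \<lhd> id_coproduct \<Delta> a |a y. True}"
            if "v \<in> cvec.span {y \<lhd> \<Delta> a |a y. True}" for v
          using that
        proof (induction rule: cvec.span_induct_alt)
          case (step c x y)
          then obtain p w where "x = w \<lhd> \<Delta> p" by blast
          then have "(a * b) \<otimes> x = (a \<otimes> w) \<lhd> id_coproduct \<Delta> (b \<otimes> p)"
            by (simp add: id_coproduct_prod tensor_multiplier_multR embed_multR)
          then have "(a * b) \<otimes> x \<in> cvec.span {y \<lhd> id_coproduct \<Delta> a |a y. True}"
              by (auto intro: cvec.span_base)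
          with step show ?case
            by (simp add: tensor_prod_add_right tensor_prod_scale_right cvec.span_add
                cvec.span_scale)
        qed (simp add: cvec.span_zero)
        then show ?case using cover_\<Delta>_right[of u] by (simp add: leg_mult_simps)
      qed (simp add: tensor_prod_add_left multiplier_simps cvec.span_add)
    qed (simp add: multiplier_simps cvec.span_add)
  qed
  have *: "id_coproduct \<Delta> (E \<rhd> t) = E12 E * id_coproduct \<Delta> t" for t
    using idc.hom_extension_times(1)[of E t] by (simp add: id_coproduct_E mult.assoc idc.unit_f)
  show ?thesis
  proof (rule tensor_eqI3[where t = x])
    fix a b c
    have "embed (leg23 t1 (insert3 c (E \<rhd> (a \<otimes> b)))) = E12 E * embed (leg23 t1 (insert3 c (a \<otimes> b)))"
      unfolding id_coproduct_t1[symmetric] * by (simp add: mult.assoc)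
    then have "leg23 t1 (insert3 c (E \<rhd> (a \<otimes> b))) = leg12 ((\<rhd>) E) (leg23 t1 (insert3 c (a \<otimes> b)))"
      by (simp add: embed_multiplier embed_inject[OF nd3] E12_leg12)
    then show "leg12 ((\<rhd>) E) (leg23 t1 (a \<otimes> b \<otimes> c)) = leg23 t1 (leg12 ((\<rhd>) E) (a \<otimes> b \<otimes> c))"
      by (simp add: leg12_prod[OF clinear_multL] insert3_prod)
  qed (simp_all add: clinear_rules)
qed


section \<open>Absorption of the idempotent by iterated coproducts\<close>

abbreviation "G x \<equiv> R1 (t1 x)"

lemma E_eta: "(\<rhd>) E = (\<lambda>x. t1 (R1 x))"
  by (simp add: fun_eq_iff T1_R1)

lemma clinear_G: "clinear (\<lambda>x. G x)"
  by (intro clinear_rules)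

text \<open>G(a \<otimes> b) = \<Sum> a1 \<otimes> \<open>eps_s\<close>(a2) b, and
  \<open>E_eps_s\<close> trades \<open>eps_s\<close>(a2) \<otimes> a3 for (1 \<otimes> a2) E. It is
  the equation that characterises \<open>G1\<close>, here for R1 T1.\<close>

lemma G_t1_leg: "leg12 G (leg13 t1 x) = leg13 t1 (leg23 ((\<rhd>) E) x)"
proof (rule tensor_eqI3[where t = x], rule_tac [3] cancel_left_leg(1)[OF nd])
  fix a b c :: 'a and e
  let ?M = "\<lambda>w :: ('a, 'a) tensor. tensor_map (\<lambda>x. x) (\<lambda>y. in_snd y \<rhd> w) (t2 (e \<otimes> a))"
  have 1: "insert3 q (tensor_map (\<lambda>x. x) (\<lambda>y. eps_s y \<rhd> b) v)
      = tensor_map (\<lambda>x. x) (tensor_map (\<lambda>p. eps_s p \<rhd> b) (\<lambda>x. x)) (insert3 q v)" for q :: 'a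
          and v :: "('a, 'a) tensor"
    by (rule tensor_eqI[where t = v]) (simp_all add: tensor_rules)
  have 2: "in_fst e \<rhd> leg12 G (insert2 b r)
      = tensor_map (\<lambda>x. x) (tensor_map (\<lambda>p. eps_s p \<rhd> b) (\<lambda>x. x)) (leg12 t2 (e \<otimes> r))"
          for r :: "('a, 'a) tensor"
    by (rule tensor_eqI[where t = r])
      (simp_all add: tensor_rules clinear_G leg12_prod left_insert3 G_left 1)
  have 3: "tensor_map (\<lambda>x. x) (tensor_map (\<lambda>p. eps_s p \<rhd> b) (\<lambda>x. x)) (leg23 t1 (insert3 c v))
      = tensor_map (\<lambda>x. x) (\<lambda>y. in_snd y \<rhd> E \<rhd> (b \<otimes> c)) v" for v :: "('a, 'a) tensor"
    by (rule tensor_eqI[where t = v]) (simp_all add: tensor_rules E_eps_s)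
  have 4: "insert2 f (v \<lhd> in_snd g) = tensor_map (\<lambda>x. x) (\<lambda>y. in_snd y \<rhd> (f \<otimes> g)) v" for f g
      and v :: "('a, 'a) tensor"
    by (rule tensor_eqI[where t = v])
      (simp_all add: tensor_rules leg_mult_simps embed_multL embed_multR)
  have 5: "in_fst e \<rhd> leg13 t1 (a \<otimes> w) = ?M w" for w :: "('a, 'a) tensor"
  proof (rule tensor_eqI[where t = w])
    show "in_fst e \<rhd> leg13 t1 (a \<otimes> f \<otimes> g) = ?M (f \<otimes> g)" for f g :: 'a
      by (simp add: leg13_prod clinear_rules left_insert2 t1_t2 4)
    have "clinear (\<lambda>w :: ('a, 'a) tensor. tensor_map (\<lambda>x. x) (\<lambda>y. in_snd y \<rhd> w) v)"
        for v :: "('a, 'a) tensor"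
      by (rule clinearI; induction v rule: tensor_induct)
        (simp_all add: tensor_rules clinear_scale_compose tensor_map_add multiplier_simps
            tensor_prod_add_right tensor_prod_scale_right scaleC_add_right)
    then show "clinear ?M" .
  qed (simp_all add: clinear_rules)
  show "in_fst e \<rhd> leg12 G (leg13 t1 (a \<otimes> b \<otimes> c))
      = in_fst e \<rhd> leg13 t1 (leg23 ((\<rhd>) E) (a \<otimes> b \<otimes> c))"
    by (simp add: leg13_prod tensor_rules 2 coassoc_t1 3 5)
qed (simp_all add: clinear_rules clinear_G)

text \<open>Inserting \<open>G\<close> on legs 1 and 2 changes nothing, as T1 R1 T1 = T1, but it
  creates inside an E = T1 R1 on legs 2 and 3. The pentagon then brings a T1 on these legs to the
  outside, whose range \<open>E\<close> fixes.\<close>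

lemma E_t1_t1: "leg23 ((\<rhd>) E) (leg12 t1 (leg13 t1 x)) = leg12 t1 (leg13 t1 x)"
proof -
  have *: "leg23 ((\<rhd>) E) (leg12 t1 (leg13 t1 (leg23 t1 y))) = leg12 t1 (leg13 t1 (leg23 t1 y))"
      for y
    unfolding pentagon1[symmetric] by (simp add: leg23_leg23 clinear_rules E_t1 clinear_E)
  have "leg12 t1 (leg13 t1 x) = leg12 t1 (leg12 G (leg13 t1 x))"
    by (simp add: leg12_leg12 clinear_rules clinear_G t1_G)
  also have "\<dots> = leg12 t1 (leg13 t1 (leg23 t1 (leg23 R1 x)))"
    unfolding G_t1_leg by (simp add: leg23_leg23 clinear_rules E_eta)
  finally show ?thesis using * by simp
qed

text \<open>\<open>(\<Delta> \<otimes> id)(E) = (1 \<otimes> E)(E \<otimes> 1)\<close>, the counterpart of the axiom on \<open>(id \<otimes> \<Delta>)(E)\<close>; both sides are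
  compared after multiplication with \<open>\<Delta>\<^sup>(\<^sup>2\<^sup>)(A)\<close>, which generates \<open>(E \<otimes> 1)(1 \<otimes> E)(A \<otimes> A \<otimes> A)\<close>.\<close>

lemma E_t2_leg: "leg12 t2 (leg23 (\<lambda>x. x \<lhd> E) x) = leg23 (\<lambda>x. x \<lhd> E) (leg12 t2 x)"
proof -
  let ?E12 = "leg12 (\<lambda>x. x \<lhd> E)" and ?E23 = "leg23 (\<lambda>x. x \<lhd> E)"
  \<comment> \<open>Here E = T2 R2 on legs 2 and 3, and \<open>pentagon2\<close> brings a T2 on
    these legs to the outside.\<close>
  have absorb: "?E23 (leg12 t2 (?E23 x)) = leg12 t2 (?E23 x)" for x
  proof -
    have "leg12 t2 (?E23 x) = leg23 t2 (leg13 t2 (leg12 t2 (leg23 R2 x)))"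
      unfolding pentagon2[symmetric] by (simp add: leg23_leg23 clinear_rules T2_R2)
    then show ?thesis by (simp add: leg23_leg23 clinear_rules E_t2)
  qed
  have mult: "leg12 t2 (a \<otimes> t) * leg12 t1 (insert2 f r) = in_fst a \<rhd> leg12 t1 (insert2 f (t * r))"
      for a t and f :: 'a and r :: "('a, 'a) tensor"
  proof (rule tensor_eqI[where t = t])
    fix b c
    show "leg12 t2 (a \<otimes> b \<otimes> c) * leg12 t1 (insert2 f r)
        = in_fst a \<rhd> leg12 t1 (insert2 f ((b \<otimes> c) * r))"
      by (rule tensor_eqI[where t = r])
        (simp_all add: tensor_rules leg12_prod insert3_mult tensor_times_prod left_insert3
            t2_times t1_mult_left)
  qed (simp_all add: clinear_rules)
  \<comment> \<open>Against iterated coproducts both copies of \<open>E\<close> are invisible: the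
    outer one by \<open>E_t1_t1\<close>, the inner one because E T1 = T1.\<close>
  have test: "?E23 (leg12 t2 (a \<otimes> t)) * leg12 t1 (leg13 t1 y)
      = ?E23 (leg12 t2 (a \<otimes> (t \<lhd> E))) * leg12 t1 (leg13 t1 y)" for a t y
  proof (rule tensor_eqI3[where t = y])
    fix u f g
    have *: "?E23 v * leg12 t1 (leg13 t1 z) = v * leg12 t1 (leg13 t1 z)" for v z
      using E_t1_t1[of z] by (metis E_leg23 mult_balanced)
    have "t * t1 (u \<otimes> g) = (t \<lhd> E) * t1 (u \<otimes> g)" by (simp add: mult_balanced E_t1)
    then show "?E23 (leg12 t2 (a \<otimes> t)) * leg12 t1 (leg13 t1 (u \<otimes> f \<otimes> g))
        = ?E23 (leg12 t2 (a \<otimes> (t \<lhd> E))) * leg12 t1 (leg13 t1 (u \<otimes> f \<otimes> g))"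
      unfolding * by (simp add: leg13_prod clinear_rules mult)
  qed (simp_all add: clinear_rules)
  \<comment> \<open>Every (E \<otimes> 1)(1 \<otimes> E) z has the form just tested: use E = T1 R1
    twice, then \<open>E_t1_leg\<close> and the pentagon.\<close>
  have dense: "\<exists>y. leg12 ((\<rhd>) E) (leg23 ((\<rhd>) E) z) = leg12 t1 (leg13 t1 y)" for z
  proof -
    have "leg12 ((\<rhd>) E) (leg23 ((\<rhd>) E) z) = leg12 ((\<rhd>) E) (leg23 t1 (leg23 R1 z))"
      by (simp add: leg23_leg23 clinear_rules E_eta)
    also have "\<dots> = leg23 t1 (leg12 t1 (leg12 R1 (leg23 R1 z)))"
      unfolding E_t1_leg by (simp add: leg12_leg12 clinear_rules E_eta)
    also have "\<dots> = leg12 t1 (leg13 t1 (leg23 t1 (leg12 R1 (leg23 R1 z))))" by (rule pentagon1)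
    finally show ?thesis by blast
  qed
  have support: "?E23 (leg12 t2 x) * z = ?E23 (leg12 t2 x) * leg12 ((\<rhd>) E) (leg23 ((\<rhd>) E) z)"
      for x z
  proof -
    have "?E12 (leg12 t2 x) = leg12 t2 x" by (simp add: leg12_leg12 clinear_rules E_t2)
    then have "?E12 (?E23 (leg12 t2 x)) = ?E23 (leg12 t2 x)" by (simp add: E_leg_commute)
    moreover have "?E23 (?E23 (leg12 t2 x)) = ?E23 (leg12 t2 x)"
      by (simp add: leg23_leg23 clinear_rules E_idem flip: times_multR)
    ultimately show ?thesis by (metis E12_leg12 E_leg23 mult_balanced)
  qed
  have eq: "?E23 (leg12 t2 (a \<otimes> t)) = ?E23 (leg12 t2 (a \<otimes> (t \<lhd> E)))" for a t
  proof (rule nondegenerate_eqI(1)[OF nd3])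
    fix z
    obtain y where y: "leg12 ((\<rhd>) E) (leg23 ((\<rhd>) E) z) = leg12 t1 (leg13 t1 y)" using dense by blast
    show "?E23 (leg12 t2 (a \<otimes> t)) * z = ?E23 (leg12 t2 (a \<otimes> (t \<lhd> E))) * z"
      unfolding support[of _ z] y by (rule test)
  qed
  have "?E23 (leg12 t2 x) = ?E23 (leg12 t2 (?E23 x))"
    by (rule tensor_eqI[where t = x]) (simp_all add: tensor_rules eq[symmetric])
  then show ?thesis by (simp add: absorb)
qed

text \<open>Slice the third leg of \<open>E_t2_leg\<close> by the counit. This is what puts
  \<open>eps_s\<close> into the source algebra.\<close>

lemma \<Delta>_eps_s: "\<Delta> (b \<lhd> eps_s c) = \<Delta> b * (1 \<otimes>\<^sub>M eps_s c)"
proof -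
  let ?sl = "tensor_map (\<lambda>x. x) (slice_right \<epsilon>)"
  have 1: "?sl (leg23 (\<lambda>x. x \<lhd> E) (insert3 c v)) = v \<lhd> (1 \<otimes>\<^sub>M eps_s c)" for v :: "('a, 'a) tensor"
    by (rule tensor_eqI[where t = v])
      (simp_all add: tensor_rules slice_E_right leg_mult_simps)
  have t2: "t2 (a \<otimes> (b \<lhd> eps_s c)) = t2 (a \<otimes> b) \<lhd> (1 \<otimes>\<^sub>M eps_s c)" for a
  proof -
    have "t2 (a \<otimes> (b \<lhd> eps_s c)) = ?sl (leg12 t2 (leg23 (\<lambda>x. x \<lhd> E) (a \<otimes> b \<otimes> c)))"
      by (simp add: leg12_slice_right clinear_\<epsilon> tensor_rules slice_E_right)
    also have "\<dots> = t2 (a \<otimes> b) \<lhd> (1 \<otimes>\<^sub>M eps_s c)"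
      unfolding E_t2_leg by (simp add: leg12_prod clinear_rules 1)
    finally show ?thesis .
  qed
  show ?thesis
  proof (rule multiplier_eqI(1)[OF nd2], rule cancel_left_leg(1)[OF nd])
    fix \<xi> a
    show "in_fst a \<rhd> \<Delta> (b \<lhd> eps_s c) \<rhd> \<xi> = in_fst a \<rhd> (\<Delta> b * (1 \<otimes>\<^sub>M eps_s c)) \<rhd> \<xi>"
      using t2[of a] by (simp add: times_multL mult_balanced flip: t2_times)
  qed
qed

text \<open>\<Delta>(a) \<Delta>(y b) = \<Delta>(a y) \<Delta>(b) = \<Delta>(a)(1 \<otimes> y)
  \<Delta>(b). Commutation of 1 \<otimes> y with \<open>E\<close> allows \<Delta>(a) to be
  cancelled.\<close>

lemma \<Delta>_source_left:
  assumes "E * (1 \<otimes>\<^sub>M y) = (1 \<otimes>\<^sub>M y) * E" "\<And>b. \<Delta> (b \<lhd> y) = \<Delta> b * (1 \<otimes>\<^sub>M y)"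
  shows "\<Delta> (y \<rhd> b) = (1 \<otimes>\<^sub>M y) * \<Delta> b"
proof (rule \<Delta>.determined)
  show "E * ((1 \<otimes>\<^sub>M y) * \<Delta> b) = (1 \<otimes>\<^sub>M y) * \<Delta> b"
    by (simp add: mult.assoc[symmetric] assms(1)) (simp add: mult.assoc E_\<Delta>)
  show "\<Delta> a * \<Delta> (y \<rhd> b) = \<Delta> a * ((1 \<otimes>\<^sub>M y) * \<Delta> b)" for a
    by (simp flip: \<Delta>_mult mult_balanced mult.assoc assms(2))
qed (rule E_\<Delta>)

lemma \<Delta>_eps_s_left: "\<Delta> (eps_s c \<rhd> b) = (1 \<otimes>\<^sub>M eps_s c) * \<Delta> b"
  by (rule \<Delta>_source_left[OF E_eps_s_commute \<Delta>_eps_s])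

text \<open>Both sides are \<Sum> a1 \<otimes> (1 \<otimes> \<open>eps_s\<close>(a2)) \<Delta>(b)(1
  \<otimes> c): a value of \<open>eps_s\<close> passes through \<open>\<Delta>\<close> to its second
  leg.\<close>

lemma G_t1_leg13: "leg13 G (leg23 t1 x) = leg23 t1 (leg12 G x)"
proof (rule tensor_eqI3[where t = x], rule_tac [3] cancel_left_leg(1)[OF nd])
  fix a b c :: 'a and e
  let ?M = "\<lambda>w :: ('a, 'a) tensor. tensor_map (\<lambda>x. x) (\<lambda>y. (1 \<otimes>\<^sub>M eps_s y) \<rhd> w) (t2 (e \<otimes> a))"
  have lin1: "clinear (\<lambda>y. (1 \<otimes>\<^sub>M eps_s y) \<rhd> w)" for w :: "('a, 'a) tensor"
    by (rule clinearI) (simp_all add: clinear_add[OF clinear_eps_s]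
        clinear_scaleC[OF clinear_eps_s] tensor_multiplier_linear multiplier_simps)
  have 1: "leg23 t1 (insert3 c (tensor_map (\<lambda>x. x) (\<lambda>q. eps_s q \<rhd> b) v))
      = tensor_map (\<lambda>x. x) (\<lambda>y. (1 \<otimes>\<^sub>M eps_s y) \<rhd> t1 (b \<otimes> c)) v" for v :: "('a, 'a) tensor"
  proof (rule tensor_eqI[where t = v])
    have "t1 ((eps_s y \<rhd> b) \<otimes> c) = (1 \<otimes>\<^sub>M eps_s y) \<rhd> t1 (b \<otimes> c)" for y
      by (rule embed_eqI) (simp add: embed_multiplier[symmetric] embed_t1 \<Delta>_eps_s_left mult.assoc)
    then show "leg23 t1 (insert3 c (tensor_map (\<lambda>x. x) (\<lambda>q. eps_s q \<rhd> b) (x \<otimes> y)))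
        = tensor_map (\<lambda>x. x) (\<lambda>y. (1 \<otimes>\<^sub>M eps_s y) \<rhd> t1 (b \<otimes> c)) (x \<otimes> y)" for x y :: 'a
      by (simp add: tensor_rules lin1)
  qed (simp_all add: clinear_rules lin1)
  have 2: "insert2 f (tensor_map (\<lambda>x. x) (\<lambda>y. eps_s y \<rhd> g) v)
      = tensor_map (\<lambda>x. x) (\<lambda>y. (1 \<otimes>\<^sub>M eps_s y) \<rhd> (f \<otimes> g)) v" for f g :: 'a
      and v :: "('a, 'a) tensor"
    by (rule tensor_eqI[where t = v])
      (simp_all add: tensor_rules lin1 leg_mult_simps)
  have 3: "in_fst e \<rhd> leg13 G (a \<otimes> w) = ?M w" for w :: "('a, 'a) tensor"
  proof (rule tensor_eqI[where t = w])
    show "in_fst e \<rhd> leg13 G (a \<otimes> f \<otimes> g) = ?M (f \<otimes> g)" for f g :: 'a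
      by (simp add: leg13_prod clinear_rules clinear_G left_insert2 G_left 2)
    have "clinear (\<lambda>w :: ('a, 'a) tensor. tensor_map (\<lambda>x. x) (\<lambda>y. (1 \<otimes>\<^sub>M eps_s y) \<rhd> w) v)"
        for v :: "('a, 'a) tensor"
      by (rule clinearI; induction v rule: tensor_induct)
        (simp_all add: tensor_rules lin1 clinear_scale_compose tensor_map_add multiplier_simps
            tensor_prod_add_right tensor_prod_scale_right scaleC_add_right)
    then show "clinear ?M" .
  qed (simp_all add: clinear_rules clinear_G)
  show "in_fst e \<rhd> leg13 G (leg23 t1 (a \<otimes> b \<otimes> c)) = in_fst e \<rhd> leg23 t1 (leg12 G (a \<otimes> b \<otimes> c))"
    by (simp add: leg12_prod clinear_G tensor_rules left_leg23 left_insert3 G_left 1 3)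
qed (simp_all add: clinear_rules clinear_G)

text \<open>Applying \<open>\<Delta>\<close> to the second leg of \<open>R1 (a \<otimes> b) = \<Sum> a\<^sub>1 \<otimes> S(a\<^sub>2) b\<close>: this is
  \<open>\<Delta> \<circ> S = (S \<otimes> S) \<circ> \<Delta>\<^sup>c\<^sup>o\<^sup>p\<close> on the range of \<open>E\<close>, obtained as a generalised inverse of the pentagon equation.\<close>

lemma pentagon_R1: "leg23 t1 (leg12 R1 x) = leg13 R1 (leg12 R1 (leg23 t1 x))"
proof -
  have R1_G: "R1 (t1 (R1 x)) = R1 x" for x by (simp add: R1_E flip: T1_R1)
  have "leg12 t1 (leg13 t1 (leg23 t1 (leg12 R1 x))) = leg23 t1 (leg12 t1 (leg12 R1 x))"
    by (rule pentagon1[symmetric])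
  also have "\<dots> = leg12 ((\<rhd>) E) (leg23 t1 x)"
    unfolding E_t1_leg by (simp add: leg12_leg12 clinear_rules E_eta)
  \<comment> \<open>Applying R1 to legs 1, 2 and then to legs 1, 3 undoes the outer T1. On the right
    R1 E = R1. On the left a \<open>G\<close> on legs 1 and 3 remains, slides to legs 1 and 2, and
    vanishes in R1 T1 R1 = R1.\<close>
  finally have "leg13 R1 (leg12 R1 (leg12 t1 (leg13 t1 (leg23 t1 (leg12 R1 x)))))
      = leg13 R1 (leg12 R1 (leg12 ((\<rhd>) E) (leg23 t1 x)))"
    by (rule arg_cong)
  also have "\<dots> = leg13 R1 (leg12 R1 (leg23 t1 x))"
    by (simp add: leg12_leg12 clinear_rules R1_E)
  also have "leg13 R1 (leg12 R1 (leg12 t1 (leg13 t1 (leg23 t1 (leg12 R1 x)))))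
      = leg13 R1 (leg12 G (leg13 t1 (leg23 t1 (leg12 R1 x))))"
    by (simp add: leg12_leg12 clinear_rules)
  also have "\<dots> = leg13 G (leg23 t1 (leg12 R1 x))"
    unfolding G_t1_leg by (simp add: leg23_leg23 leg13_leg13 clinear_rules E_t1)
  also have "\<dots> = leg23 t1 (leg12 R1 x)"
    unfolding G_t1_leg13 by (simp add: leg12_leg12 clinear_rules clinear_G R1_G)
  finally show ?thesis .
qed


subsection \<open>The antipode and the coproduct\<close>

abbreviation "Sx \<equiv> antihom_extension S"

lemmas s_properties = nd S_eq clinear_s bij_s s_mult
lemmas Sx_left = antihom_extension_left[OF s_properties]
  and Sx_right = antihom_extension_right[OF s_properties]
  and clinear_Sx = clinear_antihom_extension[OF s_properties]
  and Sx_mult = antihom_extension_mult[OF s_properties]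
  and Sx_one = antihom_extension_one[OF s_properties]

lemma slice_t4: "slice_left \<epsilon> (t4 (a \<otimes> b)) = b * a"
proof (rule nondegenerate_eqI(1)[OF nd])
  fix d
  have "slice_left \<epsilon> (t4 (a \<otimes> b)) * d = slice_left \<epsilon> (t4 (a \<otimes> b) \<lhd> in_snd d)"
    by (simp add: slice_left_mult clinear_\<epsilon> embed_multR)
  also have "\<dots> = b * a * d"
    by (simp add: t4_right slice_left_mult clinear_\<epsilon> slice_t1 tensor_product_prod embed_multL
        mult.assoc)
  finally show "slice_left \<epsilon> (t4 (a \<otimes> b)) * d = b * a * d" .
qed

lemma slice_R1: "slice_left \<epsilon> (R1 (a \<otimes> b)) = s a * b"
proof -
  have "slice_left \<epsilon> (tensor_map (\<lambda>x. x) s u) = s (slice_left \<epsilon> u)" for u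
    by (rule slice_left_leg23[OF clinear_\<epsilon> clinear_s])
  then show ?thesis by (simp add: R1_t4 slice_t4 s_mult)
qed

text \<open>\<open>twist a (w \<otimes> v)\<close> is \<open>\<Sum> S(a\<^sub>2) w \<otimes> S(a\<^sub>1) v\<close>.\<close>

definition "twist a \<xi> = slice_left \<epsilon> (leg13 R1 (leg12 R1 (a \<otimes> \<xi>)))"

lemma clinear_twist: "clinear h \<Longrightarrow> clinear (\<lambda>x. twist a (h x))"
  unfolding twist_def by (intro clinear_rules)

lemma twist_prod: "twist a (w \<otimes> v) = tensor_lift (\<lambda>x y. y \<otimes> (s x * v)) (R1 (a \<otimes> w))" (is ?t)
  and twist_bilinear: "cbilinear (\<lambda>x y. y \<otimes> (s x * v))"
proof -
  show bil: "cbilinear (\<lambda>x y. y \<otimes> (s x * v))" unfolding cbilinear_def by (simp add: clinear_rules)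
  have 1: "slice_left \<epsilon> (insert2 c u) = c \<otimes> slice_left \<epsilon> u" for c and u :: "('a, 'a) tensor"
    by (rule tensor_eqI[where t = u]) (simp_all add: tensor_rules slice_left_prod
        tensor_prod_scale_right)
  have "slice_left \<epsilon> (leg13 R1 (insert3 v u)) = tensor_lift (\<lambda>x y. y \<otimes> (s x * v)) u"
      for u :: "('a, 'a) tensor"
    by (rule tensor_eqI[where t = u])
      (simp_all add: tensor_rules leg13_prod 1 slice_R1 tensor_lift[OF bil])
  then show ?t by (simp add: twist_def leg12_prod clinear_rules)
qed

text \<open>Slicing the first leg of \<open>pentagon_R1\<close> by the counit leaves T1(S(a) b
  \<otimes> c) on one side and the twist of T1(b \<otimes> c) on the other. Arbitrary arguments
  reach the range of T1 through \<open>E\<close>.\<close>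

lemma \<Delta>_s: "\<Delta> (s a) \<rhd> \<xi> = twist a (E \<rhd> \<xi>)"
proof -
  have 1: "slice_left \<epsilon> (leg23 t1 (insert3 c u)) = t1 (slice_left \<epsilon> u \<otimes> c)" for c u
    by (rule tensor_eqI[where t = u])
      (simp_all add: tensor_rules slice_left_prod tensor_prod_scale_left
          clinear_scaleC[OF clinear_t1])
  have "\<Delta> (s a) \<rhd> t1 y = twist a (t1 y)" for y
  proof (rule tensor_eqI[where t = y])
    fix b c
    have "twist a (t1 (b \<otimes> c)) = slice_left \<epsilon> (leg23 t1 (leg12 R1 (a \<otimes> b \<otimes> c)))"
      by (simp add: twist_def pentagon_R1 tensor_rules)
    also have "\<dots> = \<Delta> (s a) \<rhd> t1 (b \<otimes> c)"
      by (simp add: leg12_prod clinear_rules 1 slice_R1 t1_mult_left)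
    finally show "\<Delta> (s a) \<rhd> t1 (b \<otimes> c) = twist a (t1 (b \<otimes> c))" by simp
  qed (simp_all add: clinear_rules clinear_twist)
  from this[of "R1 \<xi>"] show ?thesis by (simp flip: T1_R1 add: \<Delta>_EL)
qed

text \<open>S(c) S(a2) = S(a2 c), so a left factor S(c) covers the second leg of \<Delta>(a) in
  place of the first.\<close>

lemma R1_lmult: "in_snd (s c) \<rhd> R1 (a \<otimes> w) = tensor_map (\<lambda>x. x) (\<lambda>q. s q * w) (t1 (a \<otimes> c))"
proof (rule cancel_left_leg(1)[OF nd])
  fix e
  have 1: "tensor_map (\<lambda>x. x) (\<lambda>q. s q * w) (v \<lhd> in_snd c)
      = in_snd (s c) \<rhd> tensor_map (\<lambda>x. x) (\<lambda>q. s q * w) v" for v :: "('a, 'a) tensor"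
    by (rule tensor_eqI[where t = v])
      (simp_all add: tensor_rules leg_mult_simps embed_multL embed_multR s_mult mult.assoc)
  have "in_fst e \<rhd> in_snd (s c) \<rhd> R1 (a \<otimes> w) = in_snd (s c) \<rhd> in_fst e \<rhd> R1 (a \<otimes> w)"
    by (simp flip: times_multL add: tensor_multiplier_mult)
  also have "\<dots> = in_fst e \<rhd> tensor_map (\<lambda>x. x) (\<lambda>q. s q * w) (t1 (a \<otimes> c))"
    unfolding R1_left left_leg23[OF clinear_compose[OF clinear_mult_right clinear_s]] t1_t2 1 ..
  finally show "in_fst e \<rhd> in_snd (s c) \<rhd> R1 (a \<otimes> w)
      = in_fst e \<rhd> tensor_map (\<lambda>x. x) (\<lambda>q. s q * w) (t1 (a \<otimes> c))" .
qed

text \<open>From \<Delta>(S(a)) = (\<Sum> S(a2) \<otimes> S(a1)) E, contraction by u S(v) gives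
  \<Sum> S(a2) S(S(a1)) = S(\<Sum> S(a1) a2); \<open>antipode_cancel'\<close> removes the factor
  \<open>E\<close>.\<close>

lemma eps_t_s: "\<epsilon>\<^sub>t (s a) = Sx (eps_s a)"
proof (rule multiplier_eqI(2)[OF nd])
  fix x
  obtain c where x: "x = s c" using bij_s by (metis bij_pointE)
  have *: "(s c \<lhd> \<epsilon>\<^sub>t (s a)) * s (s b) = (s c \<lhd> Sx (eps_s a)) * s (s b)" for b
  proof -
    have bil1: "cbilinear (\<lambda>p q. s q \<otimes> (s b * s p))" unfolding cbilinear_def
        by (simp add: clinear_rules)
    \<comment> \<open>\<open>\<Psi>\<close> is \<Sum> S(a2 c) \<otimes> S(b) S(a1): the left factor
      S(c) \<otimes> S(b) makes the twist an element of A \<otimes> A.\<close>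
    define \<Psi> where "\<Psi> = tensor_lift (\<lambda>p q. s q \<otimes> (s b * s p)) (t1 (a \<otimes> c))"
    have "(s c \<otimes> s b) * twist a \<zeta> = \<Psi> * \<zeta>" for \<zeta>
    proof (rule tensor_eqI[where t = \<zeta>])
      fix w v
      have bil2: "cbilinear (\<lambda>x y. y \<otimes> (s b * (s x * v)))" unfolding cbilinear_def
          by (simp add: clinear_rules)
      have 1: "(s c \<otimes> s b) * tensor_lift (\<lambda>x y. y \<otimes> (s x * v)) u
          = tensor_lift (\<lambda>x y. y \<otimes> (s b * (s x * v))) (in_snd (s c) \<rhd> u)" for u
        by (rule tensor_eqI[where t = u])
          (simp_all add: clinear_rules tensor_lift[OF twist_bilinear] tensor_lift[OF bil2]
              clinear_compose[OF tensor_lift(1)[OF twist_bilinear]]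
              clinear_compose[OF tensor_lift(1)[OF bil2]] leg_mult_simps embed_multL
              tensor_times_prod s_mult mult.assoc)
      have 2: "tensor_lift (\<lambda>x y. y \<otimes> (s b * (s x * v))) (tensor_map (\<lambda>x. x) (\<lambda>q. s q * w) r)
          = tensor_lift (\<lambda>p q. s q \<otimes> (s b * s p)) r * (w \<otimes> v)" for r
        by (rule tensor_eqI[where t = r])
          (simp_all add: tensor_rules tensor_lift[OF bil2] tensor_lift[OF bil1]
              clinear_compose[OF tensor_lift(1)[OF bil2]]
              clinear_compose[OF tensor_lift(1)[OF bil1]] tensor_times_prod mult.assoc)
      show "(s c \<otimes> s b) * twist a (w \<otimes> v) = \<Psi> * (w \<otimes> v)"
        by (simp add: twist_prod 1 R1_lmult 2 \<Psi>_def)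
    qed (simp_all add: clinear_rules clinear_twist)
    then have "((s c \<otimes> s b) \<lhd> \<Delta> (s a)) * \<xi> = (\<Psi> \<lhd> E) * \<xi>" for \<xi>
      by (simp add: mult_balanced \<Delta>_s)
    then have eq: "(s c \<otimes> s b) \<lhd> \<Delta> (s a) = \<Psi> \<lhd> E"
      by (rule nondegenerate_eqI(1)[OF nd2])
    have 3: "tensor_product (tensor_map (\<lambda>x. x) s (in_snd y \<rhd> r))
        = tensor_product (tensor_map (\<lambda>x. x) s r) * s y" for y r
      by (rule tensor_eqI[where t = r])
        (simp_all add: tensor_rules tensor_product_prod leg_mult_simps embed_multL s_mult
            mult.assoc)
    have 4: "tensor_product (tensor_map (\<lambda>x. x) s (u \<lhd> E))
        = tensor_product (tensor_map (\<lambda>x. x) s u)" for u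
      by (rule tensor_eqI[where t = u]) (simp_all add: tensor_rules antipode_cancel'
          tensor_product_prod)
    have 5: "tensor_product (tensor_map (\<lambda>x. x) s (tensor_lift (\<lambda>p q. s q \<otimes> (s b * s p)) r))
        = s (tensor_product (tensor_map s (\<lambda>x. x) r)) * s (s b)" for r
      by (rule tensor_eqI[where t = r])
        (simp_all add: tensor_rules tensor_product_prod tensor_lift[OF bil1] s_mult mult.assoc)
    have "(s c \<lhd> \<epsilon>\<^sub>t (s a)) * s (s b)
        = tensor_product (tensor_map (\<lambda>x. x) s ((s c \<otimes> s b) \<lhd> \<Delta> (s a)))"
      by (simp add: \<Delta>_multR 3 \<epsilon>\<^sub>t_right)
    also have "\<dots> = s (eps_s a \<rhd> c) * s (s b)"
      by (simp add: eq 4 \<Psi>_def 5 eps_s_left)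
    finally show ?thesis by (simp add: Sx_right)
  qed
  show "x \<lhd> \<epsilon>\<^sub>t (s a) = x \<lhd> Sx (eps_s a)"
    unfolding x
  proof (rule nondegenerate_eqI(1)[OF nd])
    show "(s c \<lhd> \<epsilon>\<^sub>t (s a)) * z = (s c \<lhd> Sx (eps_s a)) * z" for z using *[of "s' (s' z)"] by simp
  qed
qed

text \<open>Contracting the twist by S(u) v gives the contraction of (1 \<otimes> y) E, while
  \<open>antipode_cancel\<close> needs \<open>E\<close> outermost. So \<open>y\<close> is first
  moved past \<open>E\<close>, by \<open>E_eps_t\<close> and the fact that \<open>y\<close> commutes
  with every \<open>\<epsilon>\<^sub>t q\<close>.\<close>

lemma eps_s_s: "eps_s (s a) = Sx (\<epsilon>\<^sub>t a)"
proof -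
  define y where "y = Sx (\<epsilon>\<^sub>t a)"
  have comm: "\<epsilon>\<^sub>t q * y = y * \<epsilon>\<^sub>t q" for q
  proof -
    have q: "\<epsilon>\<^sub>t q = Sx (eps_s (s' q))" using eps_t_s[of "s' q"] by simp
    show ?thesis unfolding q y_def by (simp flip: Sx_mult add: eps_commute)
  qed
  have E_y: "E \<rhd> (c \<otimes> (y \<rhd> d)) = (1 \<otimes>\<^sub>M y) \<rhd> E \<rhd> (c \<otimes> d)" for c d
  proof (rule cancel_left_leg(1)[OF nd])
    fix e
    have "\<epsilon>\<^sub>t q \<rhd> y \<rhd> d = y \<rhd> \<epsilon>\<^sub>t q \<rhd> d" for q using comm[of q] by (metis times_multL)
    then have "tensor_map (\<lambda>x. x) (\<lambda>q. \<epsilon>\<^sub>t q \<rhd> y \<rhd> d) v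
        = (1 \<otimes>\<^sub>M y) \<rhd> tensor_map (\<lambda>x. x) (\<lambda>q. \<epsilon>\<^sub>t q \<rhd> d) v" for v :: "('a, 'a) tensor"
      by (intro tensor_eqI[where t = v, of "\<lambda>v. tensor_map (\<lambda>x. x) (\<lambda>q. \<epsilon>\<^sub>t q \<rhd> y \<rhd> d) v"])
        (simp_all add: tensor_rules leg_mult_simps)
    moreover have "in_fst e \<rhd> (1 \<otimes>\<^sub>M y) \<rhd> E \<rhd> (c \<otimes> d) = (1 \<otimes>\<^sub>M y) \<rhd> in_fst e \<rhd> E \<rhd> (c \<otimes> d)"
      by (simp flip: times_multL mult.assoc add: tensor_multiplier_mult)
    ultimately show "in_fst e \<rhd> E \<rhd> (c \<otimes> (y \<rhd> d)) = in_fst e \<rhd> (1 \<otimes>\<^sub>M y) \<rhd> E \<rhd> (c \<otimes> d)"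
      by (simp add: E_eps_t)
  qed
  let ?m = "\<lambda>x. tensor_product (tensor_map s (\<lambda>x. x) x)"
  have 1: "?m (r \<lhd> in_fst c) = s c * ?m r" for c r
    by (rule tensor_eqI[where t = r])
      (simp_all add: tensor_rules tensor_product_prod leg_mult_simps embed_multR s_mult mult.assoc)
  have 2: "?m (tensor_lift (\<lambda>x y. y \<otimes> (s x * v)) u) = s (tensor_product u) * v" for u v
    by (rule tensor_eqI[where t = u])
      (simp_all add: tensor_rules tensor_product_prod tensor_lift[OF twist_bilinear] s_mult
          mult.assoc)
  have 3: "?m (twist a \<zeta>) = ?m ((1 \<otimes>\<^sub>M y) \<rhd> \<zeta>)" for \<zeta>
    by (rule tensor_eqI[where t = \<zeta>])
      (simp_all add: clinear_rules clinear_twist twist_prod 2 tensor_map_prod tensor_product_prod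
          leg_mult_simps mult_balanced y_def flip: \<epsilon>\<^sub>t_left Sx_right)
  have *: "s c * (eps_s (s a) \<rhd> d) = s c * (y \<rhd> d)" for c d
  proof -
    have "s c * (eps_s (s a) \<rhd> d) = ?m (\<Delta> (s a) \<rhd> (c \<otimes> d))"
      by (simp add: \<Delta>_multL 1 eps_s_left)
    also have "\<dots> = s c * (y \<rhd> d)"
      by (simp add: \<Delta>_s 3 antipode_cancel flip: E_y)
    finally show ?thesis .
  qed
  have "eps_s (s a) \<rhd> d = y \<rhd> d" for d
  proof (rule nondegenerate_eqI(2)[OF nd])
    show "z * (eps_s (s a) \<rhd> d) = z * (y \<rhd> d)" for z using *[of "s' z"] by simp
  qed
  then show ?thesis unfolding y_def[symmetric] by (rule multiplier_eqI(1)[OF nd])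
qed


subsection \<open>The source algebra\<close>

lemma source_algebra_iff: "y \<in> source_algebra \<Delta> E \<longleftrightarrow> (\<forall>b. \<Delta> (b \<lhd> y) = \<Delta> b * (1 \<otimes>\<^sub>M y))"
proof
  assume "y \<in> source_algebra \<Delta> E"
  then have y: "hom_extension \<Delta> E y = E * (1 \<otimes>\<^sub>M y)" by (simp add: source_algebra_def)
  show "\<forall>b. \<Delta> (b \<lhd> y) = \<Delta> b * (1 \<otimes>\<^sub>M y)"
    by (simp flip: \<Delta>.hom_extension_times(2) mult.assoc add: y \<Delta>_E)
next
  assume y: "\<forall>b. \<Delta> (b \<lhd> y) = \<Delta> b * (1 \<otimes>\<^sub>M y)"
  have "hom_extension \<Delta> E y = E * (1 \<otimes>\<^sub>M y)"
    by (rule \<Delta>.hom_extension_eqI) (simp_all flip: mult.assoc add: E_idem \<Delta>_E y)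
  then show "y \<in> source_algebra \<Delta> E" by (simp add: source_algebra_def)
qed

lemma eps_s_source: "eps_s a \<in> source_algebra \<Delta> E"
  by (simp add: source_algebra_iff \<Delta>_eps_s)

lemma eps_s_source_mult:
  assumes "y \<in> source_algebra \<Delta> E"
  shows "eps_s a * y = eps_s (a \<lhd> y)"
proof (rule multiplier_eqI(1)[OF nd])
  fix b
  have "1 \<otimes>\<^sub>M embed (y \<rhd> b) = ((1 \<otimes>\<^sub>M y) * in_snd b :: ('a, 'a) tensor multiplier)"
    by (simp add: tensor_multiplier_mult embed_multiplier)
  then have "t1 (a \<otimes> (y \<rhd> b)) = t1 ((a \<lhd> y) \<otimes> b)"
    using assms by (intro embed_eqI) (simp add: embed_t1 source_algebra_iff mult.assoc)
  then show "(eps_s a * y) \<rhd> b = eps_s (a \<lhd> y) \<rhd> b"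
    by (simp add: times_multL eps_s_left)
qed

text \<open>\<open>eps_s\<close>(a) y = \<open>eps_s\<close>(a y), so the claim holds behind a left
  factor \<open>eps_s\<close>(a); the span of A \<open>eps_s\<close>(A) is A, which removes that
  factor.\<close>

lemma source_commute:
  assumes y: "y \<in> source_algebra \<Delta> E"
  shows "E * (1 \<otimes>\<^sub>M y) = (1 \<otimes>\<^sub>M y) * E"
proof (rule multiplier_eqI(2)[OF nd2])
  have *: "(1 \<otimes>\<^sub>M eps_s a) * (E * (1 \<otimes>\<^sub>M y)) = (1 \<otimes>\<^sub>M eps_s a) * ((1 \<otimes>\<^sub>M y) * E)" for a
  proof -
    have "(1 \<otimes>\<^sub>M eps_s a) * (E * (1 \<otimes>\<^sub>M y)) = E * (1 \<otimes>\<^sub>M (eps_s a * y))"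
      by (simp flip: mult.assoc E_eps_s_commute) (simp add: mult.assoc tensor_multiplier_mult)
    also have "\<dots> = (1 \<otimes>\<^sub>M (eps_s a * y)) * E"
      by (simp add: eps_s_source_mult y E_eps_s_commute)
    also have "\<dots> = (1 \<otimes>\<^sub>M eps_s a) * ((1 \<otimes>\<^sub>M y) * E)"
      by (simp add: tensor_multiplier_mult flip: mult.assoc)
    finally show ?thesis .
  qed
  show "t \<lhd> (E * (1 \<otimes>\<^sub>M y)) = t \<lhd> ((1 \<otimes>\<^sub>M y) * E)" for t
  proof (rule tensor_eqI[where t = t])
    fix x w
    show "(x \<otimes> w) \<lhd> (E * (1 \<otimes>\<^sub>M y)) = (x \<otimes> w) \<lhd> ((1 \<otimes>\<^sub>M y) * E)"
    proof (induction w rule: eps_s_induct)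
      case (eps b a)
      have "x \<otimes> (b \<lhd> eps_s a) = (x \<otimes> b) \<lhd> (1 \<otimes>\<^sub>M eps_s a)"
        by (simp add: leg_mult_simps)
      then show ?case by (simp only: times_multR[symmetric] *)
    qed (simp add: tensor_prod_add_right multiplier_simps)
  qed (simp_all add: clinear_rules)
qed

lemma \<Delta>_source:
  assumes "y \<in> source_algebra \<Delta> E"
  shows "\<Delta> (y \<rhd> b) = (1 \<otimes>\<^sub>M y) * \<Delta> b"
  using assms by (intro \<Delta>_source_left source_commute) (simp_all add: source_algebra_iff)

text \<open>The mirror argument: by \<open>eps_t_s\<close>, S(y)
  \<open>\<epsilon>\<^sub>t\<close>(a) is again a value of \<open>\<epsilon>\<^sub>t\<close>, and
  \<open>\<epsilon>\<^sub>t\<close>(A) A spans A.\<close>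

lemma Sx_source_commute:
  assumes y: "y \<in> source_algebra \<Delta> E"
  shows "E * (Sx y \<otimes>\<^sub>M 1) = (Sx y \<otimes>\<^sub>M 1) * E"
proof (rule multiplier_eqI(1)[OF nd2])
  have *: "E * (Sx y \<otimes>\<^sub>M 1) * (\<epsilon>\<^sub>t a \<otimes>\<^sub>M 1) = (Sx y \<otimes>\<^sub>M 1) * E * (\<epsilon>\<^sub>t a \<otimes>\<^sub>M 1)" for a
  proof -
    have a: "Sx y * \<epsilon>\<^sub>t a = \<epsilon>\<^sub>t (s (s' a \<lhd> y))"
      using eps_t_s[of "s' a"] by (simp add: eps_t_s eps_s_source_mult[OF y, symmetric] Sx_mult)
    have "E * (Sx y \<otimes>\<^sub>M 1) * (\<epsilon>\<^sub>t a \<otimes>\<^sub>M 1) = ((Sx y * \<epsilon>\<^sub>t a) \<otimes>\<^sub>M 1) * E"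
      unfolding mult.assoc tensor_multiplier_mult mult_1_left a by (rule E_eps_t_commute)
    also have "\<dots> = (Sx y \<otimes>\<^sub>M 1) * E * (\<epsilon>\<^sub>t a \<otimes>\<^sub>M 1)"
      unfolding mult.assoc E_eps_t_commute by (simp add: tensor_multiplier_mult flip: mult.assoc)
    finally show ?thesis .
  qed
  show "(E * (Sx y \<otimes>\<^sub>M 1)) \<rhd> t = ((Sx y \<otimes>\<^sub>M 1) * E) \<rhd> t" for t
  proof (rule tensor_eqI[where t = t])
    fix w x
    show "(E * (Sx y \<otimes>\<^sub>M 1)) \<rhd> (w \<otimes> x) = ((Sx y \<otimes>\<^sub>M 1) * E) \<rhd> (w \<otimes> x)"
    proof (induction w rule: eps_t_induct)
      case (eps b a)
      have "(\<epsilon>\<^sub>t a \<rhd> b) \<otimes> x = (\<epsilon>\<^sub>t a \<otimes>\<^sub>M 1) \<rhd> (b \<otimes> x)"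
        by (simp add: leg_mult_simps)
      then show ?case by (simp only: times_multL[symmetric] *)
    qed (simp add: tensor_prod_add_left multiplier_simps)
  qed (simp_all add: clinear_rules)
qed

text \<open>For a = S(b), the law \<Delta>(y b) = (1 \<otimes> y) \<Delta>(b) moves S(y) through
  \<open>R1\<close> and hence through the twist. This makes the slice map respect the balancing
  relations.\<close>

lemma \<Delta>_Sx_source:
  assumes y: "y \<in> source_algebra \<Delta> E"
  shows "\<Delta> (a \<lhd> Sx y) = \<Delta> a * (Sx y \<otimes>\<^sub>M 1)"
proof (rule multiplier_eqI(1)[OF nd2])
  fix \<xi>
  obtain b where a: "a = s b" using bij_s by (metis s_s')
  have R1: "R1 ((y \<rhd> b) \<otimes> w) = R1 (b \<otimes> (Sx y \<rhd> w))" for w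
  proof (rule cancel_left_leg(1)[OF nd])
    fix e
    have t2: "t2 (e \<otimes> (y \<rhd> b)) = (1 \<otimes>\<^sub>M y) \<rhd> t2 (e \<otimes> b)"
    proof (rule embed_eqI)
      have "in_fst e * (1 \<otimes>\<^sub>M y) = (1 \<otimes>\<^sub>M y) * (in_fst e :: ('a, 'a) tensor multiplier)"
        by (simp add: tensor_multiplier_mult)
      then show "embed (t2 (e \<otimes> (y \<rhd> b))) = embed ((1 \<otimes>\<^sub>M y) \<rhd> t2 (e \<otimes> b))"
        by (simp add: embed_multiplier[symmetric] embed_t2 \<Delta>_source[OF y] mult.assoc[symmetric])
    qed
    have *: "s (y \<rhd> q) * w = s q * (Sx y \<rhd> w)" for q by (simp add: mult_balanced flip: Sx_right)
    show "in_fst e \<rhd> R1 ((y \<rhd> b) \<otimes> w) = in_fst e \<rhd> R1 (b \<otimes> (Sx y \<rhd> w))"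
      unfolding R1_left t2 by (simp add: tensor_multiplier_eq mult_left_eta tensor_map_tensor_map
          clinear_rules *)
  qed
  have twist: "twist (y \<rhd> b) \<zeta> = twist b ((Sx y \<otimes>\<^sub>M 1) \<rhd> \<zeta>)" for \<zeta>
    by (rule tensor_eqI[where t = \<zeta>])
      (simp_all add: clinear_rules clinear_twist twist_prod leg_mult_simps R1)
  have "\<Delta> (a \<lhd> Sx y) \<rhd> \<xi> = twist b ((Sx y \<otimes>\<^sub>M 1) \<rhd> E \<rhd> \<xi>)"
    by (simp add: a Sx_right \<Delta>_s twist)
  also have "\<dots> = (\<Delta> a * (Sx y \<otimes>\<^sub>M 1)) \<rhd> \<xi>"
    by (simp add: a times_multL \<Delta>_s) (simp flip: times_multL add: Sx_source_commute[OF y])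
  finally show "\<Delta> (a \<lhd> Sx y) \<rhd> \<xi> = (\<Delta> a * (Sx y \<otimes>\<^sub>M 1)) \<rhd> \<xi>" .
qed

text \<open>Start from E(a \<otimes> h) = T1(a \<otimes> h) and apply T1 to legs 2 and 3.
  Contracting the first two legs by S(u) v gives S(a) h1 \<otimes> h2 on one side and \<Sum>
  \<open>eps_s\<close>(a1) h1 \<otimes> a2 h2 on the other, which is (1 \<otimes> a) E
  \<Delta>(h).\<close>

lemma cointegral_coproduct:
  assumes h: "\<And>a. a * h = \<epsilon>\<^sub>t a \<rhd> h"
  shows "in_snd a \<rhd> t1 (h \<otimes> c) = in_fst (s a) \<rhd> t1 (h \<otimes> c)"
proof -
  let ?m = "\<lambda>x. tensor_product (tensor_map s (\<lambda>x. x) x)"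
  have "E \<rhd> (a \<otimes> h) = t1 (a \<otimes> h)"
  proof (rule cancel_left_leg(1)[OF nd])
    fix e
    show "in_fst e \<rhd> E \<rhd> (a \<otimes> h) = in_fst e \<rhd> t1 (a \<otimes> h)"
      by (simp add: E_eps_t t1_t2 tensor_multiplier_eqR one_multR embed_multR h)
  qed
  then have "leg12 ((\<rhd>) E) (a \<otimes> h \<otimes> c) = leg12 t1 (a \<otimes> h \<otimes> c)"
    by (simp add: leg12_prod clinear_E clinear_rules)
  then have eq: "leg12 ((\<rhd>) E) (a \<otimes> t1 (h \<otimes> c)) = leg12 t1 (leg13 t1 (a \<otimes> t1 (h \<otimes> c)))"
    using E_t1_leg[of "a \<otimes> h \<otimes> c"] pentagon1[of "a \<otimes> h \<otimes> c"] by (simp add: tensor_rules)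
  have lhs: "contract12 ?m (leg12 ((\<rhd>) E) (a \<otimes> w)) = in_fst (s a) \<rhd> w" for w :: "('a, 'a) tensor"
    by (rule tensor_eqI[where t = w])
      (simp_all add: clinear_rules leg12_prod contract12_insert3 antipode_cancel leg_mult_simps
          embed_multL)
  have rhs: "contract12 ?m (leg12 t1 (leg13 t1 (a \<otimes> w))) = in_snd a \<rhd> E \<rhd> w" for w
  proof (rule tensor_eqI[where t = w])
    fix f g
    have "contract12 (\<lambda>x. ?m (t1 x)) (insert2 f r) = tensor_map (\<lambda>p. eps_s p \<rhd> f) (\<lambda>x. x) r"
        for r :: "('a, 'a) tensor"
      by (rule tensor_eqI[where t = r])
        (simp_all add: tensor_rules contract12_prod eps_s_left)
    then show "contract12 ?m (leg12 t1 (leg13 t1 (a \<otimes> f \<otimes> g))) = in_snd a \<rhd> E \<rhd> (f \<otimes> g)"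
      by (simp add: contract12_leg12 clinear_rules leg13_prod E_eps_s)
  qed (simp_all add: clinear_rules)
  show ?thesis using lhs[of "t1 (h \<otimes> c)"] rhs[of "t1 (h \<otimes> c)"] by (simp add: eq E_t1)
qed

end

lemma scaleC_fun_apply: "(c *\<^sub>C f) x = c *\<^sub>C f x"
  by (simp add: scaleC_fun_def)

lemma clinear_functional_add: "clinear (\<omega> + \<omega>')" if "clinear \<omega>" "clinear \<omega>'"
    for \<omega> \<omega>' :: "'a::complex_vector \<Rightarrow> complex"
  unfolding plus_fun_def by (rule clinear_plus[OF that])

lemma clinear_functional_scale: "clinear (k *\<^sub>C \<omega>)" if "clinear \<omega>"
    for \<omega> :: "'a::complex_vector \<Rightarrow> complex"
  unfolding scaleC_fun_def by (rule clinear_scale_compose[OF that])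

lemma subspace_dual: "cvec.subspace (dual_space :: ('a::complex_vector \<Rightarrow> complex) set)"
proof -
  have "clinear (0 :: 'a \<Rightarrow> complex)" unfolding zero_fun_def by (rule clinear_const_zero)
  then show ?thesis
    unfolding cvec.subspace_def dual_space_def
    by (simp add: clinear_functional_add clinear_functional_scale)
qed

lemma slice_left_functional_add:
  assumes "clinear \<omega>" "clinear \<omega>'"
  shows "slice_left (\<omega> + \<omega>') t = slice_left \<omega> t + slice_left \<omega>' t"
  by (rule tensor_eqI[where t = t])
    (simp_all add: clinear_tensor_rules clinear_slice_left assms clinear_functional_add
        slice_left_prod scaleC_add_left)

lemma slice_left_functional_scale:
  assumes "clinear \<omega>"
  shows "slice_left (k *\<^sub>C \<omega>) t = k *\<^sub>C slice_left \<omega> t"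
  by (rule tensor_eqI[where t = t])
    (simp_all add: clinear_scale_compose clinear_slice_left assms clinear_functional_scale
        slice_left_prod,
      simp add: scaleC_fun_apply scaleC_scaleC scaleC_complex_def)

context antipode_data
begin

subsection \<open>Cointegrals\<close>

lemma cointegral_space_iff: "h \<in> cointegral_space \<Delta> S \<longleftrightarrow> (\<forall>a. a * h = \<epsilon>\<^sub>t a \<rhd> h)"
proof -
  have 1: "embed a * embed h = eps_t \<Delta> S a * embed h \<longleftrightarrow> a * h = \<epsilon>\<^sub>t a \<rhd> h" for a
    by (simp add: eps_t_eq embed_multiplier(1) embed_multL embed_inject[OF nd])
  have 2: "embed h = 0 \<longleftrightarrow> h = 0"
    using embed_inject[OF nd, of h 0] by (simp add: clinear_zero[OF clinear_embed])
  show ?thesis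
    by (cases "h = 0")
      (simp_all add: cointegral_space_def left_cointegral_def 1 2 clinear_zero[OF clinear_multL])
qed

text \<open>Slicing the second leg by f turns the vanishing tensors into a linear relation with
  coefficients f(q_z d) among the independent multipliers z.\<close>

lemma multiplier_independent:
  fixes I :: "'a multiplier set" and q :: "'a multiplier \<Rightarrow> 'a"
  assumes I: "finite I" "\<not> cvec.dependent I"
    and eq: "\<And>b d. (\<Sum>z\<in>I. (z \<rhd> b) \<otimes> (q z * d)) = 0" and z: "z \<in> I"
  shows "q z = 0"
proof (rule nondegenerate_eqI(1)[OF nd])
  fix d
  have "q z * d = 0"
  proof (rule functional_separates)
    fix f :: "'a \<Rightarrow> complex" assume f: "clinear f"
    have "(\<Sum>z\<in>I. f (q z * d) *\<^sub>C z) = 0"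
    proof (rule multiplier_eqI(1)[OF nd])
      fix b
      have lin: "clinear (\<lambda>m :: 'a multiplier. m \<rhd> b)"
          by (rule clinearI) (simp_all add: multiplier_simps)
      have "(\<Sum>z\<in>I. f (q z * d) *\<^sub>C z) \<rhd> b = slice_right f (\<Sum>z\<in>I. (z \<rhd> b) \<otimes> (q z * d))"
        by (simp add: clinear_sum[OF lin] clinear_sum[OF clinear_slice_right[OF f]]
            slice_right_prod f scaleC_multL)
      then show "(\<Sum>z\<in>I. f (q z * d) *\<^sub>C z) \<rhd> b = 0 \<rhd> b"
        by (simp add: eq clinear_zero[OF clinear_slice_right[OF f]] zero_multL)
    qed
    from cvec.independentD[OF I(2,1) order_refl this z] show "f (q z * d) = 0" .
  qed
  then show "q z * d = 0 * d" by simp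
qed

text \<open>For h = x y the expansion is the image of t4(y \<otimes> x) = \<Sum> y1 \<otimes> x y2
  under \<open>eps_s\<close> on the first leg; regularity makes it finite. Independence of the first
  legs is arranged so that coefficients can be compared later.\<close>

lemma E_expansion:
  obtains I p where "finite I" "I \<subseteq> range eps_s" "\<not> cvec.dependent I"
    "\<And>b d. in_snd h \<rhd> E \<rhd> (b \<otimes> d) = (\<Sum>z\<in>I. (z \<rhd> b) \<otimes> (p z * d))"
proof -
  \<comment> \<open>\<open>ex b d\<close> lets an element of M(A) \<otimes> A act on b \<otimes> d.
    The expansion lives in this tensor product of vector spaces rather than in a multiplier
    algebra.\<close>
  define ex where "ex b d = tensor_lift (\<lambda>z p. (z \<rhd> b) \<otimes> (p * d))" for b d :: 'a
  have ex: "clinear (ex b d)" "ex b d (z \<otimes> p) = (z \<rhd> b) \<otimes> (p * d)" for b d z p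
  proof -
    have "cbilinear (\<lambda>z p. (z \<rhd> b) \<otimes> (p * d))"
      by (rule cbilinearI) (simp_all add: multiplier_simps tensor_prod_add_left
          tensor_prod_add_right tensor_prod_scale_left tensor_prod_scale_right distrib_right
          mult_scaleC_left)
    then show "clinear (ex b d)" "ex b d (z \<otimes> p) = (z \<rhd> b) \<otimes> (p * d)"
      unfolding ex_def by (rule tensor_lift)+
  qed
  have "\<exists>\<beta>. \<beta> \<in> tensor_sub (range eps_s) UNIV \<and> (\<forall>b d. in_snd h \<rhd> E \<rhd> (b \<otimes> d) = ex b d \<beta>)"
  proof (induction h rule: square_induct)
    case (mult x y)
    let ?\<beta> = "tensor_map eps_s (\<lambda>x. x) (t4 (y \<otimes> x))"
    have "tensor_map eps_s (\<lambda>x. x) r \<in> tensor_sub (range eps_s) UNIV" for r :: "('a, 'a) tensor"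
      unfolding tensor_sub_def
      by (induction r rule: tensor_induct)
        (auto simp: tensor_map_prod clinear_eps_s clinear_ident tensor_map_add intro:
            cvec.span_base cvec.span_add)
    moreover have "in_snd (x * y) \<rhd> E \<rhd> (b \<otimes> d) = ex b d ?\<beta>" for b d
    proof -
      have 1: "ex b d (tensor_map eps_s (\<lambda>x. x) r)
          = tensor_map (\<lambda>p. eps_s p \<rhd> b) (\<lambda>x. x) (r \<lhd> in_snd d)" for r
        by (rule tensor_eqI[where t = r])
          (simp_all add: tensor_rules clinear_eps_s clinear_compose[OF ex(1)] ex leg_mult_simps
              embed_multR)
      have 2: "tensor_map (\<lambda>p. eps_s p \<rhd> b) (\<lambda>x. x) (in_snd x \<rhd> r)
          = in_snd x \<rhd> tensor_map (\<lambda>p. eps_s p \<rhd> b) (\<lambda>x. x) r" for r :: "('a, 'a) tensor"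
        by (rule tensor_eqI[where t = r]) (simp_all add: tensor_rules leg_mult_simps)
      have "in_snd (x * y) = in_snd x * (1 \<otimes>\<^sub>M embed y :: ('a, 'a) tensor multiplier)"
        by (simp add: tensor_multiplier_mult embed_mult)
      then show ?thesis by (simp add: 1 t4_right 2 E_eps_s times_multL)
    qed
    ultimately show ?case by blast
  next
    case (add x y)
    then obtain \<beta> \<gamma> where "\<beta> \<in> tensor_sub (range eps_s) UNIV" "\<forall>b d. in_snd x \<rhd> E \<rhd> (b \<otimes> d)
        = ex b d \<beta>"
      "\<gamma> \<in> tensor_sub (range eps_s) UNIV" "\<forall>b d. in_snd y \<rhd> E \<rhd> (b \<otimes> d) = ex b d \<gamma>" by blast
    then show ?case
      by (intro exI[of _ "\<beta> + \<gamma>"])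
        (simp add: tensor_sub_def cvec.span_add clinear_add[OF clinear_embed]
            tensor_multiplier_linear plus_multL clinear_add[OF ex(1)])
  qed
  then obtain \<beta> where \<beta>: "\<beta> \<in> tensor_sub (range eps_s) UNIV"
    and h: "\<And>b d. in_snd h \<rhd> E \<rhd> (b \<otimes> d) = ex b d \<beta>" by blast
  obtain I p where "finite I" "I \<subseteq> range eps_s" "\<not> cvec.dependent I" and "\<beta> = (\<Sum>z\<in>I. z \<otimes> p z)"
    using tensor_sub_independent_sum[OF subspace_range[OF clinear_eps_s] \<beta>] by blast
  then show ?thesis using that[of I p] by (simp add: h clinear_sum[OF ex(1)] ex(2))
qed

text \<open>The finite sum \<open>\<Sum> w\<^sub>z \<otimes> p\<^sub>z\<close> is \<open>\<Sum> S\<^sup>-\<^sup>2(E\<^sub>1) \<otimes> h E\<^sub>2\<close>. The element \<open>S\<^sup>-\<^sup>2(E\<^sub>1) \<otimes> S\<^sup>-\<^sup>1(E\<^sub>2)\<close> plays the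
  role of a separability idempotent of \<open>A\<^sub>s\<close>, which is what makes the balanced tensor product computable.\<close>

lemma cointegral_expansion:
  assumes h: "\<And>a. a * h = \<epsilon>\<^sub>t a \<rhd> h"
  obtains I p w where "finite I"
    "\<And>z. z \<in> I \<Longrightarrow> w z \<in> source_algebra \<Delta> E" "\<And>z. z \<in> I \<Longrightarrow> Sx (Sx (w z)) = z"
    "\<And>z a. z \<in> I \<Longrightarrow> a * p z = \<epsilon>\<^sub>t a \<rhd> p z"
    "h = (\<Sum>z\<in>I. p z \<lhd> Sx (w z))"
    "\<And>b d. in_snd h \<rhd> E \<rhd> (b \<otimes> d) = (\<Sum>z\<in>I. (z \<rhd> b) \<otimes> (p z * d))"
proof -
  obtain I p where I: "finite I" "I \<subseteq> range eps_s" "\<not> cvec.dependent I"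
    and hE: "\<And>b d. in_snd h \<rhd> E \<rhd> (b \<otimes> d) = (\<Sum>z\<in>I. (z \<rhd> b) \<otimes> (p z * d))"
    using E_expansion by blast
  have "\<exists>w. w \<in> source_algebra \<Delta> E \<and> Sx (Sx w) = z" if z_I: "z \<in> I" for z
  proof -
    obtain x where z: "z = eps_s x" using I(2) z_I by blast
    \<comment> \<open>By \<open>eps_t_s\<close> and \<open>eps_s_s\<close>, S^2 passes inside
      \<open>eps_s\<close>, so a preimage of a value of \<open>eps_s\<close> is again such a value
      and lies in the source algebra.\<close>
    have "Sx (Sx (eps_s (s' (s' x)))) = eps_s x" by (simp flip: eps_t_s eps_s_s)
    then show ?thesis using eps_s_source z by blast
  qed
  then obtain w where w: "\<And>z. z \<in> I \<Longrightarrow> w z \<in> source_algebra \<Delta> E" "\<And>z. z \<in> I \<Longrightarrow> Sx (Sx (w z)) = z"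
    by metis
  \<comment> \<open>1 \<otimes> a and 1 \<otimes> \<open>\<epsilon>\<^sub>t\<close>(a) act alike on
    (1 \<otimes> h) E, since both meet h first. Independence of the z then compares
    coefficients.\<close>
  have p: "a * p z = \<epsilon>\<^sub>t a \<rhd> p z" if "z \<in> I" for z a
  proof -
    have "(\<Sum>z\<in>I. (z \<rhd> b) \<otimes> ((a * p z - \<epsilon>\<^sub>t a \<rhd> p z) * d)) = 0" for b d
    proof -
      have "1 \<otimes>\<^sub>M embed (a * h) = in_snd a * (1 \<otimes>\<^sub>M embed h :: ('a, 'a) tensor multiplier)"
        "1 \<otimes>\<^sub>M embed (\<epsilon>\<^sub>t a \<rhd> h) = (1 \<otimes>\<^sub>M \<epsilon>\<^sub>t a) * (1 \<otimes>\<^sub>M embed h :: ('a, 'a) tensor multiplier)"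
        by (simp_all add: tensor_multiplier_mult embed_mult embed_multiplier)
      then have "in_snd a \<rhd> in_snd h \<rhd> E \<rhd> (b \<otimes> d) = (1 \<otimes>\<^sub>M \<epsilon>\<^sub>t a) \<rhd> in_snd h \<rhd> E \<rhd> (b \<otimes> d)"
        using h[of a] by (metis times_multL)
      then have "(\<Sum>z\<in>I. (z \<rhd> b) \<otimes> (a * (p z * d))) = (\<Sum>z\<in>I. (z \<rhd> b) \<otimes> (\<epsilon>\<^sub>t a \<rhd> (p z * d)))"
        unfolding hE by (simp add: clinear_sum[OF clinear_multL] leg_mult_simps embed_multL)
      then show ?thesis
        by (simp add: left_diff_distrib tensor_prod_diff_right sum_subtractf mult.assoc multL_mult)
    qed
    from multiplier_independent[OF I(1,3) this that] show ?thesis by simp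
  qed
  have hE': "(b \<otimes> h) \<lhd> E = (\<Sum>z\<in>I. (b \<lhd> z) \<otimes> p z)" for b
  proof (rule nondegenerate_eqI(1)[OF nd2])
    show "((b \<otimes> h) \<lhd> E) * \<xi> = (\<Sum>z\<in>I. (b \<lhd> z) \<otimes> p z) * \<xi>" for \<xi>
    proof (rule tensor_eqI[where t = \<xi>])
      fix x d
      show "((b \<otimes> h) \<lhd> E) * (x \<otimes> d) = (\<Sum>z\<in>I. (b \<lhd> z) \<otimes> p z) * (x \<otimes> d)"
        by (simp add: mult_balanced tensor_prod_times hE clinear_sum[OF clinear_multL]
            sum_distrib_right tensor_times_prod leg_mult_simps embed_multL)
    qed (simp_all add: clinear_rules)
  qed
  \<comment> \<open>Contract (b \<otimes> h) E by u S(v): \<open>antipode_cancel'\<close> gives b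
    S(h), the expansion gives \<Sum> b z S(p_z). With z = S^2(w_z) the latter sum is b times S of
    \<Sum> p_z S(w_z).\<close>
  have "(\<Sum>z\<in>I. z \<rhd> s (p z)) = s h"
  proof (rule nondegenerate_eqI(2)[OF nd])
    fix b
    have lin: "clinear (\<lambda>x. tensor_product (tensor_map (\<lambda>x. x) s x))" by (intro clinear_rules)
    show "b * (\<Sum>z\<in>I. z \<rhd> s (p z)) = b * s h"
      unfolding antipode_cancel'[symmetric] hE' clinear_sum[OF lin]
      by (simp add: sum_distrib_left tensor_rules tensor_product_prod mult_balanced)
  qed
  also have "(\<Sum>z\<in>I. z \<rhd> s (p z)) = s (\<Sum>z\<in>I. p z \<lhd> Sx (w z))"
    by (simp add: clinear_sum[OF clinear_s] w(2) flip: Sx_left)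
  finally have "h = (\<Sum>z\<in>I. p z \<lhd> Sx (w z))" by (metis s'_s)
  then show ?thesis using that I(1) w p hE by blast
qed


subsection \<open>Slices of the coproduct\<close>

lemma slice_coproduct:
  assumes \<omega>: "clinear \<omega>"
  shows "slice_coproduct \<Delta> \<omega> a \<rhd> b = slice_left \<omega> (t1 (a \<otimes> b))"
    and "b \<lhd> slice_coproduct \<Delta> \<omega> a = slice_left \<omega> (t4 (a \<otimes> b))"
proof -
  have "element (\<Delta> a * in_snd b) = t1 (a \<otimes> b)" "element (in_snd b * \<Delta> a) = t4 (a \<otimes> b)" for b
    by (simp_all add: element_embed[OF nd2] flip: embed_t1 embed_t4)
  then have eq: "slice_coproduct \<Delta> \<omega> a
      = multiplier_of (\<lambda>b. slice_left \<omega> (t1 (a \<otimes> b))) (\<lambda>b. slice_left \<omega> (t4 (a \<otimes> b)))"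
    unfolding slice_coproduct_def multiplier_of_def by simp
  have "slice_left \<omega> (t4 (a \<otimes> b)) * c = b * slice_left \<omega> (t1 (a \<otimes> c))" for b c
    using slice_left_mult(2)[OF \<omega>, of "t4 (a \<otimes> b)" "embed c"]
        slice_left_mult(1)[OF \<omega>, of "embed b" "t1 (a \<otimes> c)"]
    by (simp add: t4_right embed_multL embed_multR)
  from multiplier_of[OF nd this]
  show "slice_coproduct \<Delta> \<omega> a \<rhd> b = slice_left \<omega> (t1 (a \<otimes> b))"
    "b \<lhd> slice_coproduct \<Delta> \<omega> a = slice_left \<omega> (t4 (a \<otimes> b))"
    unfolding eq by auto
qed

lemma slice_coproduct_linear:
  assumes "clinear \<omega>" "clinear \<omega>'"
  shows "slice_coproduct \<Delta> (\<omega> + \<omega>') a = slice_coproduct \<Delta> \<omega> a + slice_coproduct \<Delta> \<omega>' a"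
    "slice_coproduct \<Delta> (k *\<^sub>C \<omega>) a = k *\<^sub>C slice_coproduct \<Delta> \<omega> a"
    "slice_coproduct \<Delta> \<omega> (a + a') = slice_coproduct \<Delta> \<omega> a + slice_coproduct \<Delta> \<omega> a'"
    "slice_coproduct \<Delta> \<omega> (k *\<^sub>C a) = k *\<^sub>C slice_coproduct \<Delta> \<omega> a"
proof -
  note lin = clinear_functional_add[OF assms] clinear_functional_scale[OF assms(1)]
  note eqI = multiplier_eqI(1)[OF nd]
  show "slice_coproduct \<Delta> (\<omega> + \<omega>') a = slice_coproduct \<Delta> \<omega> a + slice_coproduct \<Delta> \<omega>' a"
    by (rule eqI) (simp add: slice_coproduct lin assms slice_left_functional_add plus_multL)
  show "slice_coproduct \<Delta> (k *\<^sub>C \<omega>) a = k *\<^sub>C slice_coproduct \<Delta> \<omega> a"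
    by (rule eqI) (simp add: slice_coproduct lin assms slice_left_functional_scale scaleC_multL)
  show "slice_coproduct \<Delta> \<omega> (a + a') = slice_coproduct \<Delta> \<omega> a + slice_coproduct \<Delta> \<omega> a'"
    by (rule eqI) (simp add: slice_coproduct assms plus_multL tensor_prod_add_left
        clinear_add[OF clinear_t1] clinear_add[OF clinear_slice_left])
  show "slice_coproduct \<Delta> \<omega> (k *\<^sub>C a) = k *\<^sub>C slice_coproduct \<Delta> \<omega> a"
    by (rule eqI) (simp add: slice_coproduct assms scaleC_multL tensor_prod_scale_left
        clinear_scaleC[OF clinear_t1] clinear_scaleC[OF clinear_slice_left])
qed

lemma slice_coproduct_balanced:
  assumes \<omega>: "clinear \<omega>" and y: "y \<in> source_algebra \<Delta> E"
  shows "slice_coproduct \<Delta> (dual_action S \<omega> y) a = slice_coproduct \<Delta> \<omega> (cointegral_action S y a)"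
proof (rule multiplier_eqI(1)[OF nd])
  fix b
  have \<omega>': "clinear (dual_action S \<omega> y)"
    unfolding dual_action_def by (rule clinear_compose[OF \<omega> clinear_multR])
  have "t1 ((a \<lhd> Sx y) \<otimes> b) = t1 (a \<otimes> b) \<lhd> (Sx y \<otimes>\<^sub>M 1)"
    by (rule embed_eqI) (simp add: embed_multiplier[symmetric] embed_t1 \<Delta>_Sx_source[OF y]
        mult.assoc tensor_multiplier_mult)
  moreover have "slice_left (dual_action S \<omega> y) r = slice_left \<omega> (r \<lhd> (Sx y \<otimes>\<^sub>M 1))"
      for r :: "('a, 'a) tensor"
    by (rule tensor_eqI[where t = r])
      (simp_all add: clinear_rules clinear_slice_left[OF \<omega>]
          clinear_compose[OF clinear_slice_left[OF \<omega>]] clinear_slice_left[OF \<omega>']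
          slice_left_prod[OF \<omega>] slice_left_prod[OF \<omega>'] leg_mult_simps, simp add:
          dual_action_def)
  ultimately show "slice_coproduct \<Delta> (dual_action S \<omega> y) a \<rhd> b
      = slice_coproduct \<Delta> \<omega> (cointegral_action S y a) \<rhd> b"
    by (simp add: slice_coproduct \<omega> \<omega>' cointegral_action_def)
qed

text \<open>The test elements \<open>s c\<close> and \<open>d\<close> cover the legs of
  \<open>E\<close>. Since S^-1(x S(c)) = c S^-1(x), the first one becomes the argument c at which
  the resulting functionals are evaluated.\<close>

lemma kernel_expansion:
  fixes \<omega> :: "nat \<Rightarrow> 'a \<Rightarrow> complex"
  assumes \<omega>: "\<And>i. i < n \<Longrightarrow> clinear (\<omega> i)" and h: "\<And>i a. i < n \<Longrightarrow> a * h i = \<epsilon>\<^sub>t a \<rhd> h i"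
    and kernel: "(\<Sum>i<n. slice_coproduct \<Delta> (\<omega> i) (h i)) = 0"
  shows "(\<Sum>i<n. slice_left (\<lambda>x. \<omega> i (s' x)) (in_snd (h i) \<rhd> E \<rhd> (s c \<otimes> d))) = 0"
proof -
  \<comment> \<open>The cointegral identity trades the factor e = S(a) on the first leg for a on the
    second, where it can be pulled out of the slice.\<close>
  have slice_t2: "(\<Sum>i<n. slice_left (\<omega> i) (t2 (e \<otimes> h i))) = 0" for e
  proof (rule nondegenerate_eqI(1)[OF nd])
    fix c
    define a where "a = s' e"
    have "slice_left (\<omega> i) (t2 (e \<otimes> h i)) * c = a * (slice_coproduct \<Delta> (\<omega> i) (h i) \<rhd> c)" if i:
        "i < n" for i
    proof -
      have "slice_left (\<omega> i) (t2 (e \<otimes> h i)) * c = slice_left (\<omega> i) (t2 (e \<otimes> h i) \<lhd> in_snd c)"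
        by (simp add: slice_left_mult \<omega>[OF i] embed_multR)
      also have "\<dots> = slice_left (\<omega> i) (in_fst (s a) \<rhd> t1 (h i \<otimes> c))"
        by (simp add: a_def t1_t2)
      also have "\<dots> = a * (slice_coproduct \<Delta> (\<omega> i) (h i) \<rhd> c)"
        unfolding cointegral_coproduct[OF h[OF i], symmetric]
        by (simp add: slice_left_mult \<omega>[OF i] embed_multL slice_coproduct)
      finally show ?thesis .
    qed
    then have "(\<Sum>i<n. slice_left (\<omega> i) (t2 (e \<otimes> h i))) * c
        = (\<Sum>i<n. a * (slice_coproduct \<Delta> (\<omega> i) (h i) \<rhd> c))"
      by (simp add: sum_distrib_right)
    also have "\<dots> = a * ((\<Sum>i<n. slice_coproduct \<Delta> (\<omega> i) (h i)) \<rhd> c)"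
    proof -
      have lin: "clinear (\<lambda>m :: 'a multiplier. m \<rhd> c)"
          by (rule clinearI) (simp_all add: multiplier_simps)
      show ?thesis by (simp add: clinear_sum[OF lin] sum_distrib_left)
    qed
    finally show "(\<Sum>i<n. slice_left (\<omega> i) (t2 (e \<otimes> h i))) * c = 0 * c"
        by (simp add: kernel zero_multL)
  qed
  \<comment> \<open>\<open>\<eta>\<close> is \<Sum> h1 \<otimes> h2 S(c) \<otimes> h3 d.
    \<open>J\<close> keeps the argument e of \<omega>(e x) free, so that an e depending on the
    second leg can be substituted later.\<close>
  define \<eta> where "\<eta> i = leg12 t1 (insert2 (s c) (t1 (h i \<otimes> d)))" for i
  define J where "J i x = (\<lambda>e. \<omega> i (e * x))" for i and x :: 'a
  have J: "clinear (J i)" if "i < n" for i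
    unfolding J_def by (rule clinearI)
      (simp_all add: fun_eq_iff distrib_left mult_scaleC_right clinear_add[OF \<omega>[OF that]]
          clinear_scaleC[OF \<omega>[OF that]] scaleC_fun_def)
  have "(\<Sum>i<n. tensor_map (J i) (\<lambda>x. x) (\<eta> i)) = 0"
  proof (rule tensor_fun_eq_0)
    fix e
    have ev: "clinear (\<lambda>f :: 'a \<Rightarrow> complex. f e)" by (simp add: clinear_iff scaleC_fun_def)
    have "slice_left (\<lambda>f. f e) (tensor_map (J i) (\<lambda>x. x) (\<eta> i))
        = \<Delta> (slice_left (\<omega> i) (t2 (e \<otimes> h i))) \<rhd> (s c \<otimes> d)"
      if i: "i < n" for i
    proof -
      have 1: "slice_left (\<lambda>f. f e) (tensor_map (J i) (\<lambda>x. x) r)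
          = slice_left (\<omega> i) (in_fst e \<rhd> r)" for r :: "('a, ('a, 'a) tensor) tensor"
        by (rule tensor_eqI[where t = r])
          (simp_all add: tensor_rules clinear_slice_left ev J[OF i] \<omega>[OF i] slice_left_prod
              leg_mult_simps embed_multL, simp add: J_def)
      have 2: "slice_left (\<omega> i) (leg23 t1 (insert3 d u) \<lhd> (1 \<otimes>\<^sub>M embed (s c) \<otimes>\<^sub>M 1))
          = \<Delta> (slice_left (\<omega> i) u) \<rhd> (s c \<otimes> d)" for u
        by (rule tensor_eqI[where t = u])
          (simp_all add: tensor_rules clinear_slice_left \<omega>[OF i] slice_left_prod leg_mult_simps
              \<Delta>_multL clinear_scaleC[OF clinear_\<Delta>] scaleC_multL)
      show ?thesis unfolding 1 \<eta>_def leg12_t1_insert2 coassoc_t1 2 ..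
    qed
    then have "slice_left (\<lambda>f. f e) (\<Sum>i<n. tensor_map (J i) (\<lambda>x. x) (\<eta> i))
        = (\<Sum>i<n. \<Delta> (slice_left (\<omega> i) (t2 (e \<otimes> h i))) \<rhd> (s c \<otimes> d))"
      by (simp add: clinear_sum[OF clinear_slice_left[OF ev]])
    also have "\<dots> = \<Delta> (\<Sum>i<n. slice_left (\<omega> i) (t2 (e \<otimes> h i))) \<rhd> (s c \<otimes> d)"
      by (rule clinear_sum[symmetric, OF clinear_\<Delta>_L[OF clinear_ident]])
    finally show "slice_left (\<lambda>f. f e) (\<Sum>i<n. tensor_map (J i) (\<lambda>x. x) (\<eta> i)) = 0"
      by (simp add: slice_t2 clinear_zero[OF clinear_\<Delta>] zero_multL)
  qed
  \<comment> \<open>The first leg ranges over all functions, but f(S^-1(y)) is linear in y only for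
    linear f. A projection onto the dual space makes the contraction \<open>L\<close> trilinear and
    leaves the functionals at hand unchanged.\<close>
  moreover obtain P :: "('a \<Rightarrow> complex) \<Rightarrow> 'a \<Rightarrow> complex" where P: "clinear P" "\<And>f. P f \<in> dual_space"
      "\<And>f. f \<in> dual_space \<Longrightarrow> P f = f"
    using linear_projection[OF subspace_dual] by blast
  \<comment> \<open>\<open>L\<close> substitutes e = S^-1(y): \<omega>(S^-1(h2 S(c)) h1) =
    \<omega>(S^-1(S(h1) h2 S(c))), where the two legs of h combine to \<open>eps_s\<close>.\<close>
  define L where "L = tensor_lift (\<lambda>f t. tensor_lift (\<lambda>y q. P f (s' y) *\<^sub>C (q :: 'a)) t)"
  have "clinear (\<lambda>f. P f (s' y) *\<^sub>C q)" "clinear (\<lambda>y. P f (s' y) *\<^sub>C q)"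
      "clinear (\<lambda>q. P f (s' y) *\<^sub>C q)"
    for f y and q :: 'a
  proof -
    have "clinear (P f)" using P(2) by (simp add: dual_space_def)
    then show "clinear (\<lambda>y. P f (s' y) *\<^sub>C q)"
      by (intro clinear_compose[OF clinear_scaleC_left] clinear_compose[OF _ clinear_s'])
    show "clinear (\<lambda>f. P f (s' y) *\<^sub>C q)"
      by (rule clinearI) (simp_all add: clinear_add[OF P(1)] clinear_scaleC[OF P(1)]
          scaleC_add_left scaleC_fun_apply scaleC_scaleC scaleC_complex_def)
  qed (rule clinear_scale_compose[OF clinear_ident])
  note L = tensor_lift3[OF this, folded L_def]
  have "L (tensor_map (J i) (\<lambda>x. x) (\<eta> i))
      = slice_left (\<lambda>x. \<omega> i (s' x)) (in_snd (h i) \<rhd> E \<rhd> (s c \<otimes> d))"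
    if i: "i < n" for i
  proof -
    have \<omega>s: "clinear (\<lambda>x. \<omega> i (s' x))" by (rule clinear_compose[OF \<omega>[OF i] clinear_s'])
    have PJ: "P (J i x) = J i x" for x
      by (rule P(3)) (simp add: dual_space_def J_def clinear_compose[OF \<omega>[OF i] clinear_mult_right])
    have 1: "L (tensor_map (J i) (\<lambda>x. x) (insert3 q u))
        = \<omega> i (s' (tensor_product (tensor_map s (\<lambda>x. x) u))) *\<^sub>C q" for q u
      by (rule tensor_eqI[where t = u])
        (simp_all add: clinear_rules clinear_compose[OF L(1)] J[OF i] L(2) insert3_prod
            tensor_map_prod PJ tensor_product_prod
          s'_mult clinear_compose[OF clinear_scaleC_left] clinear_compose[OF \<omega>[OF i]], simp add:
              J_def)
    have 2: "L (tensor_map (J i) (\<lambda>x. x) (leg12 t1 (insert2 (s c) r)))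
        = slice_left (\<lambda>x. \<omega> i (s' x)) (tensor_map (\<lambda>p. eps_s p \<rhd> s c) (\<lambda>x. x) r)"
        for r :: "('a, 'a) tensor"
      by (rule tensor_eqI[where t = r])
        (simp_all add: tensor_rules clinear_compose[OF L(1)] J[OF i]
            clinear_compose[OF clinear_slice_left[OF \<omega>s]] leg12_prod 1 slice_left_prod[OF \<omega>s]
            eps_s_left)
    show ?thesis unfolding \<eta>_def 2 E_eps_s ..
  qed
  then have "(\<Sum>i<n. slice_left (\<lambda>x. \<omega> i (s' x)) (in_snd (h i) \<rhd> E \<rhd> (s c \<otimes> d)))
      = L (\<Sum>i<n. tensor_map (J i) (\<lambda>x. x) (\<eta> i))"
    by (simp add: clinear_sum[OF L(1)])
  ultimately show ?thesis by (simp add: clinear_zero[OF L(1)])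
qed

end

lemma tensor_sub_sum:
  assumes V: "cvec.subspace V" and t: "t \<in> tensor_sub V W"
  obtains n :: nat and v w where "\<And>i. i < n \<Longrightarrow> v i \<in> V" "\<And>i. i < n \<Longrightarrow> w i \<in> W" "t = (\<Sum>i<n. v i \<otimes> w i)"
proof -
  have "\<exists>n v w. (\<forall>i<n. v i \<in> V \<and> w i \<in> W) \<and> t = (\<Sum>i<n::nat. v i \<otimes> w i)"
    using t unfolding tensor_sub_def
  proof (induction rule: cvec.span_induct_alt)
    case base
    show ?case by (rule exI[of _ 0]) simp
  next
    case (step c x y)
    then obtain n :: nat and v w where y: "\<And>i. i < n \<Longrightarrow> v i \<in> V \<and> w i \<in> W" "y = (\<Sum>i<n. v i \<otimes> w i)"
        by blast
    obtain v' w' where x: "x = v' \<otimes> w'" "v' \<in> V" "w' \<in> W" using step by blast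
    have "c *\<^sub>C x + y = (\<Sum>i<Suc n. (v(n := c *\<^sub>C v')) i \<otimes> (w(n := w')) i)"
      by (simp add: x y(2) tensor_prod_scale_left)
    moreover have "\<forall>i<Suc n. (v(n := c *\<^sub>C v')) i \<in> V \<and> (w(n := w')) i \<in> W"
      using y(1) x(2,3) V by (auto simp: less_Suc_eq cvec.subspace_def)
    ultimately show ?case by blast
  qed
  then show ?thesis using that by blast
qed

context antipode_data
begin

subsection \<open>The balanced tensor product\<close>

definition "balanced_relators = {dual_action S m y \<otimes> n - m \<otimes> cointegral_action S y n |m y n.
  m \<in> dual_space \<and> y \<in> source_algebra \<Delta> E \<and> n \<in> cointegral_space \<Delta> S}"

lemma kernel_balanced:
  fixes \<omega> :: "nat \<Rightarrow> 'a \<Rightarrow> complex"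
  assumes \<omega>: "\<And>i. i < n \<Longrightarrow> \<omega> i \<in> dual_space" and h: "\<And>i. i < n \<Longrightarrow> h i \<in> cointegral_space \<Delta> S"
    and kernel: "(\<Sum>i<n. slice_coproduct \<Delta> (\<omega> i) (h i)) = 0"
  shows "(\<Sum>i<n. \<omega> i \<otimes> h i) \<in> cvec.span balanced_relators"
proof -
  have \<omega>': "clinear (\<omega> i)" if "i < n" for i using \<omega>[OF that] by (simp add: dual_space_def)
  have h': "a * h i = \<epsilon>\<^sub>t a \<rhd> h i" if "i < n" for i a using h[OF that]
      by (simp add: cointegral_space_iff)
  \<comment> \<open>Bundles the expansion of one cointegral, so that a single choice over the
    indices provides all expansions.\<close>
  define good where "good i I p w \<longleftrightarrow> finite I
    \<and> (\<forall>z\<in>I. w z \<in> source_algebra \<Delta> E \<and> Sx (Sx (w z)) = z \<and> p z \<in> cointegral_space \<Delta> S)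
    \<and> h i = (\<Sum>z\<in>I. p z \<lhd> Sx (w z))
    \<and> (\<forall>b d. in_snd (h i) \<rhd> E \<rhd> (b \<otimes> d) = (\<Sum>z\<in>I. (z \<rhd> b) \<otimes> (p z * d)))" for i I p w
  have "\<forall>i\<in>{..<n}. \<exists>q. good i (fst q) (fst (snd q)) (snd (snd q))"
  proof
    fix i assume "i \<in> {..<n}"
    then have i: "i < n" by simp
    obtain I p w where "finite I"
      "\<And>z. z \<in> I \<Longrightarrow> w z \<in> source_algebra \<Delta> E" "\<And>z. z \<in> I \<Longrightarrow> Sx (Sx (w z)) = z"
      "\<And>z a. z \<in> I \<Longrightarrow> a * p z = \<epsilon>\<^sub>t a \<rhd> p z" "h i = (\<Sum>z\<in>I. p z \<lhd> Sx (w z))"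
      "\<And>b d. in_snd (h i) \<rhd> E \<rhd> (b \<otimes> d) = (\<Sum>z\<in>I. (z \<rhd> b) \<otimes> (p z * d))"
      by (rule cointegral_expansion[OF h'[OF i]]) (rule that)
    then have "good i I p w" unfolding good_def cointegral_space_iff by blast
    then show "\<exists>q. good i (fst q) (fst (snd q)) (snd (snd q))" by (intro exI[of _ "(I, p, w)"]) simp
  qed
  from bchoice[OF this] obtain q where q: "\<forall>i\<in>{..<n}. good i (fst (q i)) (fst (snd (q i)))
      (snd (snd (q i)))" ..
  define I where "I i = fst (q i)" for i
  define p where "p i = fst (snd (q i))" for i
  define w where "w i = snd (snd (q i))" for i
  have good: "good i (I i) (p i) (w i)" if "i < n" for i using q that
      by (simp add: I_def p_def w_def)
  define U where "U = (\<Sum>i<n. \<Sum>z\<in>I i. dual_action S (\<omega> i) (w i z) \<otimes> p i z)"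
  \<comment> \<open>Evaluated at c and multiplied by d, \<open>U\<close> is the sum in
    \<open>kernel_expansion\<close>: z = S^2(w_z) gives S^-1(z S(c)) = c S(w_z).\<close>
  have U: "U = 0"
  proof (rule tensor_fun_eq_0, rule nondegenerate_eqI(1)[OF nd])
    fix c d
    have ev: "clinear (\<lambda>f :: 'a \<Rightarrow> complex. f c)" by (simp add: clinear_iff scaleC_fun_def)
    have "(\<Sum>z\<in>I i. \<omega> i (c \<lhd> Sx (w i z)) *\<^sub>C (p i z * d))
        = slice_left (\<lambda>x. \<omega> i (s' x)) (in_snd (h i) \<rhd> E \<rhd> (s c \<otimes> d))" if i: "i < n" for i
    proof -
      have lin: "clinear (\<lambda>x. \<omega> i (s' x))" by (rule clinear_compose[OF \<omega>'[OF i] clinear_s'])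
      have "s' (z \<rhd> s c) = c \<lhd> Sx (w i z)" if "z \<in> I i" for z
      proof -
        have "z \<rhd> s c = s (c \<lhd> Sx (w i z))" using good[OF i] that
            by (simp add: good_def flip: Sx_left)
        then show ?thesis by simp
      qed
      moreover have "in_snd (h i) \<rhd> E \<rhd> (s c \<otimes> d) = (\<Sum>z\<in>I i. (z \<rhd> s c) \<otimes> (p i z * d))"
        using good[OF i] unfolding good_def by blast
      ultimately show ?thesis
        by (simp add: clinear_sum[OF clinear_slice_left[OF lin]] slice_left_prod[OF lin])
    qed
    then have "slice_left (\<lambda>f. f c) U * d
        = (\<Sum>i<n. slice_left (\<lambda>x. \<omega> i (s' x)) (in_snd (h i) \<rhd> E \<rhd> (s c \<otimes> d)))"
      by (simp add: U_def clinear_sum[OF clinear_slice_left[OF ev]] slice_left_prod[OF ev]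
          sum_distrib_right mult_scaleC_left dual_action_def)
    also have "\<dots> = 0" by (rule kernel_expansion[OF \<omega>' h' kernel])
    finally show "slice_left (\<lambda>f. f c) U * d = 0 * d" by simp
  qed
  have "U - (\<Sum>i<n. \<omega> i \<otimes> h i) \<in> cvec.span balanced_relators"
  proof -
    have "U - (\<Sum>i<n. \<omega> i \<otimes> h i)
        = (\<Sum>i<n. \<Sum>z\<in>I i. dual_action S (\<omega> i) (w i z) \<otimes> p i z - \<omega> i \<otimes> cointegral_action S (w i z)
            (p i z))"
    proof -
      have "\<omega> i \<otimes> h i = (\<Sum>z\<in>I i. \<omega> i \<otimes> cointegral_action S (w i z) (p i z))" if "i < n" for i
      proof -
        have "h i = (\<Sum>z\<in>I i. p i z \<lhd> Sx (w i z))" using good[OF that] unfolding good_def by blast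
        then show ?thesis by (simp add: cointegral_action_def
            clinear_sum[OF clinear_tensor_prod_right])
      qed
      then show ?thesis by (simp add: U_def sum_subtractf)
    qed
    also have "\<dots> \<in> cvec.span balanced_relators"
    proof (intro cvec.span_sum cvec.span_base)
      fix i z assume "i \<in> {..<n}" and z: "z \<in> I i"
      then have i: "i < n" by simp
      have "w i z \<in> source_algebra \<Delta> E" "p i z \<in> cointegral_space \<Delta> S"
        using good[OF i] z unfolding good_def by blast+
      with \<omega>[OF i] show "dual_action S (\<omega> i) (w i z) \<otimes> p i z - \<omega> i \<otimes> cointegral_action S (w i z)
          (p i z) \<in> balanced_relators"
        unfolding balanced_relators_def by blast
    qed
    finally show ?thesis .
  qed
  from cvec.span_neg[OF this] show ?thesis by (simp add: U)
qed

lemma right_action_dual: "right_action (source_algebra \<Delta> E) (dual_space :: ('a \<Rightarrow> complex) set)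
    (dual_action S)"
proof -
  have add: "m (x + y) = m x + m y" and scale: "m (c *\<^sub>C x) = c * m x" if "m \<in> dual_space"
      for m :: "'a \<Rightarrow> complex" and x y c
    using that by (simp_all add: dual_space_def clinear_iff scaleC_complex_def)
  show ?thesis
    unfolding right_action_def
  proof (intro conjI ballI allI)
    show "dual_action S m y \<in> dual_space" if "m \<in> dual_space" for m :: "'a \<Rightarrow> complex" and y
      using that clinear_compose[OF _ clinear_multR] by (auto simp: dual_space_def dual_action_def)
  qed (simp_all add: dual_action_def fun_eq_iff scaleC_fun_def scaleC_complex_def
      clinear_add[OF clinear_Sx] clinear_scaleC[OF clinear_Sx] plus_multR scaleC_multR add scale
      Sx_one one_multR Sx_mult times_multR)
qed

lemma left_action_cointegral: "left_action (source_algebra \<Delta> E) (cointegral_space \<Delta> S)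
    (cointegral_action S)"
  unfolding left_action_def
proof (intro conjI ballI allI)
  show "cointegral_action S y h \<in> cointegral_space \<Delta> S" if "h \<in> cointegral_space \<Delta> S" for h y
    unfolding cointegral_space_iff
  proof
    fix a
    have "a * (h \<lhd> Sx y) = (a * h) \<lhd> Sx y" by (simp add: multR_mult)
    also have "\<dots> = \<epsilon>\<^sub>t a \<rhd> (h \<lhd> Sx y)" using that
        by (simp add: cointegral_space_iff mult_left_right[OF nd])
    finally show "a * cointegral_action S y h = \<epsilon>\<^sub>t a \<rhd> cointegral_action S y h"
      by (simp add: cointegral_action_def)
  qed
qed (simp_all add: cointegral_action_def clinear_add[OF clinear_Sx] clinear_scaleC[OF clinear_Sx]
    multiplier_simps Sx_one Sx_mult)

lemma slice_map_injective:
  fixes bal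
  defines "bal \<equiv> balanced_rel (dual_space :: ('a \<Rightarrow> complex) set) (dual_action S)
      (source_algebra \<Delta> E)
    (cointegral_action S) (cointegral_space \<Delta> S)"
  shows "\<exists>F. (\<forall>\<omega>\<in>dual_space. \<forall>h\<in>cointegral_space \<Delta> S. F (bal `` {\<omega> \<otimes> h}) = slice_coproduct \<Delta> \<omega> h)
    \<and> (\<forall>s\<in>tensor_sub dual_space (cointegral_space \<Delta> S). \<forall>t\<in>tensor_sub dual_space
        (cointegral_space \<Delta> S).
         F (bal `` {s + t}) = F (bal `` {s}) + F (bal `` {t}))
    \<and> (\<forall>c. \<forall>t\<in>tensor_sub dual_space (cointegral_space \<Delta> S). F (bal `` {c *\<^sub>C t})
        = c *\<^sub>C F (bal `` {t}))
    \<and> inj_on F (balanced_tensor dual_space (dual_action S) (source_algebra \<Delta> E)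
        (cointegral_action S) (cointegral_space \<Delta> S))"
proof -
  let ?T = "tensor_sub dual_space (cointegral_space \<Delta> S) :: ('a \<Rightarrow> complex, 'a) tensor set"
  let ?N = "cvec.span balanced_relators"
  have bal: "bal `` {t} = {u \<in> ?T. t - u \<in> ?N}" if "t \<in> ?T" for t
    using that unfolding bal_def balanced_rel_def balanced_relators_def by auto
  have T: "cvec.subspace ?T" unfolding tensor_sub_def by (rule cvec.subspace_span)
  \<comment> \<open>The type of the first leg admits arbitrary functions, whose slices need not
    behave bilinearly. Projecting onto the dual space extends the slice map to a bilinear map on the
    whole type.\<close>
  obtain P :: "('a \<Rightarrow> complex) \<Rightarrow> 'a \<Rightarrow> complex" where P: "clinear P" "\<And>f. P f \<in> dual_space"
      "\<And>f. f \<in> dual_space \<Longrightarrow> P f = f"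
    using linear_projection[OF subspace_dual] by blast
  have P_lin: "clinear (P f)" for f using P(2) by (simp add: dual_space_def)
  define \<Phi> where "\<Phi> = tensor_lift (\<lambda>\<omega> h. slice_coproduct \<Delta> (P \<omega>) h)"
  have "cbilinear (\<lambda>\<omega> h. slice_coproduct \<Delta> (P \<omega>) h)"
    by (rule cbilinearI)
      (simp_all add: clinear_add[OF P(1)] clinear_scaleC[OF P(1)]
          slice_coproduct_linear[OF P_lin P_lin])
  note \<Phi> = tensor_lift[OF this, folded \<Phi>_def]
  have \<Phi>_N: "\<Phi> t = 0" if "t \<in> ?N" for t
  proof -
    have "balanced_relators \<subseteq> {t. \<Phi> t = 0}"
    proof
      fix t assume "t \<in> balanced_relators"
      then obtain m y n where t: "t = dual_action S m y \<otimes> n - m \<otimes> cointegral_action S y n"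
        and m: "m \<in> dual_space" and y: "y \<in> source_algebra \<Delta> E"
        unfolding balanced_relators_def by blast
      have "dual_action S m y \<in> dual_space"
        using right_action_dual m y unfolding right_action_def by blast
      then show "t \<in> {t. \<Phi> t = 0}"
        using m y by (simp add: t clinear_diff[OF \<Phi>(1)] \<Phi>(2) P(3) slice_coproduct_balanced
            dual_space_def)
    qed
    then show ?thesis using cvec.span_minimal[OF _ subspace_kernel[OF \<Phi>(1) clinear_const_zero]]
        that by blast
  qed
  have \<Phi>_inj: "t \<in> ?N" if t: "t \<in> ?T" and 0: "\<Phi> t = 0" for t
  proof -
    obtain n :: nat and \<omega> h where *: "\<And>i. i < n \<Longrightarrow> \<omega> i \<in> dual_space" "\<And>i. i < n
        \<Longrightarrow> h i \<in> cointegral_space \<Delta> S"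
      "t = (\<Sum>i<n. \<omega> i \<otimes> h i)"
      by (rule tensor_sub_sum[OF subspace_dual t]) (rule that)
    have kernel: "(\<Sum>i<n. slice_coproduct \<Delta> (\<omega> i) (h i)) = 0"
      using 0 by (simp add: *(3) clinear_sum[OF \<Phi>(1)] \<Phi>(2) P(3)[OF *(1)])
    show ?thesis
      unfolding *(3)
    proof (rule kernel_balanced)
      show "\<omega> i \<in> dual_space" "h i \<in> cointegral_space \<Delta> S" if "i < n" for i by (rule * that)+
    qed (rule kernel)
  qed
  \<comment> \<open>Any representative may be chosen, because \<Phi> vanishes on the span of the
    relators.\<close>
  define F where "F X = \<Phi> (SOME u. u \<in> X)" for X
  have F: "F (bal `` {t}) = \<Phi> t" if t: "t \<in> ?T" for t
  proof -
    have "t \<in> bal `` {t}" using t by (simp add: bal cvec.span_zero)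
    then have "(SOME u. u \<in> bal `` {t}) \<in> bal `` {t}" by (rule someI)
    then have "\<Phi> (t - (SOME u. u \<in> bal `` {t})) = 0" using \<Phi>_N by (simp add: bal[OF t])
    then show ?thesis by (simp add: F_def clinear_diff[OF \<Phi>(1)])
  qed
  have "F (bal `` {\<omega> \<otimes> h}) = slice_coproduct \<Delta> \<omega> h" if "\<omega> \<in> dual_space" "h \<in> cointegral_space \<Delta> S"
      for \<omega> h
  proof -
    have "\<omega> \<otimes> h \<in> ?T" using that unfolding tensor_sub_def by (blast intro: cvec.span_base)
    then show ?thesis using that by (simp add: F \<Phi>(2) P(3))
  qed
  moreover have "F (bal `` {s + t}) = F (bal `` {s}) + F (bal `` {t})" if "s \<in> ?T" "t \<in> ?T" for s t
    using that cvec.subspace_add[OF T] by (simp add: F clinear_add[OF \<Phi>(1)])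
  moreover have "F (bal `` {c *\<^sub>C t}) = c *\<^sub>C F (bal `` {t})" if "t \<in> ?T" for c t
    using that cvec.subspace_scale[OF T] by (simp add: F clinear_scaleC[OF \<Phi>(1)])
  moreover have "inj_on F (balanced_tensor dual_space (dual_action S) (source_algebra \<Delta> E)
      (cointegral_action S) (cointegral_space \<Delta> S))"
  proof (rule inj_onI)
    fix X Y
    assume "X \<in> balanced_tensor dual_space (dual_action S) (source_algebra \<Delta> E)
        (cointegral_action S) (cointegral_space \<Delta> S)"
      and "Y \<in> balanced_tensor dual_space (dual_action S) (source_algebra \<Delta> E)
          (cointegral_action S) (cointegral_space \<Delta> S)"
      and eq: "F X = F Y"
    then obtain u v where u: "u \<in> ?T" "X = bal `` {u}" and v: "v \<in> ?T" "Y = bal `` {v}"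
      unfolding balanced_tensor_def bal_def by (auto elim!: quotientE)
    have "\<Phi> (u - v) = 0" using eq by (simp add: u v F clinear_diff[OF \<Phi>(1)])
    then have uv: "u - v \<in> ?N" using \<Phi>_inj cvec.subspace_diff[OF T u(1) v(1)] by blast
    have "u - x \<in> ?N \<longleftrightarrow> v - x \<in> ?N" for x
      using cvec.span_add[OF uv, of "v - x"] cvec.span_diff[OF _ uv, of "u - x"] by auto
    then show "X = Y" by (simp add: u v bal)
  qed
  ultimately show ?thesis by blast
qed

end

section \<open>Antipode data obtained from regularity\<close>

lemma (in regular_weak_multiplier_hopf_algebra) antipode_data:
  obtains s R1 R2 where "antipode_data \<Delta> \<epsilon> E G1 G2 S s R1 R2"
proof -
  have nd: "nondegenerate TYPE('a)"
    unfolding nondegenerate_def using nondegenerate_left nondegenerate_right by blast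
  define s where "s a = element (S a)" for a
  have S: "S a = embed (s a)" for a
  proof -
    obtain b where "S a = embed b" using regular by (auto simp: bij_betw_def)
    then show ?thesis by (simp add: s_def element_embed[OF nd])
  qed
  have "bij s"
  proof (rule bijI)
    show "inj s" using regular S by (auto simp: bij_betw_def inj_def)
    show "surj s"
    proof (rule surjI)
      fix b
      have "embed b \<in> range S" using regular by (simp add: bij_betw_def)
      then have "S (inv S (embed b)) = embed b" by (rule f_inv_into_f)
      then show "s (inv S (embed b)) = b" by (simp add: s_def element_embed[OF nd])
    qed
  qed
  moreover obtain R1 R2 where "is_R1 \<Delta> S R1" "is_R2 \<Delta> S R2"
      "\<And>a b. E \<rhd> (a \<otimes> b) = T1 \<Delta> (R1 (a \<otimes> b))" "\<And>a b. (a \<otimes> b) \<lhd> E = T2 \<Delta> (R2 (a \<otimes> b))"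
      "\<And>a b. tensor_lift (\<lambda>p q. S p \<rhd> q) (T1 \<Delta> (R1 (a \<otimes> b))) = S a \<rhd> b"
    using antipode unfolding antipode_def by blast
  ultimately have "antipode_data \<Delta> \<epsilon> E G1 G2 S s R1 R2"
    by unfold_locales (simp_all add: S)
  then show ?thesis by (rule that)
qed

theorem proposition3p8:
  fixes \<Delta> :: "'a::complex_algebra \<Rightarrow> ('a, 'a) tensor multiplier"
    and \<epsilon> :: "'a \<Rightarrow> complex"
    and E :: "('a, 'a) tensor multiplier"
    and G1 G2 :: "('a, 'a) tensor \<Rightarrow> ('a, 'a) tensor"
    and S :: "'a \<Rightarrow> 'a multiplier"
  assumes "regular_weak_multiplier_hopf_algebra \<Delta> \<epsilon> E G1 G2 S"
  shows "let A\<^sub>s = source_algebra \<Delta> E;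
      A' = (dual_space :: ('a \<Rightarrow> complex) set);
      H = cointegral_space \<Delta> S;
      bal = balanced_rel A' (dual_action S) A\<^sub>s (cointegral_action S) H
    in right_action A\<^sub>s A' (dual_action S)
      \<and> left_action A\<^sub>s H (cointegral_action S)
      \<and> (\<exists>F :: ('a \<Rightarrow> complex, 'a) tensor set \<Rightarrow> 'a multiplier.
          (\<forall>\<omega>\<in>A'. \<forall>h\<in>H. F (bal `` {\<omega> \<otimes> h}) = slice_coproduct \<Delta> \<omega> h)
          \<and> (\<forall>s\<in>tensor_sub A' H. \<forall>t\<in>tensor_sub A' H.
               F (bal `` {s + t}) = F (bal `` {s}) + F (bal `` {t}))
          \<and> (\<forall>c. \<forall>t\<in>tensor_sub A' H. F (bal `` {c *\<^sub>C t}) = c *\<^sub>C F (bal `` {t}))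
          \<and> inj_on F (balanced_tensor A' (dual_action S) A\<^sub>s (cointegral_action S) H))"
proof -
  interpret regular_weak_multiplier_hopf_algebra \<Delta> \<epsilon> E G1 G2 S by (rule assms)
  obtain s R1 R2 where data: "antipode_data \<Delta> \<epsilon> E G1 G2 S s R1 R2" by (rule antipode_data)
  show ?thesis
    unfolding Let_def
    using antipode_data.right_action_dual[OF data] antipode_data.left_action_cointegral[OF data]
      antipode_data.slice_map_injective[OF data] by (intro conjI)
qed

end
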